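(* Let $B>0$ and $1/2<\sigma<1$. Then $(q,\sigma,B)$ does not satisfy the Northcott property, i.e. $S_{q,\sigma,B}=\{[K]:|\zeta_K^*(\sigma)|\le B\}$ is infinite.
   Context: $q\equiv1\pmod 4$; $\sigma$ real (a real point $s=\sigma$ with $\sigma=\operatorname{Re}(s)$). $K$ ranges over isomorphism classes of global function fields in one variable with constant field $\mathbb F_q$; $\zeta_K^*(\sigma)$ is the first nonzero Taylor coefficient of $\zeta_K$ at $\sigma$. *)

theory Defs
  imports
    "HOL-Complex_Analysis.Complex_Analysis"
    "HOL-Number_Theory.Prime_Powers"
    "HOL-Algebra.Algebra"
    "HOL-Library.Multiset"
begin

text \<open>
  \<open>K\<close> is a function field in one variable over the field \<open>F \<subseteq> K\<close>: it contains
  an element \<open>x\<close> transcendental over \<open>F\<close> such that \<open>K\<close> is a finite extension of \<open>F(x)\<close>.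
\<close>

definition function_field :: "'a set \<Rightarrow> 'a ring \<Rightarrow> bool" where
  "function_field F K \<longleftrightarrow>
     field K \<and> subfield F K \<and>
     (\<exists>x\<in>carrier K. ring.transcendental K F x \<and>
        ring.finite_dimension K (generate_field K (insert x F)) (carrier K))"

text \<open>
  \<open>F\<close> is the full constant field of \<open>K\<close>, i.e. algebraically closed in \<open>K\<close>; a field with
  \<open>q\<close> elements is the field of order \<open>q\<close>, unique up to isomorphism.
\<close>

definition global_function_field :: "nat \<Rightarrow> 'a set \<Rightarrow> 'a ring \<Rightarrow> bool" where
  "global_function_field q F K \<longleftrightarrow>
     function_field F K \<and>
     (\<forall>a\<in>carrier K. ring.algebraic K F a \<longrightarrow> a \<in> F) \<and>
     finite F \<and> card F = q"

definition discrete_valuation_ring :: "'a ring \<Rightarrow> bool" where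
  "discrete_valuation_ring R \<longleftrightarrow>
     principal_domain R \<and> (\<exists>!P. maximalideal P R) \<and> \<not> field R"

text \<open>
  A prime of \<open>K\<close> is (the carrier \<open>V\<close> of) a discrete valuation ring containing \<open>F\<close> with quotient
  field \<open>K\<close>.
\<close>

definition function_field_primes :: "'a set \<Rightarrow> 'a ring \<Rightarrow> 'a set set" where
  "function_field_primes F K =
     {V. subring V K \<and> F \<subseteq> V \<and> discrete_valuation_ring (K\<lparr>carrier := V\<rparr>) \<and>
         (\<forall>z\<in>carrier K. \<exists>a\<in>V. \<exists>b\<in>V - {\<zero>\<^bsub>K\<^esub>}. z = a \<otimes>\<^bsub>K\<^esub> inv\<^bsub>K\<^esub> b)}"

definition residue_field :: "'a ring \<Rightarrow> 'a set \<Rightarrow> 'a set ring" where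
  "residue_field K V =
     (K\<lparr>carrier := V\<rparr>) Quot (THE P. maximalideal P (K\<lparr>carrier := V\<rparr>))"

text \<open>If \<open>card F = q\<close>, this is \<open>q\<close> to the power \<open>deg V\<close>, the dimension of the residue field over \<open>F\<close>.\<close>

definition prime_norm :: "'a ring \<Rightarrow> 'a set \<Rightarrow> nat" where
  "prime_norm K V = card (carrier (residue_field K V))"

text \<open>
  Divisors form the free abelian group on the primes; the effective ones are therefore the finite
  multisets of primes.
\<close>

definition effective_divisors :: "'a set \<Rightarrow> 'a ring \<Rightarrow> 'a set multiset set" where
  "effective_divisors F K = {D. set_mset D \<subseteq> function_field_primes F K}"

definition divisor_norm :: "'a ring \<Rightarrow> 'a set multiset \<Rightarrow> nat" where
  "divisor_norm K D = (\<Prod>V\<in>#D. prime_norm K V)"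

text \<open>
  The zeta function is the meromorphic continuation to the whole plane of the Dirichlet series over
  effective divisors, which converges for \<open>Re s > 1\<close>. Niceness of the meromorphic function (it is
  equal to its limit at each point that is not a pole, and to 0 at poles) makes it unique
  as a total function.
\<close>

definition function_field_zeta :: "'a set \<Rightarrow> 'a ring \<Rightarrow> complex \<Rightarrow> complex" where
  "function_field_zeta F K =
     (THE f. f nicely_meromorphic_on UNIV \<and>
        (\<forall>s. Re s > 1 \<longrightarrow>
           f s = (\<Sum>\<^sub>\<infinity>D\<in>effective_divisors F K. of_nat (divisor_norm K D) powr (- s))))"

text \<open>Meaningful at points \<open>s\<close> where \<open>f\<close> is analytic and not locally zero.\<close>

definition first_nonzero_taylor_coeff :: "(complex \<Rightarrow> complex) \<Rightarrow> complex \<Rightarrow> complex" where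
  "first_nonzero_taylor_coeff f s = fps_nth (fps_expansion f s) (subdegree (fps_expansion f s))"

definition zeta_special_value :: "'a set \<Rightarrow> 'a ring \<Rightarrow> complex \<Rightarrow> complex" where
  "zeta_special_value F K s = first_nonzero_taylor_coeff (function_field_zeta F K) s"

text \<open>
  Global function fields are countable, so up to isomorphism all of them have a carrier consisting
  of natural numbers; we take isomorphism classes among those. The field \<open>F\<close> below is determined by
  \<open>K\<close>, so that ring isomorphisms automatically respect the constant fields.
\<close>

definition function_field_iso_rel :: "nat \<Rightarrow> nat ring rel" where
  "function_field_iso_rel q =
     {(K, L). (\<exists>F. global_function_field q F K) \<and> (\<exists>F. global_function_field q F L) \<and> K \<simeq> L}"

definition northcott_set :: "nat \<Rightarrow> complex \<Rightarrow> real \<Rightarrow> nat ring set set" where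
  "northcott_set q s B =
     {K. \<exists>F. global_function_field q F K \<and> norm (zeta_special_value F K s) \<le> B}
       // function_field_iso_rel q"

definition northcott_property :: "nat \<Rightarrow> complex \<Rightarrow> real \<Rightarrow> bool" where
  "northcott_property q s B \<longleftrightarrow> finite (northcott_set q s B)"

end

theory Submission
  imports Defs "Berlekamp_Zassenhaus.Finite_Field" "HOL-Algebra.Algebraic_Closure_Type"
begin

text \<open>
  For \<open>n = 2\<^sup>a\<close> and \<open>Q = q\<^sup>n\<close> let \<open>K\<^sub>a\<close> be the function field of \<open>y\<^sup>2 = x\<^sup>Q - x\<close>. Since \<open>-1\<close> is a square in the
  field with \<open>q\<close> elements, the curve has \<open>q\<^sup>j + 1\<close> points over the extension of degree \<open>j\<close>, except that
  \<open>(q\<^sup>n - 1) q\<^bsup>j/2\<^esup>\<close> points are missing when \<open>2n\<close> divides \<open>j\<close>. Hence, with \<open>u = q\<^bsup>-s\<^esup>\<close> and \<open>r = (q\<^sup>n - 1) / (2n)\<close>,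
  the zeta function is \<open>(1 - q\<^sup>n u\<^bsup>2n\<^esup>)\<^sup>r / ((1 - u) (1 - q u))\<close>. At a real point \<open>1/2 < \<sigma> < 1\<close> it is nonzero
  and at most a constant times \<open>exp (- q\<^bsup>2n(1 - \<sigma>)\<^esup> / (4n))\<close>, which tends to \<open>0\<close> with \<open>a\<close>. So the special
  values of the \<open>K\<^sub>a\<close> take infinitely many values of modulus at most \<open>B\<close>.

  All the \<open>K\<^sub>a\<close> live in one algebraically closed field, the finite places are the local rings at Frobenius
  orbits of points, and the place at infinity is reached by the symmetry \<open>x \<mapsto> 1/x\<close>.
\<close>

section \<open>Fixed points of the Frobenius map\<close>

text \<open>The value has to be small without vanishing, so it must be known exactly. Here it is:
  the numerator says that every Frobenius eigenvalue has \<open>2n\<close>-th power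
  \<open>q^n\<close>, and \<open>2nr = q^n - 1\<close> is twice the genus. At u = q^(-\<sigma>) the
  numerator is (1 - w)^r with w = q^(n(1 - 2\<sigma>)). The bound \<sigma> > 1/2 keeps w below 1, so
  the zeta value is nonzero and is itself the first nonzero Taylor coefficient; the bound \<sigma> <
  1 makes w r unbounded, and 1 - w \<le> exp(-w) then gives the decay. The exponent \<open>n\<close>
  is a power of two because then the 2-part of any \<open>j\<close> not divisible by
  \<open>2n\<close> divides \<open>n\<close>. This supplies a nonsquare that commutes with the map a
  \<mapsto> a^Q - a and remains a nonsquare in the extension of degree \<open>j\<close>. Zeta is
  defined through divisors, so the point counts reach it through the number of effective divisors of
  each degree, which they determine recursively. Isomorphic fields have the same zeta function, and
  nonzero values tending to 0 cannot repeat one value infinitely often; this separates infinitely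
  many classes.\<close>

lemma minimal_period:
  fixes j :: nat
  assumes per: "\<And>i j. P i \<Longrightarrow> P (i + j) \<longleftrightarrow> P j" and ex: "P j" "j > 0"
  shows "\<exists>e>0. P e \<and> (\<forall>i. P i \<longleftrightarrow> e dvd i)"
proof -
  \<comment> \<open>In the application \<open>P i\<close> says that a point has coordinates in the
    field with \<open>q ^ i\<close> elements; this least period becomes the degree of its
    place.\<close>
  define e where "e = (LEAST e. e > 0 \<and> P e)"
  have e: "e > 0 \<and> P e" unfolding e_def using LeastI[of "\<lambda>e. e > 0 \<and> P e" j] ex by blast
  have least: "i < e \<Longrightarrow> i > 0 \<Longrightarrow> \<not> P i" for i unfolding e_def using not_less_Least by blast
  have P0: "P 0" using per[of e 0] e by simp
  have mult: "P (e * m)" for m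
  proof (induction m)
    case (Suc m) then show ?case using per[of e "e * m"] e by simp
  qed (use P0 in simp)
  have "P i \<longleftrightarrow> e dvd i" for i
  proof -
    have "P i \<longleftrightarrow> P (i mod e)" using per[OF mult[of "i div e"], of "i mod e"] by simp
    also have "\<dots> \<longleftrightarrow> i mod e = 0" using least[of "i mod e"] e P0 by (metis mod_less_divisor neq0_conv)
    finally show ?thesis by (simp add: dvd_eq_mod_eq_0)
  qed
  with e show ?thesis by blast
qed

text \<open>Each fibre over \<open>U\<close> meets \<open>S\<close> in a translate of the kernel, by
  any preimage \<open>u\<close> in \<open>S\<close>. It serves for both the trace and the map a
  \<mapsto> a^Q - a.\<close>

lemma card_additive_preimage:
  fixes f :: "'a::ab_group_add \<Rightarrow> 'a"
  assumes fin: "finite S" and diff: "\<And>a b. a \<in> S \<Longrightarrow> b \<in> S \<Longrightarrow> a - b \<in> S"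
    and add: "\<And>a b. a \<in> S \<Longrightarrow> b \<in> S \<Longrightarrow> a + b \<in> S"
    and hom: "\<And>a b. f (a + b) = f a + f b" and U: "U \<subseteq> f ` S"
  shows "card {z \<in> S. f z \<in> U} = card U * card {z \<in> S. f z = 0}"
proof -
  have hom_diff: "f (a - b) = f a - f b" for a b
    using hom[of "a - b" b] by (simp add: algebra_simps)
  have fibre: "card {z \<in> S. f z = w} = card {z \<in> S. f z = 0}" if wU: "w \<in> U" for w
  proof -
    obtain u where u: "u \<in> S" "f u = w" using U wU by blast
    have "bij_betw (\<lambda>z. z - u) {z \<in> S. f z = w} {z \<in> S. f z = 0}"
      by (rule bij_betwI[of _ _ _ "\<lambda>z. z + u"]) (auto simp: hom hom_diff u intro: add diff)
    then show ?thesis by (rule bij_betw_same_card)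
  qed
  have finU: "finite U" using U fin by (meson finite_imageI finite_subset)
  have "{z \<in> S. f z \<in> U} = (\<Union>w\<in>U. {z \<in> S. f z = w})" by auto
  then have "card {z \<in> S. f z \<in> U} = (\<Sum>w\<in>U. card {z \<in> S. f z = w})"
    using fin finU by (simp add: card_UN_disjoint disjoint_iff)
  then show ?thesis using fibre by simp
qed

corollary card_additive_image:
  fixes f :: "'a::ab_group_add \<Rightarrow> 'a"
  assumes "finite S" "\<And>a b. a \<in> S \<Longrightarrow> b \<in> S \<Longrightarrow> a - b \<in> S"
    "\<And>a b. a \<in> S \<Longrightarrow> b \<in> S \<Longrightarrow> a + b \<in> S" "\<And>a b. f (a + b) = f a + f b"
  shows "card (f ` S) * card {z \<in> S. f z = 0} = card S"
proof -
  have "{z \<in> S. f z \<in> f ` S} = S" by auto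
  with card_additive_preimage[OF assms subset_refl] show ?thesis by simp
qed

locale frobenius_field =
  fixes q k :: nat and T :: "'a::alg_closed_field itself"
  assumes prime_char: "Factorial_Ring.prime CHAR('a)" and q_def: "q = CHAR('a) ^ k" and k_pos: "k > 0"
begin

text \<open>The subfield with \<open>q ^ j\<close> elements for \<open>j > 0\<close>;
  \<open>Fix 0\<close> is the whole field, hence the hypothesis \<open>j > 0\<close> in the
  counts.\<close>

definition Fix :: "nat \<Rightarrow> 'a set" where
  "Fix j = {z. z ^ (q ^ j) = z}"

lemma q_gt_1: "q > 1"
  unfolding q_def using prime_gt_1_nat[OF prime_char] k_pos by (rule one_less_power)

lemma q_pos [simp]: "q > 0" using q_gt_1 by simp

lemma q_power: "q ^ j = CHAR('a) ^ (k * j)"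
  by (simp add: q_def power_mult)

lemma frob_add: "(a + b :: 'a) ^ (q ^ j) = a ^ (q ^ j) + b ^ (q ^ j)"
  using prime_char q_power by (rule freshmans_dream')

lemma q_power_pos [simp]: "q ^ j > 0"
  using q_pos by (rule zero_less_power)

lemma frob_0 [simp]: "(0 :: 'a) ^ (q ^ j) = 0"
  using q_power_pos[of j] by (simp only: zero_power)

lemma frob_uminus: "(- a :: 'a) ^ (q ^ j) = - (a ^ (q ^ j))"
  using frob_add[of a "- a" j] by (simp add: eq_neg_iff_add_eq_0 add.commute)

lemma frob_diff: "(a - b :: 'a) ^ (q ^ j) = a ^ (q ^ j) - b ^ (q ^ j)"
  using frob_add[of a "- b" j] by (simp add: frob_uminus)

lemma frob_frob: "(z ^ (q ^ i)) ^ (q ^ j) = (z :: 'a) ^ (q ^ (i + j))"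
  by (simp add: power_mult[symmetric] power_add)

lemma frob_inj: "a ^ (q ^ j) = b ^ (q ^ j) \<Longrightarrow> a = (b :: 'a)"
  using frob_diff[of a b j] by (metis eq_iff_diff_eq_0 power_eq_0_iff)

lemma frob_one: "(a + b :: 'a) ^ q = a ^ q + b ^ q" "(a - b :: 'a) ^ q = a ^ q - b ^ q"
   "(- a :: 'a) ^ q = - (a ^ q)" "(0::'a) ^ q = 0"
  using frob_add[of a b 1] frob_diff[of a b 1] frob_uminus[of a 1] by auto

lemma Fix_0 [simp]: "0 \<in> Fix j" and Fix_1 [simp]: "1 \<in> Fix j"
  by (auto simp: Fix_def)

lemma Fix_add: "a \<in> Fix j \<Longrightarrow> b \<in> Fix j \<Longrightarrow> a + b \<in> Fix j"
  and Fix_diff: "a \<in> Fix j \<Longrightarrow> b \<in> Fix j \<Longrightarrow> a - b \<in> Fix j"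
  and Fix_uminus: "a \<in> Fix j \<Longrightarrow> - a \<in> Fix j"
  and Fix_mult: "a \<in> Fix j \<Longrightarrow> b \<in> Fix j \<Longrightarrow> a * b \<in> Fix j"
  and Fix_inverse: "a \<in> Fix j \<Longrightarrow> inverse a \<in> Fix j"
  and Fix_divide: "a \<in> Fix j \<Longrightarrow> b \<in> Fix j \<Longrightarrow> a / b \<in> Fix j"
  and Fix_power: "a \<in> Fix j \<Longrightarrow> a ^ m \<in> Fix j"
  by (auto simp: Fix_def frob_add frob_diff frob_uminus power_mult_distrib power_inverse
      power_divide power_mult[symmetric] mult.commute[of m])
    (auto simp: power_mult)

lemma Fix_sum: "(\<And>i. i \<in> S \<Longrightarrow> f i \<in> Fix j) \<Longrightarrow> sum f S \<in> Fix j"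
  by (induction S rule: infinite_finite_induct) (auto intro: Fix_add)

lemma Fix_frob_mult: "z \<in> Fix i \<Longrightarrow> z \<in> Fix (i * m)"
proof (induction m)
  case (Suc m)
  have "z ^ (q ^ (i * Suc m)) = (z ^ (q ^ i)) ^ (q ^ (i * m))"
    by (simp add: frob_frob)
  with Suc show ?case by (simp add: Fix_def)
qed (simp add: Fix_def)

lemma Fix_mono: "i dvd j \<Longrightarrow> Fix i \<subseteq> Fix j"
  using Fix_frob_mult by (auto simp: dvd_def)

text \<open>The polynomial \<open>P\<close> splits, and its derivative is the constant -1 because
  \<open>N\<close> is zero in the field; so its \<open>N\<close> roots are distinct.\<close>

lemma card_Fix:
  assumes "j > 0"
  shows "finite (Fix j)" "card (Fix j) = q ^ j"
proof -
  define N where "N = q ^ j"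
  have N: "N > 1" unfolding N_def using q_gt_1 assms by (rule one_less_power)
  have Nz: "of_nat N = (0::'a)"
    using assms k_pos by (simp add: N_def q_power of_nat_eq_0_iff_char_dvd)
  define P :: "'a poly" where "P = Polynomial.monom 1 N + Polynomial.monom (-1) 1"
  have degP: "Polynomial.degree P = N"
    unfolding P_def using N by (subst degree_add_eq_left) (auto simp: Polynomial.degree_monom_eq)
  then have P0: "P \<noteq> 0" using N by auto
  have poly_P: "poly P z = z ^ N - z" for z by (simp add: P_def poly_monom)
  have Fix_eq: "Fix j = {z. poly P z = 0}" by (auto simp: Fix_def poly_P N_def)
  then show "finite (Fix j)" using P0 by (simp add: poly_roots_finite)
  have pd: "pderiv P = - 1" using Nz by (simp add: P_def pderiv_add pderiv_monom one_pCons monom_0)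
  obtain A where A: "size A = Polynomial.degree P" "P = Polynomial.smult (Polynomial.lead_coeff P) (\<Prod>x\<in>#A. [:- x, 1:])"
    using alg_closed_imp_factorization[OF P0] by auto
  have roots: "poly P z = 0 \<longleftrightarrow> z \<in># A" for z
  proof -
    have "poly P z = Polynomial.lead_coeff P * (\<Prod>x\<in>#A. z - x)"
      by (subst A(2)) (simp add: poly_prod_mset image_mset.compositionality o_def)
    then show ?thesis using P0 by (auto simp: prod_mset_zero_iff image_iff)
  qed
  have "count A z \<le> 1" for z
  proof (rule ccontr)
    assume "\<not> count A z \<le> 1"
    then have "count A z \<ge> 2" by simp
    then have "{#z, z#} \<subseteq># A" by (simp add: subseteq_mset_def)
    then obtain B where B: "A = B + {#z, z#}" by (metis mset_subset_eq_exists_conv add.commute)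
    have "P = [:- z, 1:] * ([:- z, 1:] * Polynomial.smult (Polynomial.lead_coeff P) (\<Prod>x\<in>#B. [:- x, 1:]))"
      by (subst A(2)) (simp add: B mult_ac)
    then obtain R where "P = [:- z, 1:] * ([:- z, 1:] * R)" by blast
    moreover have "poly (pderiv ([:- z, 1:] * ([:- z, 1:] * R))) z = 0" for R
      by (simp only: pderiv_mult poly_add poly_mult) simp
    ultimately have "poly (pderiv P) z = 0" by metis
    with pd show False by simp
  qed
  then have "count A z = count (mset_set (set_mset A)) z" for z
  proof (cases "z \<in># A")
    case True
    then have "count A z > 0" by simp
    with \<open>count A z \<le> 1\<close> have "count A z = 1" by linarith
    with True show ?thesis by simp
  qed (simp add: not_in_iff)
  then have "A = mset_set (set_mset A)" by (rule multiset_eqI)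
  then have "size A = card (set_mset A)" by (metis size_mset_set)
  with A(1) degP roots Fix_eq show "card (Fix j) = q ^ j" by (simp add: N_def)
qed

section \<open>Polynomials over the field with q elements\<close>

definition FP :: "'a poly set" where "FP = {f. \<forall>i. poly.coeff f i \<in> Fix 1}"

lemma FP_coeff: "f \<in> FP \<Longrightarrow> poly.coeff f i \<in> Fix 1" by (simp add: FP_def)

lemma FP_0 [simp]: "0 \<in> FP" and FP_1 [simp]: "1 \<in> FP"
  by (auto simp: FP_def coeff_1)
lemma FP_add: "f \<in> FP \<Longrightarrow> g \<in> FP \<Longrightarrow> f + g \<in> FP"
  and FP_diff: "f \<in> FP \<Longrightarrow> g \<in> FP \<Longrightarrow> f - g \<in> FP"
  and FP_uminus: "f \<in> FP \<Longrightarrow> - f \<in> FP"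
  and FP_mult: "f \<in> FP \<Longrightarrow> g \<in> FP \<Longrightarrow> f * g \<in> FP"
  by (auto simp: FP_def coeff_mult intro!: Fix_add Fix_diff Fix_uminus Fix_sum Fix_mult)
lemma FP_power: "f \<in> FP \<Longrightarrow> f ^ m \<in> FP"
  by (induction m) (auto intro: FP_mult)
lemma FP_const: "c \<in> Fix 1 \<Longrightarrow> [:c:] \<in> FP"
  by (auto simp: FP_def coeff_pCons split: nat.splits)
lemma FP_monom: "c \<in> Fix 1 \<Longrightarrow> Polynomial.monom c m \<in> FP"
  by (auto simp: FP_def)
lemma FP_X: "[:0, 1:] \<in> FP"
  by (auto simp: FP_def coeff_pCons split: nat.splits)

sublocale frob: field_hom "\<lambda>z::'a. z ^ q"
  by unfold_locales (auto simp: frob_one power_mult_distrib)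

text \<open>Field homomorphisms commute with division with remainder, so this description by the
  coefficientwise Frobenius map yields \<open>FP_mod\<close> and \<open>FP_div\<close>.\<close>

lemma FP_iff: "f \<in> FP \<longleftrightarrow> map_poly (\<lambda>z. z ^ q) f = f"
  unfolding poly_eq_iff FP_def by (simp add: coeff_map_poly Fix_def)

lemma FP_mod: "f \<in> FP \<Longrightarrow> g \<in> FP \<Longrightarrow> f mod g \<in> FP"
  and FP_div: "f \<in> FP \<Longrightarrow> g \<in> FP \<Longrightarrow> f div g \<in> FP"
  by (auto simp: FP_iff frob.map_poly_mod frob.map_poly_div)

lemma FP_frob: "f \<in> FP \<Longrightarrow> poly f z ^ (q ^ j) = poly f (z ^ (q ^ j))"
proof (induction j)
  case (Suc j)
  have "poly f w ^ q = poly f (w ^ q)" for w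
    using frob.poly_map_poly[of f w] Suc.prems unfolding FP_iff by metis
  from this[of "z ^ (q ^ j)"] Suc show ?case by (metis power_Suc mult.commute power_mult)
qed simp

lemma FP_Fix: "f \<in> FP \<Longrightarrow> z \<in> Fix j \<Longrightarrow> poly f z \<in> Fix j"
  using FP_frob[of f z j] by (simp add: Fix_def)

text \<open>All Frobenius powers of \<open>z\<close> are roots of \<open>f\<close>, so two of them
  coincide; injectivity of Frobenius cancels the smaller exponent.\<close>

lemma algebraic_Fix:
  assumes f: "f \<in> FP" "f \<noteq> 0" "poly f z = 0"
  obtains j where "j > 0" "z \<in> Fix j"
proof -
  have "\<not> inj (\<lambda>i. z ^ (q ^ i))"
  proof
    assume "inj (\<lambda>i. z ^ (q ^ i))"
    moreover have "range (\<lambda>i. z ^ (q ^ i)) \<subseteq> {w. poly f w = 0}"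
      using f FP_frob[OF f(1), of z] by auto
    ultimately show False
      using finite_subset[OF _ poly_roots_finite[OF f(2)]] finite_imageD infinite_UNIV_nat by blast
  qed
  then obtain i i' where "i < i'" "z ^ (q ^ i) = z ^ (q ^ i')"
    unfolding inj_def by (metis linorder_neq_iff)
  then have "(z ^ (q ^ (i' - i))) ^ (q ^ i) = z ^ (q ^ i)"
    by (simp add: frob_frob)
  from frob_inj[OF this] have "z \<in> Fix (i' - i)" by (simp add: Fix_def)
  with \<open>i < i'\<close> show ?thesis using that[of "i' - i"] by simp
qed

text \<open>A member of least degree in \<open>S\<close>, which is inhabited by X^(q^j) - X.
  Remainders stay in \<open>FP\<close>, so divisibility holds with a quotient in
  \<open>FP\<close>.\<close>

lemma minimal_polynomial:
  assumes "j > 0" "a \<in> Fix j"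
  obtains P where "P \<in> FP" "P \<noteq> 0" "Polynomial.degree P > 0" "poly P a = 0"
    "\<And>f. f \<in> FP \<Longrightarrow> poly f a = 0 \<Longrightarrow> \<exists>g\<in>FP. f = P * g"
proof -
  define S where "S = {f \<in> FP. f \<noteq> 0 \<and> poly f a = 0}"
  have q1: "1 < q ^ j" using q_gt_1 assms(1) by (rule one_less_power)
  then have "Polynomial.degree (Polynomial.monom (1::'a) (q ^ j) + Polynomial.monom (-1) 1) = q ^ j"
    by (subst degree_add_eq_left) (auto simp: Polynomial.degree_monom_eq)
  then have "Polynomial.monom (1::'a) (q ^ j) + Polynomial.monom (-1) 1 \<noteq> 0" using q1 by (metis Polynomial.degree_0 not_one_less_zero)
  moreover have "Polynomial.monom 1 (q ^ j) + Polynomial.monom (-1) 1 \<in> FP"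
    by (intro FP_add FP_monom Fix_uminus Fix_1)
  ultimately have "Polynomial.monom 1 (q ^ j) + Polynomial.monom (-1) 1 \<in> S"
    using assms by (auto simp: S_def poly_monom Fix_def)
  then obtain P where P: "P \<in> S" "\<And>f. f \<in> S \<Longrightarrow> Polynomial.degree P \<le> Polynomial.degree f"
    using arg_min_nat_lemma[of "\<lambda>f. f \<in> S" _ Polynomial.degree] by blast
  have "\<exists>g\<in>FP. f = P * g" if f: "f \<in> FP" "poly f a = 0" for f
  proof (intro bexI)
    have "f mod P = 0"
    proof (rule ccontr)
      assume n0: "f mod P \<noteq> 0"
      have "f mod P = f - P * (f div P)" by (simp add: minus_mult_div_eq_mod)
      then have "poly (f mod P) a = 0" using f P by (auto simp: S_def)
      with n0 f P have "f mod P \<in> S" by (auto simp: S_def intro: FP_mod)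
      from P(2)[OF this] degree_mod_less[of P f] n0 P(1) show False by (auto simp: S_def)
    qed
    then show "f = P * (f div P)" by (metis add.right_neutral mult_div_mod_eq)
    show "f div P \<in> FP" using f P by (auto simp: S_def intro: FP_div)
  qed
  moreover have "Polynomial.degree P > 0"
  proof (rule ccontr)
    assume "\<not> Polynomial.degree P > 0"
    then obtain c where "P = [:c:]" using degree_eq_zeroE by blast
    with P(1) show False by (auto simp: S_def)
  qed
  ultimately show ?thesis using that P(1) by (auto simp: S_def)
qed

text \<open>Order of vanishing at \<open>a\<close>, with \<open>P\<close> in the role of the minimal
  polynomial: every division by \<open>P\<close> lowers the degree, so the process stops.\<close>

lemma FP_order:
  assumes P: "P \<in> FP" "Polynomial.degree P > 0" "\<And>f. f \<in> FP \<Longrightarrow> poly f a = 0 \<Longrightarrow> \<exists>g\<in>FP. f = P * g"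
    and f: "f \<in> FP" "f \<noteq> 0"
  shows "\<exists>m. \<exists>g\<in>FP. f = P ^ m * g \<and> poly g a \<noteq> 0"
  using f
proof (induction "Polynomial.degree f" arbitrary: f rule: less_induct)
  case less
  show ?case
  proof (cases "poly f a = 0")
    case True
    then obtain g where g: "g \<in> FP" "f = P * g" using P less by blast
    with less have "g \<noteq> 0" "P \<noteq> 0" by auto
    then have "Polynomial.degree g < Polynomial.degree f" using P(2) by (simp add: g(2) degree_mult_eq)
    from less(1)[OF this g(1) \<open>g \<noteq> 0\<close>] obtain m h where "h \<in> FP" "g = P ^ m * h" "poly h a \<noteq> 0" by blast
    then show ?thesis by (intro exI[of _ "Suc m"] bexI[of _ h]) (auto simp: g(2) mult_ac)
  next
    case False
    then show ?thesis using less by (intro exI[of _ 0] bexI[of _ f]) auto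
  qed
qed

end

section \<open>Points on \<open>y\<^sup>2 = x\<^sup>Q - x\<close>\<close>

locale artin_schreier_base = frobenius_field q k T
  for q k :: nat and T :: "'a::alg_closed_field itself" +
  fixes n s :: nat
  assumes q_mod_4: "q mod 4 = 1" and n_def: "n = 2 ^ s"
begin

lemma n_pos [simp]: "n > 0" by (simp add: n_def)

lemma odd_q: "odd q" using q_mod_4 by presburger

lemma two_nonzero: "(2::'a) \<noteq> 0"
proof
  assume "(2::'a) = 0"
  then have "CHAR('a) dvd 2" using of_nat_eq_0_iff_char_dvd[of 2, where ?'a = 'a] by simp
  then have "CHAR('a) = 2"
    using prime_char by (simp add: primes_dvd_imp_eq)
  with odd_q q_def k_pos show False by simp
qed

lemma neg_one_neq_one: "(-1::'a) \<noteq> 1"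
  using two_nonzero by (metis one_add_one add.right_inverse)

definition I :: 'a where "I = (SOME i. i ^ 2 = -1)"

lemma I_square: "I ^ 2 = -1" "I * I = -1"
proof -
  have "\<exists>i. i ^ 2 = (-1 :: 'a)" by (rule nth_root_exists) simp
  then show "I ^ 2 = -1" unfolding I_def by (rule someI_ex)
  then show "I * I = -1" by (simp add: power2_eq_square)
qed

text \<open>With q = 4m + 1 the power \<open>I ^ q\<close> is (-1)^(2m) \<open>I\<close>. Here the
  residue 1 modulo 4 is used, not just oddness.\<close>

lemma I_Fix: "I \<in> Fix j"
proof -
  have "q = 2 * (2 * (q div 4)) + 1" using q_mod_4 by presburger
  then have "I ^ q = (I ^ 2) ^ (2 * (q div 4)) * I"
    by (metis power_add power_mult power_one_right)
  then have "I \<in> Fix 1" by (simp add: Fix_def I_square power_mult)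
  then show ?thesis using Fix_frob_mult[of I 1 j] by simp
qed

definition pts :: "nat \<Rightarrow> ('a \<times> 'a) set" where
  "pts j = {(a, b). a \<in> Fix j \<and> b \<in> Fix j \<and> b ^ 2 = a ^ (q ^ n) - a}"

lemma finite_pts: "j > 0 \<Longrightarrow> finite (pts j)"
  by (rule finite_subset[of _ "Fix j \<times> Fix j"]) (auto simp: pts_def card_Fix)

lemma Fix_nonzero_power: "w \<in> Fix j \<Longrightarrow> w \<noteq> 0 \<Longrightarrow> w ^ (q ^ j - 1) = 1"
proof -
  assume w: "w \<in> Fix j" "w \<noteq> 0"
  have "w ^ (q ^ j - 1) * w = w ^ (q ^ j)"
    using q_power_pos[of j] by (metis One_nat_def Suc_pred power_Suc2)
  with w show ?thesis by (simp add: Fix_def)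
qed

lemma nonzero_power_Fix: "w ^ (q ^ j - 1) = 1 \<Longrightarrow> w \<in> Fix j"
  unfolding Fix_def using q_power_pos[of j]
  by (metis (mono_tags, lifting) One_nat_def Suc_pred mem_Collect_eq mult_1 power_Suc2)

lemma half_double: "2 * ((q ^ j - 1) div 2) = q ^ j - 1"
  using odd_q by simp

text \<open>Euler's criterion: for a square root b of \<open>w\<close> in the big field, the power
  of \<open>w\<close> in question is b^(q^j - 1), which is 1 exactly if b lies in
  \<open>Fix j\<close>.\<close>

lemma card_square_roots:
  assumes "w \<in> Fix j" "w \<noteq> 0" "j > 0"
  shows "w ^ ((q ^ j - 1) div 2) = 1 \<Longrightarrow> card {b \<in> Fix j. b ^ 2 = w} = 2"
    "w ^ ((q ^ j - 1) div 2) = -1 \<Longrightarrow> card {b \<in> Fix j. b ^ 2 = w} = 0"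
    "w ^ ((q ^ j - 1) div 2) \<in> {1, -1}"
proof -
  obtain b where b: "b ^ 2 = w" using nth_root_exists[of 2 w] by auto
  with assms have b0: "b \<noteq> 0" by auto
  have bp: "b ^ (q ^ j - 1) = w ^ ((q ^ j - 1) div 2)"
    using power_mult[of b 2 "(q ^ j - 1) div 2"] by (simp only: half_double b)
  have roots: "c ^ 2 = w \<longleftrightarrow> c = b \<or> c = - b" for c unfolding b[symmetric] by (rule power2_eq_iff)
  have "b \<noteq> - b"
  proof
    assume "b = - b"
    then have "2 * b = 0" by (simp only: eq_neg_iff_add_eq_0 mult_2)
    with b0 two_nonzero show False by simp
  qed
  {
    assume "w ^ ((q ^ j - 1) div 2) = 1"
    then have "b \<in> Fix j" using bp nonzero_power_Fix by simp
    then have "{b \<in> Fix j. b ^ 2 = w} = {b, - b}" using roots Fix_uminus[of b j] by auto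
    then show "card {b \<in> Fix j. b ^ 2 = w} = 2" using \<open>b \<noteq> - b\<close> by simp
  }
  {
    assume "w ^ ((q ^ j - 1) div 2) = -1"
    then have "b \<notin> Fix j" using bp Fix_nonzero_power[of b j] b0 neg_one_neq_one by auto
    then have "- b \<notin> Fix j" using Fix_uminus[of "- b" j] by auto
    with \<open>b \<notin> Fix j\<close> have "{b \<in> Fix j. b ^ 2 = w} = {}" using roots by auto
    then show "card {b \<in> Fix j. b ^ 2 = w} = 0" by (simp only: card.empty)
  }
  have "(w ^ ((q ^ j - 1) div 2)) ^ 2 = 1"
    using Fix_nonzero_power[OF assms(1,2)] half_double[of j] by (metis power_mult mult.commute)
  then show "w ^ ((q ^ j - 1) div 2) \<in> {1, -1}" by (simp add: power2_eq_1_iff)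
qed

text \<open>Otherwise all q^j - 1 nonzero elements would be roots of a nonzero polynomial of half
  that degree.\<close>

lemma exists_nonsquare:
  assumes "j > 0"
  shows "\<exists>c\<in>Fix j. c ^ ((q ^ j - 1) div 2) = -1"
proof (rule ccontr)
  assume neg: "\<not> ?thesis"
  define N where "N = (q ^ j - 1) div 2"
  have N: "2 * N = q ^ j - 1" unfolding N_def by (rule half_double)
  have "q ^ j > 1" using q_gt_1 assms by (rule one_less_power)
  with N have N0: "N > 0" by simp
  define P :: "'a poly" where "P = Polynomial.monom 1 N - 1"
  have P: "poly P z = z ^ N - 1" for z by (simp add: P_def poly_monom)
  have "poly P 0 \<noteq> 0" using N0 by (simp add: P power_0_left)
  then have P0: "P \<noteq> 0" by auto
  have deg: "Polynomial.degree P \<le> N"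
    unfolding P_def by (rule degree_diff_le) (auto simp: Polynomial.degree_monom_le)
  have "Fix j - {0} \<subseteq> {z. poly P z = 0}"
    using card_square_roots(3)[of _ j] neg assms by (auto simp: P N_def)
  then have "card (Fix j - {0}) \<le> card {z. poly P z = 0}"
    using P0 by (intro card_mono poly_roots_finite)
  also have "\<dots> \<le> N" using card_poly_roots_bound[OF P0] deg by simp
  finally have "q ^ j - 1 \<le> N" using card_Fix[OF assms] by simp
  with N N0 show False by simp
qed

lemma card_pts_sum:
  assumes "j > 0"
  shows "card (pts j) = (\<Sum>a\<in>Fix j. card {b \<in> Fix j. b ^ 2 = a ^ (q ^ n) - a})"
proof -
  have "pts j = (SIGMA a:Fix j. {b \<in> Fix j. b ^ 2 = a ^ (q ^ n) - a})" by (auto simp: pts_def)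
  then show ?thesis using card_Fix[OF assms] by simp
qed

text \<open>Scaling \<open>a\<close> by a nonsquare \<open>c\<close> with \<open>c\<^sup>Q = c\<close> exchanges squares and nonsquares among the values \<open>a\<^sup>Q - a\<close>.\<close>

lemma card_pts_odd:
  assumes j: "j > 0" and nd: "\<not> 2 * n dvd j"
  shows "card (pts j) = q ^ j"
proof -
  have "j \<noteq> 0" "\<not> (2::nat) dvd 1" using j by auto
  from multiplicity_decompose'[OF this] obtain r where r': "j = 2 ^ multiplicity 2 j * r" "odd r" .
  define t where "t = multiplicity 2 j"
  have r: "j = 2 ^ t * r" "odd r" using r' by (simp_all add: t_def)
  \<comment> \<open>The 2-part of \<open>j\<close> divides \<open>n\<close>: this is where
    \<open>n\<close> being a power of two is needed.\<close>
  have "t \<le> s"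
  proof (rule ccontr)
    assume "\<not> t \<le> s"
    then have "2 * n dvd 2 ^ t" unfolding n_def power_Suc[symmetric] by (intro le_imp_power_dvd) auto
    with nd r show False by (meson dvd_mult2)
  qed
  define m where "m = (2::nat) ^ t"
  have m: "m > 0" "m dvd n" "j = m * r" using \<open>t \<le> s\<close> r by (auto simp: m_def n_def le_imp_power_dvd)
  \<comment> \<open>A nonsquare of the field with \<open>q ^ m\<close> elements:
    \<open>m dvd n\<close> makes it invariant under the Q-power, and the odd degree \<open>r\<close>
    of the extension keeps it a nonsquare in \<open>Fix j\<close>.\<close>
  obtain c where c: "c \<in> Fix m" "c ^ ((q ^ m - 1) div 2) = -1" using exists_nonsquare[OF m(1)] by auto
  have cj: "c \<in> Fix j" and cn: "c \<in> Fix n"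
    using c(1) m Fix_mono[of m j] Fix_mono[of m n] by auto
  have c0: "c \<noteq> 0"
  proof
    assume "c = 0"
    with c(2) have "(0::'a) ^ ((q ^ m - 1) div 2) = -1" by simp
    then show False using neg_one_neq_one by (cases "(q ^ m - 1) div 2 = 0") (auto simp: power_0_left split: if_splits)
  qed
  define e where "e = (\<Sum>i<r. (q ^ m) ^ i)"
  have one: "q ^ j - 1 = (q ^ m - 1) * e"
  proof -
    have "int (q ^ j) - 1 = (int (q ^ m) - 1) * (\<Sum>i<r. int (q ^ m) ^ i)"
      unfolding m(3) power_mult of_nat_power by (rule power_diff_1_eq)
    then have "int (q ^ j - 1) = int ((q ^ m - 1) * e)"
      using q_power_pos[of j, THEN Suc_leI] q_power_pos[of m, THEN Suc_leI] by (simp add: of_nat_diff e_def)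
    then show ?thesis by (simp only: of_nat_eq_iff)
  qed
  \<comment> \<open>An odd number of odd summands. The Euler power of \<open>c\<close> in
    \<open>Fix j\<close> is the one in \<open>Fix m\<close> raised to \<open>e\<close>, so it is
    still -1.\<close>
  have "odd e"
    unfolding e_def using odd_q r(2) by (subst even_sum_iff) (auto simp: Int_def)
  have "2 * ((q ^ j - 1) div 2) = 2 * ((q ^ m - 1) div 2 * e)"
    using half_double[of j] half_double[of m] one by (metis mult.assoc)
  then have "(q ^ j - 1) div 2 = (q ^ m - 1) div 2 * e" by simp
  then have ch: "c ^ ((q ^ j - 1) div 2) = -1"
    using c(2) \<open>odd e\<close> by (simp add: power_mult)
  define sq where "sq w = card {b \<in> Fix j. b ^ 2 = w}" for w :: 'a
  define f where "f a = a ^ (q ^ n) - a" for a :: 'a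
  have fF: "a \<in> Fix j \<Longrightarrow> f a \<in> Fix j" for a unfolding f_def by (intro Fix_diff Fix_power)
  \<comment> \<open>For nonzero \<open>w\<close> exactly one of \<open>w\<close> and
    \<open>c * w\<close> is a square and has two roots; for \<open>w = 0\<close> both terms are
    1.\<close>
  have two: "sq w + sq (c * w) = 2" if w: "w \<in> Fix j" for w
  proof (cases "w = 0")
    case True
    have "{b \<in> Fix j. b ^ 2 = 0} = {0}" by auto
    then show ?thesis using True by (simp add: sq_def)
  next
    case False
    have cw: "c * w \<in> Fix j" "c * w \<noteq> 0" using cj c0 w False by (auto intro: Fix_mult)
    have "(c * w) ^ ((q ^ j - 1) div 2) = - (w ^ ((q ^ j - 1) div 2))"
      by (simp only: power_mult_distrib ch) simp
    then show ?thesis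
      using card_square_roots[OF w False j] card_square_roots[OF cw j] by (auto simp: sq_def)
  qed
  have "(\<Sum>a\<in>Fix j. sq (c * f a)) = (\<Sum>a\<in>Fix j. sq (f (c * a)))"
    using cn by (simp add: f_def Fix_def power_mult_distrib right_diff_distrib)
  also have "\<dots> = (\<Sum>a\<in>Fix j. sq (f a))"
  proof (rule sum.reindex_bij_witness[of _ "\<lambda>a. inverse c * a" "\<lambda>a. c * a"])
    fix a assume "a \<in> Fix j"
    then show "inverse c * a \<in> Fix j" "c * a \<in> Fix j" using cj by (auto intro: Fix_mult Fix_inverse)
    show "inverse c * (c * a) = a" "c * (inverse c * a) = a" using c0 by (simp_all add: field_simps)
  qed auto
  finally have "2 * (\<Sum>a\<in>Fix j. sq (f a)) = (\<Sum>a\<in>Fix j. sq (f a) + sq (c * f a))"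
    by (simp add: sum.distrib)
  also have "\<dots> = (\<Sum>a\<in>Fix j. 2)" using fF two by (intro sum.cong) auto
  also have "\<dots> = 2 * q ^ j" using card_Fix[OF j] by simp
  finally show ?thesis using card_pts_sum[OF j] by (simp add: sq_def f_def)
qed

text \<open>With R = q^h each fibre of the norm z \<mapsto> z^(R + 1) has at most R + 1 elements,
  being a set of roots. The R - 1 fibres over nonzero values must hold R^2 - 1 elements, so every
  bound is attained.\<close>

lemma card_norm_fibre:
  assumes h: "h > 0" and w: "w \<in> Fix h" "w \<noteq> 0"
  shows "card {z \<in> Fix (2 * h). z ^ (q ^ h + 1) = w} = q ^ h + 1"
proof -
  define R where "R = q ^ h"
  have R: "R > 0" by (simp add: R_def)
  have le: "card {z. z ^ (R + 1) = v} \<le> R + 1 \<and> finite {z. z ^ (R + 1) = v}" for v :: 'a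
  proof -
    define P :: "'a poly" where "P = Polynomial.monom 1 (R + 1) - [:v:]"
    have deg: "Polynomial.degree P \<le> R + 1"
      unfolding P_def by (rule degree_diff_le) (auto simp: Polynomial.degree_monom_le)
    have "poly.coeff P (R + 1) = 1" by (simp add: P_def)
    then have P0: "P \<noteq> 0" by auto
    have "{z. z ^ (R + 1) = v} = {z. poly P z = 0}" by (simp add: P_def poly_monom)
    with card_poly_roots_bound[OF P0] poly_roots_finite[OF P0] deg show ?thesis by simp
  qed
  define A where "A v = {z \<in> Fix (2 * h). z ^ (R + 1) = v}" for v
  have A: "card (A v) \<le> R + 1" "finite (A v)" for v
    using le[of v] order_trans[OF card_mono[of "{z. z ^ (R + 1) = v}" "A v"]] finite_subset[of "A v" "{z. z ^ (R + 1) = v}"]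
    unfolding A_def by blast+
  have fin: "finite (Fix h)" "finite (Fix (2 * h))" using card_Fix[of h] card_Fix[of "2 * h"] h by auto
  have RR: "q ^ (2 * h) = R * R" by (simp add: R_def mult_2 power_add)
  have norm: "z ^ (R + 1) \<in> Fix h" if "z \<in> Fix (2 * h)" for z
  proof -
    have "(z ^ (R + 1)) ^ R = z ^ (R * R) * z ^ R"
      by (simp add: power_mult[symmetric] power_add[symmetric] algebra_simps)
    also have "\<dots> = z ^ (R + 1)" using that RR by (simp add: Fix_def)
    finally show ?thesis by (simp add: Fix_def R_def)
  qed
  have "Fix (2 * h) - {0} = (\<Union>v\<in>Fix h - {0}. A v)"
    using norm by (auto simp: A_def)
  then have "card (Fix (2 * h) - {0}) = (\<Sum>v\<in>Fix h - {0}. card (A v))"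
    using fin A(2) by (simp add: card_UN_disjoint disjoint_iff A_def)
  then have "R * R - 1 = (\<Sum>v\<in>Fix h - {0}. card (A v))"
    using card_Fix[of "2 * h"] h RR by simp
  moreover have "(\<Sum>v\<in>Fix h - {0}. R + 1) = R * R - 1"
    using card_Fix[OF h] R by (simp add: R_def[symmetric] algebra_simps)
  ultimately have eq: "(\<Sum>v\<in>Fix h - {0}. card (A v)) = (\<Sum>v\<in>Fix h - {0}. R + 1)" by simp
  have "card (A w) = R + 1"
  proof (rule ccontr)
    assume "card (A w) \<noteq> R + 1"
    then have "card (A w) < R + 1" using A(1)[of w] by linarith
    then have "(\<Sum>v\<in>Fix h - {0}. card (A v)) < (\<Sum>v\<in>Fix h - {0}. R + 1)"
      using w A(1) fin by (intro sum_strict_mono_ex1) auto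
    with eq show False by simp
  qed
  then show ?thesis by (simp add: A_def R_def)
qed

text \<open>With \<open>R = q\<^bsup>nh\<^esup>\<close>, the image of \<open>\<phi> a = a\<^sup>Q - a\<close> on the field with \<open>R\<^sup>2\<close> elements consists of the \<open>z\<close> whose trace
  \<open>z + z\<^sup>R\<close> lies in the image \<open>\<phi> ` E\<close> of the subfield \<open>E\<close> with \<open>R\<close> elements. The additive bijection \<open>N b = b + I b\<^sup>R\<close>
  turns the trace of \<open>b\<^sup>2\<close> into the norm of \<open>N b\<close> up to a constant, so counting the admissible \<open>b\<close> amounts
  to counting norm fibres over \<open>\<phi> ` E\<close>.\<close>

lemma card_pts_even:
  assumes j: "j > 0" and h: "j = 2 * (n * h)"
  shows "card (pts j) + (q ^ n - 1) * q ^ (n * h) = q ^ j"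
proof -
  define Q where "Q = q ^ n"
  define R where "R = q ^ (n * h)"
  have h0: "h > 0" using j h by (cases h) auto
  have nh: "n * h > 0" using h0 by simp
  have RR: "q ^ j = R * R" by (simp add: h R_def mult_2 power_add)
  define L where "L = Fix j"
  define E where "E = Fix (n * h)"
  have finL: "finite L" "card L = R * R" using card_Fix[OF j] by (auto simp: L_def RR)
  have finE: "finite E" "card E = R" using card_Fix[OF nh] by (auto simp: E_def R_def)
  have EL: "E \<subseteq> L" unfolding E_def L_def by (rule Fix_mono) (simp add: h)
  have bar_add: "(a + b :: 'a) ^ R = a ^ R + b ^ R" for a b by (simp add: R_def frob_add)
  have bar_bar: "(z ^ R) ^ R = z" if "z \<in> L" for z
    using that by (simp add: L_def Fix_def RR power_mult)
  have ER: "E = {z. z ^ R = z}" by (auto simp: E_def Fix_def R_def)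
  have barL: "z ^ R \<in> L" if "z \<in> L" for z using that unfolding L_def by (rule Fix_power)
  have LC: "a \<in> L \<Longrightarrow> b \<in> L \<Longrightarrow> a + b \<in> L" "a \<in> L \<Longrightarrow> b \<in> L \<Longrightarrow> a - b \<in> L" "a \<in> L \<Longrightarrow> b \<in> L \<Longrightarrow> a * b \<in> L" for a b
    by (auto simp: L_def intro: Fix_add Fix_diff Fix_mult)
  have EC: "a \<in> E \<Longrightarrow> b \<in> E \<Longrightarrow> a + b \<in> E" "a \<in> E \<Longrightarrow> b \<in> E \<Longrightarrow> a - b \<in> E" for a b
    by (auto simp: E_def intro: Fix_add Fix_diff)
  define \<phi> where "\<phi> a = a ^ Q - a" for a :: 'a
  have \<phi>_add: "\<phi> (a + b) = \<phi> a + \<phi> b" for a b by (simp add: \<phi>_def Q_def frob_add)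
  have \<phi>0: "{z. \<phi> z = 0} = Fix n" by (auto simp: \<phi>_def Fix_def Q_def)
  have FnE: "Fix n \<subseteq> E" unfolding E_def by (rule Fix_mono) simp
  have ker: "{z \<in> E. \<phi> z = 0} = Fix n" "{z \<in> L. \<phi> z = 0} = Fix n" using \<phi>0 FnE EL by blast+
  have cardFn: "card (Fix n) = Q" using card_Fix[of n] by (simp add: Q_def)
  have cW: "card (\<phi> ` L) * Q = R * R" "card (\<phi> ` E) * Q = R"
    using card_additive_image[OF finL(1) LC(2,1) \<phi>_add] card_additive_image[OF finE(1) EC(2,1) \<phi>_add]
    unfolding ker cardFn finL finE by simp_all
  have \<phi>E: "\<phi> ` E \<subseteq> E" by (auto simp: \<phi>_def E_def intro!: Fix_diff Fix_power)
  define tr where "tr z = z + z ^ R" for z :: 'a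
  have tr_add: "tr (a + b) = tr a + tr b" for a b by (simp add: tr_def bar_add)
  have trL: "tr ` L \<subseteq> E" using bar_bar by (auto simp: tr_def ER bar_add)
  have ktr: "card {z \<in> L. tr z = 0} \<le> R"
  proof -
    define P :: "'a poly" where "P = Polynomial.monom 1 R + [:0, 1:]"
    have R1: "R > 1" unfolding R_def using q_gt_1 nh by (rule one_less_power)
    then have deg: "Polynomial.degree P = R"
      unfolding P_def by (subst degree_add_eq_left) (auto simp: Polynomial.degree_monom_eq)
    with R1 have P0: "P \<noteq> 0" by auto
    have "{z \<in> L. tr z = 0} \<subseteq> {z. poly P z = 0}" by (auto simp: P_def poly_monom tr_def add.commute)
    then have "card {z \<in> L. tr z = 0} \<le> card {z. poly P z = 0}"
      using poly_roots_finite[OF P0] by (intro card_mono)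
    with card_poly_roots_bound[OF P0] deg show ?thesis by simp
  qed
  have R0: "R > 0" by (simp add: R_def)
  have trc: "card (tr ` L) * card {z \<in> L. tr z = 0} = R * R"
    using card_additive_image[OF finL(1) LC(2,1) tr_add] finL by simp
  have "card (tr ` L) \<le> R" using card_mono[OF finE(1) trL] finE by simp
  \<comment> \<open>Image and kernel of the trace have at most \<open>R\<close> elements each, and
    the product of their sizes is \<open>R * R\<close>; both bounds are equalities.\<close>
  have trE: "tr ` L = E" and ktr': "card {z \<in> L. tr z = 0} = R"
  proof -
    have "R * R \<le> card (tr ` L) * R" using trc ktr by (metis mult_le_mono2)
    then have "card (tr ` L) = R" using R0 \<open>card (tr ` L) \<le> R\<close> by simp
    then show "tr ` L = E" using trL finE by (metis card_subset_eq)
    show "card {z \<in> L. tr z = 0} = R" using trc R0 \<open>card (tr ` L) = R\<close> by simp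
  qed
  \<comment> \<open>The trace commutes with \<open>\<phi>\<close>, which gives one inclusion; equal
    cardinalities give the other.\<close>
  have W: "\<phi> ` L = {z \<in> L. tr z \<in> \<phi> ` E}"
  proof (rule card_subset_eq)
    show "finite {z \<in> L. tr z \<in> \<phi> ` E}" using finL by simp
    have "tr (\<phi> a) = \<phi> (tr a)" for a
      by (simp add: tr_def \<phi>_def Q_def R_def frob_add frob_diff power_mult[symmetric] mult.commute)
    then show "\<phi> ` L \<subseteq> {z \<in> L. tr z \<in> \<phi> ` E}"
      using trL by (auto simp: L_def intro!: Fix_diff Fix_power) (auto simp: \<phi>_def intro!: Fix_diff Fix_power)
    have "card {z \<in> L. tr z \<in> \<phi> ` E} = card (\<phi> ` E) * R"
      using card_additive_preimage[OF finL(1) LC(2,1) tr_add, of "\<phi> ` E"] \<phi>E trE ktr' by simp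
    also have "\<dots> * Q = card (\<phi> ` L) * Q" using cW by (simp add: mult_ac)
    finally show "card (\<phi> ` L) = card {z \<in> L. tr z \<in> \<phi> ` E}"
      using q_power_pos[of n] q_pos by (auto simp: Q_def)
  qed
  \<comment> \<open>The factor \<open>I\<close> is chosen to kill the mixed term: in (b + I b^R)(b^R
    + I b) the product b b^R has coefficient 1 + I^2 = 0, and only \<open>I\<close> times the trace
    of b^2 remains.\<close>
  define N where "N b = b + I * b ^ R" for b
  have IL: "I \<in> L" "I ^ R = I" using I_Fix by (auto simp: L_def R_def Fix_def)
  have N_add: "N (a + b) = N a + N b" for a b by (simp add: N_def bar_add distrib_left)
  have NL: "N b \<in> L" if "b \<in> L" for b using that IL barL LC by (simp add: N_def)
  \<comment> \<open>On the kernel the R-power acts as multiplication by \<open>I\<close>; acting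
    twice gives both \<open>z\<close> and \<open>- z\<close>.\<close>
  have Nker: "{z \<in> L. N z = 0} = {0}"
  proof -
    have "z = 0" if z: "z \<in> L" "N z = 0" for z
    proof -
      have "I * z ^ R = - z" using z(2) by (simp add: N_def eq_neg_iff_add_eq_0 add.commute)
      then have "I * (I * z ^ R) = - (I * z)" by simp
      then have e: "z ^ R = I * z" by (simp add: mult.assoc[symmetric] I_square)
      have "z = (I * z) ^ R" using bar_bar[OF z(1)] e by simp
      also have "\<dots> = I * (I * z)" by (simp add: power_mult_distrib IL e)
      also have "\<dots> = - z" by (simp add: mult.assoc[symmetric] I_square)
      finally have "2 * z = 0" by (simp only: eq_neg_iff_add_eq_0 mult_2)
      with two_nonzero show ?thesis by simp
    qed
    then show ?thesis using R0 by (auto simp: N_def L_def zero_power)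
  qed
  have Ninj: "inj_on N L"
  proof (rule inj_onI)
    fix a b assume ab: "a \<in> L" "b \<in> L" "N a = N b"
    have "N (a - b) = 0" using N_add[of "a - b" b] ab(3) by simp
    then have "a - b \<in> {z \<in> L. N z = 0}" using ab LC by simp
    then show "a = b" using Nker by simp
  qed
  then have NLL: "N ` L = L" using NL finL by (simp add: endo_inj_surj image_subset_iff)
  have key: "tr (b ^ 2) = - I * N b ^ (R + 1)" if "b \<in> L" for b
  proof -
    have "N b ^ R = b ^ R + I * b" using bar_bar[OF that] by (simp add: N_def bar_add power_mult_distrib IL)
    then have "N b ^ (R + 1) = (b + I * b ^ R) * (b ^ R + I * b)" by (simp add: N_def)
    also have "\<dots> = (1 + I * I) * (b * b ^ R) + I * (b * b + b ^ R * b ^ R)" by (simp add: algebra_simps)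
    also have "\<dots> = I * (b ^ 2 + (b ^ 2) ^ R)"
      by (simp add: I_square power2_eq_square power_mult_distrib)
    finally have "- I * N b ^ (R + 1) = - (I * I) * (b ^ 2 + (b ^ 2) ^ R)" by (simp add: mult.assoc)
    then show ?thesis by (simp add: I_square tr_def)
  qed
  \<comment> \<open>The element \<open>- I\<close> lies in \<open>E\<close> and is fixed by the
    Q-power, so multiplication by it commutes with \<open>\<phi>\<close>. The constant in
    \<open>key\<close> is therefore harmless.\<close>
  have Iphi: "- I * w \<in> \<phi> ` E \<longleftrightarrow> w \<in> \<phi> ` E" for w
  proof -
    have IE: "- I \<in> E" "I \<in> E" "I ^ Q = I" "(- I) ^ Q = - I" "I ^ R = I"
      using I_Fix[of "n * h"] I_Fix[of n] by (auto simp: E_def Fix_uminus Fix_def Q_def frob_uminus R_def)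
    have m: "c * \<phi> e = \<phi> (c * e)" if "c ^ Q = c" for c e
      using that by (simp add: \<phi>_def power_mult_distrib right_diff_distrib)
    have Em: "c \<in> E \<Longrightarrow> e \<in> E \<Longrightarrow> c * e \<in> E" for c e unfolding E_def by (rule Fix_mult)
    have "- I * w \<in> \<phi> ` E" if "w \<in> \<phi> ` E" for w using that IE m[of "- I"] Em by (metis (no_types, lifting) image_iff)
    moreover have "w \<in> \<phi> ` E" if "- I * w \<in> \<phi> ` E"
    proof -
      have "w = I * (- I * w)" using I_square by (simp add: mult.assoc[symmetric])
      also have "\<dots> \<in> \<phi> ` E" using that IE m[of I] Em by (metis (no_types, lifting) image_iff)
      finally show ?thesis .
    qed
    ultimately show ?thesis by blast
  qed
  have sq: "b ^ 2 \<in> \<phi> ` L \<longleftrightarrow> N b ^ (R + 1) \<in> \<phi> ` E" if "b \<in> L" for b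
  proof -
    have "b ^ 2 \<in> L" using that by (auto simp: L_def intro: Fix_power)
    then show ?thesis using W key[OF that] Iphi by auto
  qed
  have "card {b \<in> L. b ^ 2 \<in> \<phi> ` L} = card {z \<in> L. z ^ (R + 1) \<in> \<phi> ` E}"
  proof -
    have "bij_betw N {b \<in> L. b ^ 2 \<in> \<phi> ` L} {z \<in> L. z ^ (R + 1) \<in> \<phi> ` E}"
      unfolding bij_betw_def
    proof
      show "inj_on N {b \<in> L. b ^ 2 \<in> \<phi> ` L}" by (rule inj_on_subset[OF Ninj]) auto
      show "N ` {b \<in> L. b ^ 2 \<in> \<phi> ` L} = {z \<in> L. z ^ (R + 1) \<in> \<phi> ` E}"
      proof (intro Set.set_eqI iffI)
        fix z assume "z \<in> N ` {b \<in> L. b ^ 2 \<in> \<phi> ` L}"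
        then obtain b where "b \<in> L" "b ^ 2 \<in> \<phi> ` L" "z = N b" by blast
        then show "z \<in> {z \<in> L. z ^ (R + 1) \<in> \<phi> ` E}" using sq NL by simp
      next
        fix z assume z: "z \<in> {z \<in> L. z ^ (R + 1) \<in> \<phi> ` E}"
        then have "z \<in> N ` L" unfolding NLL by simp
        then obtain b where "b \<in> L" "z = N b" by blast
        then show "z \<in> N ` {b \<in> L. b ^ 2 \<in> \<phi> ` L}" using sq z by (intro image_eqI[of _ _ b]) simp_all
      qed
    qed
    then show ?thesis by (rule bij_betw_same_card)
  qed
  also have "\<dots> = (\<Sum>w\<in>\<phi> ` E. card {z \<in> L. z ^ (R + 1) = w})"
  proof -
    have "{z \<in> L. z ^ (R + 1) \<in> \<phi> ` E} = (\<Union>w\<in>\<phi> ` E. {z \<in> L. z ^ (R + 1) = w})" by auto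
    then show ?thesis
      by (simp only:) (rule card_UN_disjoint; use finL finE in auto)
  qed
  also have "\<dots> = (\<Sum>w\<in>\<phi> ` E. if w = 0 then 1 else R + 1)"
  proof (rule sum.cong[OF refl])
    fix w assume w: "w \<in> \<phi> ` E"
    show "card {z \<in> L. z ^ (R + 1) = w} = (if w = 0 then 1 else R + 1)"
    proof (cases "w = 0")
      case True
      then have "{z \<in> L. z ^ (R + 1) = w} = {0}" by (auto simp: L_def)
      with True show ?thesis by simp
    next
      case False
      then show ?thesis using card_norm_fibre[OF nh, of w] w \<phi>E by (auto simp: L_def E_def h R_def)
    qed
  qed
  also have "\<dots> = 1 + (card (\<phi> ` E) - 1) * (R + 1)"
  proof -
    have z: "0 \<in> \<phi> ` E" by (rule image_eqI[of _ _ 0]) (auto simp: \<phi>_def E_def Q_def)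
    then show ?thesis using finE
      by (subst sum.remove[of _ 0]) (auto simp: sum.If_cases)
  qed
  finally have c1: "card {b \<in> L. b ^ 2 \<in> \<phi> ` L} = 1 + (card (\<phi> ` E) - 1) * (R + 1)" .
  \<comment> \<open>Points are now counted by \<open>b\<close>: each admissible \<open>b\<close> has
    \<open>Q\<close> partners \<open>a\<close>, forming a coset of \<open>Fix n\<close>.\<close>
  have "card (pts j) = (\<Sum>b\<in>{b \<in> L. b ^ 2 \<in> \<phi> ` L}. card {a \<in> L. \<phi> a = b ^ 2})"
  proof -
    have "pts j = prod.swap ` (SIGMA b:{b \<in> L. b ^ 2 \<in> \<phi> ` L}. {a \<in> L. \<phi> a = b ^ 2})"
      by (auto simp: pts_def \<phi>_def L_def Q_def image_iff intro: sym)
    then have "card (pts j) = card (SIGMA b:{b \<in> L. b ^ 2 \<in> \<phi> ` L}. {a \<in> L. \<phi> a = b ^ 2})"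
      by (simp add: card_image)
    then show ?thesis using finL by simp
  qed
  also have "\<dots> = (\<Sum>b\<in>{b \<in> L. b ^ 2 \<in> \<phi> ` L}. Q)"
  proof (rule sum.cong[OF refl])
    fix b assume "b \<in> {b \<in> L. b ^ 2 \<in> \<phi> ` L}"
    then have "{b ^ 2} \<subseteq> \<phi> ` L" by auto
    from card_additive_preimage[OF finL(1) LC(2,1) \<phi>_add this]
    show "card {a \<in> L. \<phi> a = b ^ 2} = Q" using ker cardFn by simp
  qed
  finally have c2: "card (pts j) = (1 + (card (\<phi> ` E) - 1) * (R + 1)) * Q" using c1 by simp
  \<comment> \<open>Writing \<open>R = Suc v * Q\<close> and \<open>Q = Suc u\<close> removes the
    truncated subtractions, and the claim becomes a polynomial identity.\<close>
  obtain v where v: "card (\<phi> ` E) = Suc v"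
    using cW(2) R0 by (cases "card (\<phi> ` E)") auto
  have QR: "R = Suc v * Q" using cW(2) v by simp
  have "Q \<noteq> 0" using q_power_pos[of n] unfolding Q_def by linarith
  then obtain u where u: "Q = Suc u" using not0_implies_Suc by blast
  have "card (pts j) + (Q - 1) * R = R * R"
    unfolding c2 v u QR by (simp add: algebra_simps)
  then show ?thesis by (simp add: RR Q_def R_def)
qed

end

section \<open>Discrete valuation rings inside a field\<close>

definition subring_set :: "'a::field set \<Rightarrow> bool" where
  "subring_set V \<longleftrightarrow> 1 \<in> V \<and> (\<forall>a\<in>V. \<forall>b\<in>V. a - b \<in> V \<and> a * b \<in> V)"

definition subfield_set :: "'a::field set \<Rightarrow> bool" where
  "subfield_set K \<longleftrightarrow> subring_set K \<and> (\<forall>a\<in>K. inverse a \<in> K)"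

lemma subring_setD:
  assumes "subring_set V"
  shows "1 \<in> V" "0 \<in> V" "a \<in> V \<Longrightarrow> - a \<in> V" "a \<in> V \<Longrightarrow> b \<in> V \<Longrightarrow> a - b \<in> V"
    "a \<in> V \<Longrightarrow> b \<in> V \<Longrightarrow> a + b \<in> V" "a \<in> V \<Longrightarrow> b \<in> V \<Longrightarrow> a * b \<in> V" "a \<in> V \<Longrightarrow> a ^ m \<in> V"
proof -
  show one: "1 \<in> V" and diff: "a \<in> V \<Longrightarrow> b \<in> V \<Longrightarrow> a - b \<in> V" and mult: "a \<in> V \<Longrightarrow> b \<in> V \<Longrightarrow> a * b \<in> V" for a b
    using assms by (auto simp: subring_set_def)
  show zero: "0 \<in> V" using diff[OF one one] by simp
  show "a \<in> V \<Longrightarrow> - a \<in> V" for a using diff[OF zero, of a] by simp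
  then show "a \<in> V \<Longrightarrow> b \<in> V \<Longrightarrow> a + b \<in> V" using diff[of a "- b"] by simp
  show "a \<in> V \<Longrightarrow> a ^ m \<in> V" by (induction m) (auto intro: one mult)
qed

lemma subfield_setD:
  assumes "subfield_set K"
  shows "subring_set K" "a \<in> K \<Longrightarrow> inverse a \<in> K" "a \<in> K \<Longrightarrow> b \<in> K \<Longrightarrow> a / b \<in> K"
  using assms subring_setD(6)[of K] by (auto simp: subfield_set_def divide_inverse)

text \<open>The bridge to explicit ring records: all computation takes place in the type-class
  field, and only predicates of the definitions are transported across.\<close>

definition ring_on :: "'a::field set \<Rightarrow> 'a ring" where
  "ring_on V = \<lparr>carrier = V, monoid.mult = (*), one = 1, ring.zero = 0, add = (+)\<rparr>"

lemma ring_on_simps [simp]: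
  "carrier (ring_on V) = V" "monoid.mult (ring_on V) = (*)" "one (ring_on V) = 1"
  "ring.zero (ring_on V) = 0" "add (ring_on V) = (+)" "(ring_on W)\<lparr>carrier := V\<rparr> = ring_on V"
  by (simp_all add: ring_on_def)

lemma domain_ring_on: "subring_set V \<Longrightarrow> domain (ring_on V)"
proof -
  assume "subring_set V"
  note V = subring_setD[OF this]
  show ?thesis
  proof unfold_locales
    show "carrier (add_monoid (ring_on V)) \<subseteq> Units (add_monoid (ring_on V))"
    proof
      fix a assume "a \<in> carrier (add_monoid (ring_on V))"
      then have "a \<in> V" "- a \<in> V" "a + - a = 0" "- a + a = 0" using V(3)[of a] by simp_all
      then show "a \<in> Units (add_monoid (ring_on V))" unfolding Units_def by (auto intro!: bexI[of _ "- a"])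
    qed
  qed (use V in \<open>auto simp: algebra_simps\<close>)
qed

lemma ring_on_a_inv: "subring_set V \<Longrightarrow> a \<in> V \<Longrightarrow> \<ominus>\<^bsub>ring_on V\<^esub> a = - a"
proof -
  assume V: "subring_set V" "a \<in> V"
  interpret domain "ring_on V" by (rule domain_ring_on) fact
  show ?thesis using V subring_setD(3)[OF V(1)] by (intro minus_equality) auto
qed

lemma Units_ring_on: "subring_set V \<Longrightarrow> Units (ring_on V) = {u \<in> V. u \<noteq> 0 \<and> inverse u \<in> V}"
proof (intro Set.set_eqI iffI)
  fix u assume V: "subring_set V" and "u \<in> Units (ring_on V)"
  then obtain v where "v \<in> V" "u \<in> V" "v * u = 1" by (auto simp: Units_def)
  then have "u \<noteq> 0" "inverse u = v" by (auto simp: inverse_unique mult.commute)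
  then show "u \<in> {u \<in> V. u \<noteq> 0 \<and> inverse u \<in> V}" using \<open>u \<in> V\<close> \<open>v \<in> V\<close> by simp
qed (auto simp: Units_def intro!: bexI[of _ "inverse u" for u])

lemma ring_on_inv: "subfield_set K \<Longrightarrow> a \<in> K \<Longrightarrow> a \<noteq> 0 \<Longrightarrow> inv\<^bsub>ring_on K\<^esub> a = inverse a"
proof -
  assume K: "subfield_set K" "a \<in> K" "a \<noteq> 0"
  interpret domain "ring_on K" by (rule domain_ring_on) (use K in \<open>simp add: subfield_set_def\<close>)
  show ?thesis using K by (intro comm_inv_char) (auto intro: subfield_setD)
qed

lemma field_ring_on: "subfield_set K \<Longrightarrow> field (ring_on K)"
proof -
  assume K: "subfield_set K"
  interpret domain "ring_on K" by (rule domain_ring_on) (use K in \<open>simp add: subfield_set_def\<close>)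
  show ?thesis using K
    by unfold_locales (auto simp: Units_ring_on subfield_setD)
qed

lemma subring_ring_on:
  assumes "subring_set K"
  shows "subring V (ring_on K) \<longleftrightarrow> V \<subseteq> K \<and> subring_set V"
proof
  interpret domain "ring_on K" by (rule domain_ring_on) fact
  assume V: "subring V (ring_on K)"
  note V' = subringE[OF V]
  have sub: "V \<subseteq> K" using V'(1) by simp
  have "a - b \<in> V" if "a \<in> V" "b \<in> V" for a b
    using V'(5)[OF that(2)] V'(7)[OF that(1), of "- b"] ring_on_a_inv[OF assms, of b] that sub by auto
  then show "V \<subseteq> K \<and> subring_set V" using V' sub by (auto simp: subring_set_def)
next
  interpret domain "ring_on K" by (rule domain_ring_on) fact
  assume V: "V \<subseteq> K \<and> subring_set V"
  show "subring V (ring_on K)"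
    using V subring_setD[of V] ring_on_a_inv[OF assms] by (intro subringI) auto
qed

text \<open>A discrete valuation ring of \<open>K\<close> in terms of a uniformizer
  \<open>t\<close>. The two forms of \<open>z\<close> cover nonnegative and nonpositive valuation,
  as the exponents are natural numbers.\<close>

definition dvr_set :: "'a::field set \<Rightarrow> 'a set \<Rightarrow> 'a \<Rightarrow> bool" where
  "dvr_set K V t \<longleftrightarrow> subring_set V \<and> V \<subseteq> K \<and> t \<in> V \<and> t \<noteq> 0 \<and> inverse t \<notin> V \<and>
     (\<forall>z\<in>K - {0}. \<exists>u m. u \<in> V \<and> u \<noteq> 0 \<and> inverse u \<in> V \<and> (z = u * t ^ m \<or> z = u / t ^ m))"

definition nonunits :: "'a::field set \<Rightarrow> 'a set" where
  "nonunits V = {z \<in> V. z = 0 \<or> inverse z \<notin> V}"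

lemma ideal_ring_on:
  assumes "subring_set V"
  shows "ideal J (ring_on V) \<longleftrightarrow> J \<subseteq> V \<and> 0 \<in> J \<and> (\<forall>a\<in>J. \<forall>b\<in>J. a + b \<in> J) \<and> (\<forall>a\<in>J. \<forall>v\<in>V. v * a \<in> J)"
    (is "?I \<longleftrightarrow> ?J")
proof -
  interpret R: domain "ring_on V" by (rule domain_ring_on) fact
  have ?J if ?I
  proof -
    from that interpret ideal J "ring_on V" .
    show ?thesis
      using a_subset zero_closed additive_subgroup.a_closed[OF is_additive_subgroup] I_l_closed by simp
  qed
  moreover have ?I if J: ?J
  proof -
    have neg: "- a \<in> J" if "a \<in> J" for a
      using J that subring_setD(1,3)[OF assms] by (metis mult_minus1)
    show ?thesis
    proof (rule idealI)
      show "subgroup J (add_monoid (ring_on V))"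
      proof (rule R.add.subgroupI)
        show "\<ominus>\<^bsub>ring_on V\<^esub> a \<in> J" if "a \<in> J" for a
          using ring_on_a_inv[OF assms, of a] that J neg[OF that] by auto
      qed (use J in auto)
    qed (use J in \<open>auto simp: mult.commute intro: R.ring_axioms\<close>)
  qed
  ultimately show ?thesis by blast
qed

lemma dvr_setD:
  assumes "dvr_set K V t"
  shows "subring_set V" "V \<subseteq> K" "t \<in> V" "t \<noteq> 0" "inverse t \<notin> V"
  using assms by (auto simp: dvr_set_def)

lemma dvr_unit_decomp:
  assumes "dvr_set K V t" "z \<in> K" "z \<noteq> 0"
  obtains u m where "u \<in> V" "u \<noteq> 0" "inverse u \<in> V" "z = u * t ^ m \<or> z = u / t ^ m"
  using assms unfolding dvr_set_def by blast

text \<open>Multiplying by the inverse unit and by \<open>t ^ (m - 1)\<close> would bring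
  \<open>inverse t\<close> into \<open>V\<close>.\<close>

lemma dvr_power_notin:
  assumes "dvr_set K V t" "m > 0" "u \<in> V" "u \<noteq> 0" "inverse u \<in> V"
  shows "u / t ^ m \<notin> V"
proof
  note V = dvr_setD[OF assms(1)] subring_setD[OF dvr_setD(1)[OF assms(1)]]
  assume "u / t ^ m \<in> V"
  then have "inverse u * (u / t ^ m) * t ^ (m - 1) \<in> V" using assms V by (intro V) auto
  moreover have "inverse u * (u / t ^ m) * t ^ (m - 1) = inverse t"
    using assms(2,4) V(4) by (cases m) (auto simp: field_simps)
  ultimately show False using V by simp
qed

lemma dvr_V_decomp:
  assumes "dvr_set K V t" "z \<in> V" "z \<noteq> 0"
  obtains u m where "u \<in> V" "u \<noteq> 0" "inverse u \<in> V" "z = u * t ^ m"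
proof -
  obtain u m where u: "u \<in> V" "u \<noteq> 0" "inverse u \<in> V" "z = u * t ^ m \<or> z = u / t ^ m"
    using dvr_unit_decomp[OF assms(1)] dvr_setD(2)[OF assms(1)] assms(2,3) by blast
  show ?thesis
  proof (cases "z = u * t ^ m")
    case False
    then have "z = u / t ^ m" "m > 0" using u by (auto intro: ccontr)
    then show ?thesis using dvr_power_notin[OF assms(1), of m u] u assms(2) by blast
  qed (use u that in blast)
qed

lemma dvr_valuation:
  assumes "dvr_set K V t" "z \<in> K" "z \<notin> V"
  shows "inverse z \<in> V"
proof -
  note V = dvr_setD[OF assms(1)] subring_setD[OF dvr_setD(1)[OF assms(1)]]
  have "z \<noteq> 0" using assms V by auto
  from dvr_unit_decomp[OF assms(1,2) this] obtain u m where
    u: "u \<in> V" "u \<noteq> 0" "inverse u \<in> V" "z = u * t ^ m \<or> z = u / t ^ m" .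
  moreover have "u * t ^ m \<in> V" using V(11)[OF u(1) V(12)[OF V(3)]] .
  ultimately have "z = u / t ^ m" using assms(3) by metis
  then have "inverse z = inverse u * t ^ m" by (simp add: divide_inverse mult.commute)
  then show ?thesis using V(11)[OF u(3) V(12)[OF V(3)]] by simp
qed

text \<open>The maximal ideal is principal with generator \<open>t\<close>; in this form its closure
  properties become distributivity.\<close>

lemma dvr_nonunits:
  assumes "dvr_set K V t"
  shows "nonunits V = (\<lambda>v. v * t) ` V"
proof (intro Set.set_eqI iffI)
  note V = dvr_setD[OF assms] subring_setD[OF dvr_setD(1)[OF assms]]
  fix z assume z: "z \<in> nonunits V"
  show "z \<in> (\<lambda>v. v * t) ` V"
  proof (cases "z = 0")
    case True then show ?thesis using V by (intro image_eqI[of _ _ 0]) auto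
  next
    case False
    obtain u m where u: "u \<in> V" "inverse u \<in> V" "z = u * t ^ m"
      using dvr_V_decomp[OF assms, of z] z False unfolding nonunits_def by blast
    have "m \<noteq> 0" using u z False by (auto simp: nonunits_def intro: ccontr)
    then obtain m' where "m = Suc m'" using not0_implies_Suc by blast
    then have "z = (u * t ^ m') * t" using u by (simp add: mult_ac)
    then show ?thesis using u V by (intro image_eqI[of _ _ "u * t ^ m'"]) auto
  qed
next
  note V = dvr_setD[OF assms] subring_setD[OF dvr_setD(1)[OF assms]]
  fix z assume "z \<in> (\<lambda>v. v * t) ` V"
  then obtain v where v: "v \<in> V" "z = v * t" by auto
  have "inverse z \<notin> V" if "z \<noteq> 0"
  proof
    assume "inverse z \<in> V"
    then have "v * inverse z \<in> V" using v V(11) by metis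
    moreover have "v * inverse z = inverse t" using v that by (simp add: field_simps)
    ultimately show False using V by simp
  qed
  then show "z \<in> nonunits V" using v V by (auto simp: nonunits_def)
qed

lemma dvr_nonunits_ideal:
  assumes "dvr_set K V t"
  shows "a \<in> nonunits V \<Longrightarrow> b \<in> nonunits V \<Longrightarrow> a + b \<in> nonunits V"
    "a \<in> nonunits V \<Longrightarrow> b \<in> nonunits V \<Longrightarrow> a - b \<in> nonunits V"
    "a \<in> nonunits V \<Longrightarrow> v \<in> V \<Longrightarrow> v * a \<in> nonunits V"
    "v \<in> V \<Longrightarrow> w \<in> V \<Longrightarrow> v * w \<in> nonunits V \<Longrightarrow> v \<in> nonunits V \<or> w \<in> nonunits V"
proof -
  note V = dvr_setD[OF assms] subring_setD[OF dvr_setD(1)[OF assms]]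
  show "a \<in> nonunits V \<Longrightarrow> b \<in> nonunits V \<Longrightarrow> a + b \<in> nonunits V"
    unfolding dvr_nonunits[OF assms] using V(10) by (auto simp: distrib_right[symmetric])
  show "a \<in> nonunits V \<Longrightarrow> b \<in> nonunits V \<Longrightarrow> a - b \<in> nonunits V"
    unfolding dvr_nonunits[OF assms] using V(9) by (auto simp: left_diff_distrib[symmetric])
  show "a \<in> nonunits V \<Longrightarrow> v \<in> V \<Longrightarrow> v * a \<in> nonunits V"
    unfolding dvr_nonunits[OF assms] using V(11) by (auto simp: mult.assoc[symmetric])
  show "v \<in> V \<Longrightarrow> w \<in> V \<Longrightarrow> v * w \<in> nonunits V \<Longrightarrow> v \<in> nonunits V \<or> w \<in> nonunits V"
    using V(11)[of "inverse v" "inverse w"] by (auto simp: nonunits_def)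
qed

text \<open>A strictly larger \<open>W\<close> would contain an element of negative valuation, hence
  \<open>inverse t\<close>, hence all of \<open>K\<close>, including \<open>inverse s\<close>. To
  identify two places, one inclusion is thus enough.\<close>

lemma dvr_maximal:
  assumes "subfield_set K" "dvr_set K V t" "dvr_set K W s" "V \<subseteq> W"
  shows "V = W"
proof (rule ccontr)
  assume "V \<noteq> W"
  note V = dvr_setD[OF assms(2)] subring_setD[OF dvr_setD(1)[OF assms(2)]]
  note W = dvr_setD[OF assms(3)] subring_setD[OF dvr_setD(1)[OF assms(3)]]
  obtain z where z: "z \<in> W" "z \<notin> V" using \<open>V \<noteq> W\<close> assms(4) by blast
  then have "z \<noteq> 0" using V by auto
  have "z \<in> K" using z(1) W(2) by blast
  from dvr_unit_decomp[OF assms(2) this \<open>z \<noteq> 0\<close>] obtain u m where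
    u: "u \<in> V" "u \<noteq> 0" "inverse u \<in> V" "z = u * t ^ m \<or> z = u / t ^ m" .
  moreover have "u * t ^ m \<in> V" using V(11)[OF u(1) V(12)[OF V(3)]] .
  ultimately have zu: "z = u / t ^ m" using z by metis
  with z u(1) have "m \<noteq> 0" by (metis div_by_1 power_0)
  then obtain m' where m': "m = Suc m'" using not0_implies_Suc by blast
  have "inverse u \<in> W" "t \<in> W" using subsetD[OF assms(4) u(3)] subsetD[OF assms(4) V(3)] by simp_all
  then have "inverse u * z * t ^ m' \<in> W" using z W(11,12) by metis
  moreover have "inverse u * z * t ^ m' = inverse t" using u V(4) by (simp add: zu m' field_simps)
  ultimately have it: "inverse t \<in> W" by simp
  have "w \<in> W" if w: "w \<in> K" for w
  proof (cases "w = 0")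
    case False
    obtain u m where u: "u \<in> V" "w = u * t ^ m \<or> w = u / t ^ m"
      using dvr_unit_decomp[OF assms(2) w False] by metis
    have uW: "u \<in> W" and tW: "t \<in> W" using subsetD[OF assms(4) u(1)] subsetD[OF assms(4) V(3)] by simp_all
    have "u * t ^ m \<in> W" using W(11)[OF uW W(12)[OF tW]] .
    moreover have "u / t ^ m \<in> W" using W(11)[OF uW W(12)[OF it]] by (simp add: divide_inverse power_inverse)
    ultimately show ?thesis using u(2) by metis
  qed (use W in simp)
  moreover have "inverse s \<in> K" using subfield_setD(2)[OF assms(1), of s] subsetD[OF W(2) W(3)] by simp
  ultimately show False using W(5) by metis
qed

lemma dvr_nonunits_is_ideal: "dvr_set K V t \<Longrightarrow> ideal (nonunits V) (ring_on V)"
  using dvr_nonunits_ideal[of K V t] dvr_setD(1)[of K V t] subring_setD(2)[of V]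
  by (subst ideal_ring_on) (auto simp: nonunits_def)

lemma ideal_subset_nonunits:
  assumes "dvr_set K V t" "ideal J (ring_on V)" "J \<noteq> V"
  shows "J \<subseteq> nonunits V"
proof
  note V = dvr_setD(1)[OF assms(1)]
  have J: "J \<subseteq> V" "\<And>a v. a \<in> J \<Longrightarrow> v \<in> V \<Longrightarrow> v * a \<in> J" using assms(2) V by (auto simp: ideal_ring_on)
  fix a assume a: "a \<in> J"
  show "a \<in> nonunits V"
  proof (rule ccontr)
    assume "a \<notin> nonunits V"
    then have "a \<noteq> 0" "inverse a \<in> V" using a J by (auto simp: nonunits_def)
    then have "v \<in> J" if "v \<in> V" for v
      using J(2)[OF a subring_setD(6)[OF V that \<open>inverse a \<in> V\<close>]] by (simp add: mult.assoc)
    with J(1) assms(3) show False by blast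
  qed
qed

lemma nonunits_maximal:
  assumes "dvr_set K V t"
  shows "maximalideal P (ring_on V) \<longleftrightarrow> P = nonunits V"
proof
  note V = dvr_setD(1)[OF assms]
  have one: "1 \<in> V" "1 \<notin> nonunits V" using subring_setD(1)[OF V] by (auto simp: nonunits_def)
  show "maximalideal P (ring_on V)" if P: "P = nonunits V"
  proof (rule maximalidealI)
    show "ideal P (ring_on V)" unfolding P by (rule dvr_nonunits_is_ideal[OF assms])
    show "carrier (ring_on V) \<noteq> P" using one P by auto
    show "J = P \<or> J = carrier (ring_on V)" if "ideal J (ring_on V)" "P \<subseteq> J" "J \<subseteq> carrier (ring_on V)" for J
      using ideal_subset_nonunits[OF assms that(1)] that P by auto
  qed
  show "P = nonunits V" if P: "maximalideal P (ring_on V)"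
  proof -
    interpret maximalideal P "ring_on V" by fact
    have "P \<subseteq> nonunits V" using ideal_subset_nonunits[OF assms is_ideal] I_notcarr by auto
    then have "nonunits V = P \<or> nonunits V = V"
      using I_maximal[OF dvr_nonunits_is_ideal[OF assms]] by (auto simp: nonunits_def)
    with one show ?thesis by auto
  qed
qed

text \<open>A nonzero ideal contains, with each nonzero element, the power of \<open>t\<close> of
  the same order; the least such power generates it.\<close>

lemma dvr_principal:
  assumes "dvr_set K V t"
  shows "principal_domain (ring_on V)"
proof -
  note V = dvr_setD[OF assms] subring_setD[OF dvr_setD(1)[OF assms]]
  interpret R: domain "ring_on V" by (rule domain_ring_on[OF V(1)])
  have "\<exists>a\<in>V. J = PIdl\<^bsub>ring_on V\<^esub> a" if "ideal J (ring_on V)" for J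
  proof -
    have J: "J \<subseteq> V" "0 \<in> J" "\<And>a v. a \<in> J \<Longrightarrow> v \<in> V \<Longrightarrow> v * a \<in> J" using that V(1) by (auto simp: ideal_ring_on)
    have gen: "PIdl\<^bsub>ring_on V\<^esub> a = (\<lambda>v. v * a) ` V" for a by (auto simp: cgenideal_def)
    show ?thesis
    proof (cases "J = {0}")
      case True
      then have "J = PIdl\<^bsub>ring_on V\<^esub> 0" using V(7) by (auto simp: gen)
      then show ?thesis using V(7) by blast
    next
      case False
      then obtain z where z: "z \<in> J" "z \<noteq> 0" using J(2) by blast
      have pw: "\<exists>m. t ^ m \<in> J \<and> (\<exists>u\<in>V. z = u * t ^ m)" if z: "z \<in> J" "z \<noteq> 0" for z
      proof -
        obtain u m where u: "u \<in> V" "u \<noteq> 0" "inverse u \<in> V" "z = u * t ^ m"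
          using dvr_V_decomp[OF assms, of z] J(1) z by blast
        have "inverse u * z \<in> J" using J(3) z(1) u(3) by simp
        with u show ?thesis by (auto simp: mult.assoc[symmetric])
      qed
      define m where "m = (LEAST m. t ^ m \<in> J)"
      have m: "t ^ m \<in> J" unfolding m_def using pw[OF z] LeastI[of "\<lambda>m. t ^ m \<in> J"] by blast
      have "J = (\<lambda>v. v * t ^ m) ` V"
      proof
        show "(\<lambda>v. v * t ^ m) ` V \<subseteq> J" using J(3)[OF m] by auto
        show "J \<subseteq> (\<lambda>v. v * t ^ m) ` V"
        proof
          fix y assume y: "y \<in> J"
          show "y \<in> (\<lambda>v. v * t ^ m) ` V"
          proof (cases "y = 0")
            case True then show ?thesis using V(7) by (intro image_eqI[of _ _ 0]) auto
          next
            case False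
            then obtain m' u where m': "t ^ m' \<in> J" "u \<in> V" "y = u * t ^ m'" using pw y by blast
            have "m \<le> m'" unfolding m_def using m'(1) by (rule Least_le)
            then have "t ^ m' = t ^ (m' - m) * t ^ m" by (simp add: power_add[symmetric])
            then have "y = (u * t ^ (m' - m)) * t ^ m" using m' by (simp add: mult.assoc)
            moreover have "u * t ^ (m' - m) \<in> V" using V(11)[OF m'(2) V(12)[OF V(3)]] .
            ultimately show ?thesis by blast
          qed
        qed
      qed
      then have "J = PIdl\<^bsub>ring_on V\<^esub> (t ^ m)" by (simp add: gen)
      then show ?thesis using V(12)[OF V(3)] by blast
    qed
  qed
  then show ?thesis by unfold_locales auto
qed

lemma dvr_imp_discrete_valuation_ring:
  assumes "dvr_set K V t"
  shows "discrete_valuation_ring (ring_on V)"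
  unfolding discrete_valuation_ring_def
proof (intro conjI)
  note V = dvr_setD[OF assms]
  show "principal_domain (ring_on V)" by (rule dvr_principal[OF assms])
  show "\<exists>!P. maximalideal P (ring_on V)" using nonunits_maximal[OF assms] by auto
  show "\<not> field (ring_on V)"
  proof
    assume "field (ring_on V)"
    then have "t \<in> Units (ring_on V)" using V by (simp add: field.field_Units)
    with V show False by (simp add: Units_ring_on)
  qed
qed

text \<open>Any irreducible element is a uniformizer: it generates the only maximal ideal, so it
  divides every nonunit, and ascending chains of ideals stop, so it divides a nonzero element only
  finitely often.\<close>

lemma discrete_valuation_ring_imp_dvr:
  assumes K: "subfield_set K" and V: "subring_set V" "V \<subseteq> K"
    and dvr: "discrete_valuation_ring (ring_on V)"
    and quot: "\<And>z. z \<in> K \<Longrightarrow> \<exists>a\<in>V. \<exists>b\<in>V - {0}. z = a / b"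
  shows "\<exists>t. dvr_set K V t"
proof -
  from dvr interpret R: principal_domain "ring_on V" by (simp add: discrete_valuation_ring_def)
  have units: "Units (ring_on V) = {u \<in> V. u \<noteq> 0 \<and> inverse u \<in> V}" by (rule Units_ring_on[OF V(1)])
  have "\<not> field (ring_on V)" using dvr by (simp add: discrete_valuation_ring_def)
  have "\<exists>a\<in>V. a \<noteq> 0 \<and> a \<notin> Units (ring_on V)"
  proof (rule ccontr)
    assume "\<not> ?thesis"
    then have "Units (ring_on V) = V - {0}" by (auto simp: units)
    then have "field (ring_on V)" by unfold_locales simp
    with \<open>\<not> field (ring_on V)\<close> show False ..
  qed
  then obtain a where a: "a \<in> V" "a \<noteq> 0" "a \<notin> Units (ring_on V)" by blast
  have irr: "\<exists>p\<in>V. ring_irreducible\<^bsub>ring_on V\<^esub> p \<and> (\<exists>v\<in>V. a = p * v)"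
    if aV: "a \<in> V" "a \<noteq> 0" "a \<notin> Units (ring_on V)" for a
  proof -
    obtain p where "p \<in> carrier (ring_on V)" "ring_irreducible\<^bsub>ring_on V\<^esub> p" "p divides\<^bsub>ring_on V\<^esub> a"
      by (rule R.exists_irreducible_divisor[of a]) (use aV in auto)
    then show ?thesis by (auto simp: factor_def)
  qed
  obtain t where t: "t \<in> V" "ring_irreducible\<^bsub>ring_on V\<^esub> t" using irr[OF a] by blast
  have t0: "t \<noteq> 0" and tU: "inverse t \<notin> V"
    using t R.ring_irreducibleE[of t] by (auto simp: units)
  have gen: "PIdl\<^bsub>ring_on V\<^esub> a = (\<lambda>v. v * a) ` V" for a by (auto simp: cgenideal_def)
  obtain M where M: "\<And>P. maximalideal P (ring_on V) \<Longrightarrow> P = M"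
    using dvr by (auto simp: discrete_valuation_ring_def)
  have div: "\<exists>w\<in>V. a = w * t" if aV: "a \<in> V" "a \<noteq> 0" "a \<notin> Units (ring_on V)" for a
  proof -
    obtain p v where p: "p \<in> V" "ring_irreducible\<^bsub>ring_on V\<^esub> p" "v \<in> V" "a = p * v" using irr[OF aV] by blast
    have "PIdl\<^bsub>ring_on V\<^esub> p = PIdl\<^bsub>ring_on V\<^esub> t"
      using M R.irreducible_imp_maximalideal p(1,2) t by (metis ring_on_simps(1))
    then have "p \<in> (\<lambda>v. v * t) ` V" using subring_setD(1)[OF V(1)] p(1) unfolding gen by (metis image_eqI mult_1)
    then obtain w where "w \<in> V" "p = w * t" by blast
    then show ?thesis using p subring_setD(6)[OF V(1)] by (intro bexI[of _ "v * w"]) (auto simp: mult_ac)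
  qed
  \<comment> \<open>Unlimited divisibility by \<open>t\<close> would give an increasing chain of
    principal ideals generated by \<open>a / t ^ m\<close>; where it becomes stationary,
    \<open>t\<close> would be a unit.\<close>
  have bounded: "\<exists>m. \<not> (\<exists>w\<in>V. a = w * t ^ m)" if a: "a \<in> V" "a \<noteq> 0" for a
  proof (rule ccontr)
    assume "\<not> ?thesis"
    then have ex: "\<exists>w. w \<in> V \<and> a = w * t ^ m" for m by blast
    define w where "w m = a / t ^ m" for m
    have w: "w m \<in> V" "w m \<noteq> 0" "w m = w (Suc m) * t" for m
      using ex[of m] t0 a by (auto simp: w_def)
    define C where "C = range (\<lambda>m. PIdl\<^bsub>ring_on V\<^esub> (w m))"
    have mono: "PIdl\<^bsub>ring_on V\<^esub> (w m) \<subseteq> PIdl\<^bsub>ring_on V\<^esub> (w (Suc m))" for m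
      unfolding gen w(3)[of m] using subring_setD(6)[OF V(1)] t(1) by (auto simp: image_iff mult_ac)
    have inc: "incseq (\<lambda>m. PIdl\<^bsub>ring_on V\<^esub> (w m))" using mono by (rule incseq_SucI)
    have "PIdl\<^bsub>ring_on V\<^esub> (w i) \<subseteq> PIdl\<^bsub>ring_on V\<^esub> (w j) \<or> PIdl\<^bsub>ring_on V\<^esub> (w j) \<subseteq> PIdl\<^bsub>ring_on V\<^esub> (w i)" for i j
      using nat_le_linear[of i j] incseqD[OF inc] by blast
    then have chain: "subset.chain {I. ideal I (ring_on V)} C"
      unfolding C_def subset_chain_def using R.cgenideal_ideal w(1) by auto
    have "\<Union>C \<in> C" by (rule R.ideal_chain_is_trivial[OF _ chain]) (simp add: C_def)
    then obtain m where "\<Union>C = PIdl\<^bsub>ring_on V\<^esub> (w m)" by (auto simp: C_def)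
    then have "PIdl\<^bsub>ring_on V\<^esub> (w (Suc m)) \<subseteq> PIdl\<^bsub>ring_on V\<^esub> (w m)" by (auto simp: C_def)
    moreover have "w (Suc m) \<in> PIdl\<^bsub>ring_on V\<^esub> (w (Suc m))"
      unfolding gen using subring_setD(1)[OF V(1)] by (metis image_eqI mult_1)
    ultimately obtain v where v: "v \<in> V" "w (Suc m) = v * w m" unfolding gen by blast
    have "w (Suc m) = v * (w (Suc m) * t)" using v(2) by (subst (asm) w(3)[of m])
    then have "w (Suc m) * (v * t) = w (Suc m) * 1" by (simp add: mult_ac)
    then have "v * t = 1" using w(2)[of "Suc m"] by (simp only: mult_cancel_left) simp
    then have "inverse t = v" by (simp add: inverse_unique mult.commute)
    with tU v(1) show False by simp
  qed
  have decomp: "\<exists>u m. u \<in> V \<and> u \<noteq> 0 \<and> inverse u \<in> V \<and> a = u * t ^ m" if a: "a \<in> V" "a \<noteq> 0" for a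
  proof -
    obtain m where m: "\<not> (\<exists>w\<in>V. a = w * t ^ m)" using bounded[OF a] by blast
    have "\<exists>m. (\<exists>w\<in>V. a = w * t ^ m) \<and> \<not> (\<exists>w\<in>V. a = w * t ^ Suc m)"
    proof (rule ccontr)
      assume "\<not> ?thesis"
      then have "\<exists>w\<in>V. a = w * t ^ i" for i
        by (induction i) (use a in auto)
      with m show False by blast
    qed
    then obtain m w where w: "w \<in> V" "a = w * t ^ m" and n: "\<not> (\<exists>w\<in>V. a = w * t ^ Suc m)" by blast
    have w0: "w \<noteq> 0" using w a by auto
    have "w \<in> Units (ring_on V)"
    proof (rule ccontr)
      assume "w \<notin> Units (ring_on V)"
      from div[OF w(1) w0 this] obtain w' where "w' \<in> V" "w = w' * t" by blast
      with n w show False by (auto simp: mult.assoc)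
    qed
    with w show ?thesis by (auto simp: units)
  qed
  have "\<exists>u m. u \<in> V \<and> u \<noteq> 0 \<and> inverse u \<in> V \<and> (z = u * t ^ m \<or> z = u / t ^ m)" if z: "z \<in> K - {0}" for z
  proof -
    obtain a b where ab: "a \<in> V" "b \<in> V" "b \<noteq> 0" "z = a / b" using quot z by blast
    then have "a \<noteq> 0" using z by auto
    obtain u m where u: "u \<in> V" "u \<noteq> 0" "inverse u \<in> V" "a = u * t ^ m" using decomp[OF ab(1) \<open>a \<noteq> 0\<close>] by blast
    obtain u' m' where u': "u' \<in> V" "u' \<noteq> 0" "inverse u' \<in> V" "b = u' * t ^ m'" using decomp[OF ab(2,3)] by blast
    define v where "v = u * inverse u'"
    have v: "v \<in> V" "v \<noteq> 0" "inverse v \<in> V"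
      using u u' subring_setD(6)[OF V(1)] by (auto simp: v_def mult.commute)
    have zv: "z = v * t ^ m / t ^ m'" using ab u u' by (simp add: v_def divide_inverse)
    show ?thesis
    proof (cases "m' \<le> m")
      case True
      then have "z = v * t ^ (m - m')" using zv t0 by (simp add: power_diff)
      with v show ?thesis by blast
    next
      case False
      then have "t ^ m' = t ^ (m' - m) * t ^ m" by (simp add: power_add[symmetric])
      then have "z = v / t ^ (m' - m)" using zv t0 by simp
      with v show ?thesis by blast
    qed
  qed
  then show ?thesis using V t t0 tU by (auto simp: dvr_set_def)
qed

theorem function_field_primes_iff:
  assumes K: "subfield_set K"
  shows "V \<in> function_field_primes F (ring_on K) \<longleftrightarrow> F \<subseteq> V \<and> (\<exists>t. dvr_set K V t)"
proof -
  have K': "subring_set K" using K by (simp add: subfield_set_def)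
  have quot: "(\<exists>a\<in>V. \<exists>b\<in>V - {\<zero>\<^bsub>ring_on K\<^esub>}. z = a \<otimes>\<^bsub>ring_on K\<^esub> inv\<^bsub>ring_on K\<^esub> b) \<longleftrightarrow>
      (\<exists>a\<in>V. \<exists>b\<in>V - {0}. z = a / b)" if "V \<subseteq> K" for z V
  proof -
    have "inv\<^bsub>ring_on K\<^esub> b = inverse b" if "b \<in> V" "b \<noteq> 0" for b
      using ring_on_inv[OF K, of b] that \<open>V \<subseteq> K\<close> by blast
    then show ?thesis unfolding divide_inverse ring_on_simps by (intro bex_cong refl) auto
  qed
  show ?thesis
  proof
    assume "V \<in> function_field_primes F (ring_on K)"
    then have V: "subring V (ring_on K)" "F \<subseteq> V" "discrete_valuation_ring (ring_on V)"
      "\<And>z. z \<in> K \<Longrightarrow> \<exists>a\<in>V. \<exists>b\<in>V - {\<zero>\<^bsub>ring_on K\<^esub>}. z = a \<otimes>\<^bsub>ring_on K\<^esub> inv\<^bsub>ring_on K\<^esub> b"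
      by (auto simp: function_field_primes_def)
    have V': "V \<subseteq> K" "subring_set V" using V(1) subring_ring_on[OF K'] by auto
    have "\<exists>a\<in>V. \<exists>b\<in>V - {0}. z = a / b" if "z \<in> K" for z
      using V(4)[OF that] quot[OF V'(1)] by simp
    from discrete_valuation_ring_imp_dvr[OF K V'(2,1) V(3) this] V(2)
    show "F \<subseteq> V \<and> (\<exists>t. dvr_set K V t)" by simp
  next
    assume A: "F \<subseteq> V \<and> (\<exists>t. dvr_set K V t)"
    then obtain t where t: "dvr_set K V t" by blast
    note V = dvr_setD[OF t] subring_setD[OF dvr_setD(1)[OF t]]
    have "\<exists>a\<in>V. \<exists>b\<in>V - {0}. z = a / b" if z: "z \<in> K" for z
    proof (cases "z \<in> V")
      case True
      then show ?thesis using V(6) by (intro bexI[of _ z] bexI[of _ 1]) auto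
    next
      case False
      then have "z \<noteq> 0" using V(7) by auto
      then show ?thesis using dvr_valuation[OF t z False] V(6)
        by (intro bexI[of _ 1] bexI[of _ "inverse z"]) (auto simp: field_simps)
    qed
    then show "V \<in> function_field_primes F (ring_on K)"
      unfolding function_field_primes_def
      using A subring_ring_on[OF K', of V] V(1,2) dvr_imp_discrete_valuation_ring[OF t] quot[OF V(2)] by auto
  qed
qed

text \<open>Any map whose fibres on \<open>V\<close> are the residue classes can replace the
  quotient by cosets. Evaluation at a point will be such a map.\<close>

theorem prime_norm_ring_on:
  assumes "dvr_set K V t"
    and \<phi>: "\<And>a b. a \<in> V \<Longrightarrow> b \<in> V \<Longrightarrow> \<phi> a = \<phi> b \<longleftrightarrow> a - b \<in> nonunits V"
  shows "prime_norm (ring_on K) V = card (\<phi> ` V)"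
proof -
  note V = dvr_setD[OF assms(1)] subring_setD[OF dvr_setD(1)[OF assms(1)]]
  have M: "(THE P. maximalideal P (ring_on V)) = nonunits V"
    using nonunits_maximal[OF assms(1)] by auto
  define C where "C a = (\<lambda>h. h + a) ` nonunits V" for a
  have "carrier (residue_field (ring_on K) V) = C ` V"
    by (auto simp: residue_field_def FactRing_def M A_RCOSETS_def' a_r_coset_def' C_def)
  moreover have C: "C a = C b \<longleftrightarrow> \<phi> a = \<phi> b" if "a \<in> V" "b \<in> V" for a b
  proof
    have z: "0 \<in> nonunits V" using V(7) by (simp add: nonunits_def)
    assume "C a = C b"
    moreover have "a \<in> C a" using z by (auto simp: C_def image_iff intro!: bexI[of _ 0])
    ultimately obtain h where "h \<in> nonunits V" "a = h + b" by (auto simp: C_def)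
    then show "\<phi> a = \<phi> b" using \<phi> that by simp
  next
    have sub: "C a \<subseteq> C b" if "a - b \<in> nonunits V" for a b
    proof
      fix x assume "x \<in> C a"
      then obtain h where h: "h \<in> nonunits V" "x = h + a" by (auto simp: C_def)
      then have "h + (a - b) \<in> nonunits V" using dvr_nonunits_ideal(1)[OF assms(1)] that by blast
      with h show "x \<in> C b" by (auto simp: C_def image_iff intro!: bexI[of _ "h + (a - b)"])
    qed
    assume "\<phi> a = \<phi> b"
    then have "a - b \<in> nonunits V" "b - a \<in> nonunits V" using \<phi>[of a b] \<phi>[of b a] that by auto
    then show "C a = C b" using sub by blast
  qed
  moreover have "card (C ` V) = card (\<phi> ` V)"
  proof -
    have "bij_betw (\<lambda>c. \<phi> (SOME a. a \<in> V \<and> C a = c)) (C ` V) (\<phi> ` V)"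
    proof (rule bij_betwI[of _ _ _ "\<lambda>f. C (SOME a. a \<in> V \<and> \<phi> a = f)"])
      have 1: "(SOME a'. a' \<in> V \<and> C a' = C a) \<in> V \<and> C (SOME a'. a' \<in> V \<and> C a' = C a) = C a" if "a \<in> V" for a
        using someI[of "\<lambda>a'. a' \<in> V \<and> C a' = C a" a] that by blast
      have 2: "(SOME a'. a' \<in> V \<and> \<phi> a' = \<phi> a) \<in> V \<and> \<phi> (SOME a'. a' \<in> V \<and> \<phi> a' = \<phi> a) = \<phi> a" if "a \<in> V" for a
        using someI[of "\<lambda>a'. a' \<in> V \<and> \<phi> a' = \<phi> a" a] that by blast
      show "(\<lambda>c. \<phi> (SOME a. a \<in> V \<and> C a = c)) \<in> C ` V \<rightarrow> \<phi> ` V" using 1 by blast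
      show "(\<lambda>f. C (SOME a. a \<in> V \<and> \<phi> a = f)) \<in> \<phi> ` V \<rightarrow> C ` V" using 2 by blast
      show "C (SOME a. a \<in> V \<and> \<phi> a = \<phi> (SOME a. a \<in> V \<and> C a = c)) = c" if c: "c \<in> C ` V" for c
      proof -
        from c obtain a where a: "a \<in> V" "c = C a" by blast
        define b where "b = (SOME b. b \<in> V \<and> C b = c)"
        have b: "b \<in> V" "C b = c" using 1[OF a(1)] by (simp_all add: b_def a(2))
        show ?thesis using conjunct2[OF 2[OF b(1)]] C[OF conjunct1[OF 2[OF b(1)]] b(1)] b(2) by (simp add: b_def[symmetric])
      qed
      show "\<phi> (SOME a. a \<in> V \<and> C a = C (SOME a. a \<in> V \<and> \<phi> a = f)) = f" if f: "f \<in> \<phi> ` V" for f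
      proof -
        from f obtain a where a: "a \<in> V" "f = \<phi> a" by blast
        define b where "b = (SOME b. b \<in> V \<and> \<phi> b = f)"
        have b: "b \<in> V" "\<phi> b = f" using 2[OF a(1)] by (simp_all add: b_def a(2))
        show ?thesis using conjunct2[OF 1[OF b(1)]] C[OF conjunct1[OF 1[OF b(1)]] b(1)] b(2) by (simp add: b_def[symmetric])
      qed
    qed
    then show ?thesis by (rule bij_betw_same_card)
  qed
  ultimately show ?thesis by (simp add: prime_norm_def)
qed

section \<open>Local rings of an affine coordinate ring at a point\<close>

definition local_ring_at :: "'a::field set \<Rightarrow> ('a \<Rightarrow> 'a) \<Rightarrow> 'a set" where
  "local_ring_at A e = {f / g |f g. f \<in> A \<and> g \<in> A \<and> e g \<noteq> 0}"

definition fractions :: "'a::field set \<Rightarrow> 'a set" where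
  "fractions A = {f / g |f g. f \<in> A \<and> g \<in> A \<and> g \<noteq> 0}"

lemma fractions_subfield:
  assumes A: "subring_set A"
  shows "subfield_set (fractions A)" "A \<subseteq> fractions A"
proof -
  note R = subring_setD[OF A]
  show "A \<subseteq> fractions A"
  proof
    fix f assume "f \<in> A"
    then show "f \<in> fractions A" unfolding fractions_def using R(1) by (intro CollectI exI[of _ f] exI[of _ 1]) auto
  qed
  then have one: "1 \<in> fractions A" using R(1) by blast
  have "u - v \<in> fractions A \<and> u * v \<in> fractions A" if uv: "u \<in> fractions A" "v \<in> fractions A" for u v
  proof -
    obtain f g f' g' where fg: "f \<in> A" "g \<in> A" "g \<noteq> 0" "f' \<in> A" "g' \<in> A" "g' \<noteq> 0" "u = f / g" "v = f' / g'"
      using uv by (auto simp: fractions_def)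
    have "u - v = (f * g' - f' * g) / (g * g')" "u * v = (f * f') / (g * g')" using fg by (auto simp: field_simps)
    moreover have "f * g' - f' * g \<in> A" "f * f' \<in> A" "g * g' \<in> A" "g * g' \<noteq> 0"
      using fg R(4,6) by auto
    ultimately show ?thesis unfolding fractions_def by blast
  qed
  moreover have "inverse u \<in> fractions A" if uA: "u \<in> fractions A" for u
  proof -
    obtain f g where fg: "f \<in> A" "g \<in> A" "g \<noteq> 0" "u = f / g" using uA by (auto simp: fractions_def)
    show ?thesis
    proof (cases "f = 0")
      case True
      then show ?thesis unfolding fractions_def using fg R(2) by (intro CollectI exI[of _ 0] exI[of _ g]) auto
    next
      case False
      then show ?thesis unfolding fractions_def using fg by (intro CollectI exI[of _ g] exI[of _ f]) auto
    qed
  qed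
  ultimately show "subfield_set (fractions A)" using one by (auto simp: subfield_set_def subring_set_def)
qed

text \<open>\<open>A\<close> plays the coordinate ring of an affine curve, \<open>e\<close> the evaluation at a closed point and \<open>t\<close> a local
  parameter there; the assumptions say that the local ring at the point is a discrete valuation ring.\<close>

locale local_ring_data =
  fixes A :: "'a::field set" and e :: "'a \<Rightarrow> 'a" and t :: 'a
  assumes A: "subring_set A"
    and e1: "e 1 = 1" and e_diff: "\<And>f g. f \<in> A \<Longrightarrow> g \<in> A \<Longrightarrow> e (f - g) = e f - e g"
    and e_mult: "\<And>f g. f \<in> A \<Longrightarrow> g \<in> A \<Longrightarrow> e (f * g) = e f * e g"
    and t: "t \<in> A" "t \<noteq> 0" "e t = 0"
    and unif: "\<And>f. f \<in> A \<Longrightarrow> e f = 0 \<Longrightarrow> \<exists>g\<in>A. \<exists>h\<in>A. e g \<noteq> 0 \<and> f * g = t * h"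
    and order: "\<And>f. f \<in> A \<Longrightarrow> f \<noteq> 0 \<Longrightarrow> \<exists>k. \<exists>g\<in>A. \<exists>h\<in>A. e g \<noteq> 0 \<and> f * h = t ^ k * g"
begin

lemmas R = subring_setD[OF A]

lemma e0: "e 0 = 0" using e_diff[OF R(1) R(1)] by simp

lemma e_nz: "e f \<noteq> 0 \<Longrightarrow> f \<noteq> 0" using e0 by auto

definition loc_unit :: "'a \<Rightarrow> bool" where
  "loc_unit w \<longleftrightarrow> (\<exists>a\<in>A. \<exists>b\<in>A. e a \<noteq> 0 \<and> e b \<noteq> 0 \<and> w = a / b)"

lemma loc_unitD:
  assumes "loc_unit w"
  shows "w \<in> local_ring_at A e" "w \<noteq> 0" "inverse w \<in> local_ring_at A e" "loc_unit (inverse w)"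
proof -
  obtain a b where "a \<in> A" "b \<in> A" "e a \<noteq> 0" "e b \<noteq> 0" "w = a / b" using assms by (auto simp: loc_unit_def)
  moreover from this have "inverse w = b / a" by simp
  ultimately show "w \<in> local_ring_at A e" "w \<noteq> 0" "inverse w \<in> local_ring_at A e" "loc_unit (inverse w)"
    unfolding local_ring_at_def loc_unit_def using e_nz by auto
qed

lemma loc_unit_mult: "loc_unit v \<Longrightarrow> loc_unit w \<Longrightarrow> loc_unit (v * w)"
proof -
  assume "loc_unit v" "loc_unit w"
  then obtain a b c d where *: "a \<in> A" "b \<in> A" "e a \<noteq> 0" "e b \<noteq> 0" "v = a / b"
     "c \<in> A" "d \<in> A" "e c \<noteq> 0" "e d \<noteq> 0" "w = c / d" unfolding loc_unit_def by metis
  then have "v * w = (a * c) / (b * d)" "a * c \<in> A" "b * d \<in> A" "e (a * c) \<noteq> 0" "e (b * d) \<noteq> 0"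
    using R(6) e_mult by auto
  then show ?thesis unfolding loc_unit_def by blast
qed

text \<open>Here \<open>e h\<close> may be 0, so \<open>k\<close> only bounds the order of
  \<open>f\<close>. As long as \<open>e f = 0\<close>, \<open>unif\<close> extracts one factor
  \<open>t\<close>, which cancels against \<open>t ^ k\<close>; at \<open>k = 0\<close> the value
  \<open>e f\<close> is forced to be nonzero.\<close>

lemma decomp_aux:
  assumes "f \<in> A" "g \<in> A" "h \<in> A" "e g \<noteq> 0" "f * h = t ^ k * g"
  shows "\<exists>w i. loc_unit w \<and> f = w * t ^ i"
  using assms
proof (induction k arbitrary: f g h)
  case 0
  then have "f * h = g" by simp
  then have "e f * e h = e g" using e_mult[of f h] 0 by simp
  then have "e f \<noteq> 0" using 0 by auto
  then have "loc_unit f" unfolding loc_unit_def using 0 R(1) e1 by (intro bexI[of _ f] bexI[of _ 1]) auto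
  then show ?case by (intro exI[of _ f] exI[of _ 0]) simp
next
  case (Suc k)
  show ?case
  proof (cases "e f = 0")
    case False
    then have "loc_unit f" unfolding loc_unit_def using Suc.prems R(1) e1 by (intro bexI[of _ f] bexI[of _ 1]) auto
    then show ?thesis by (intro exI[of _ f] exI[of _ 0]) simp
  next
    case True
    from unif[OF Suc.prems(1) True] obtain g1 h1 where g1: "g1 \<in> A" "h1 \<in> A" "e g1 \<noteq> 0" "f * g1 = t * h1" by blast
    have "t * (h1 * h) = (f * h) * g1" using g1(4) by (metis mult.assoc mult.commute)
    also have "\<dots> = t * (t ^ k * (g * g1))" using Suc.prems(5) by (simp add: mult_ac)
    finally have "h1 * h = t ^ k * (g * g1)" using t by simp
    from Suc.IH[OF g1(2) _ Suc.prems(3) _ this] obtain w i where w: "loc_unit w" "h1 = w * t ^ i"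
      using R(6) Suc.prems(2,4) g1(1,3) e_mult by auto
    have "loc_unit (1 / g1)" unfolding loc_unit_def using g1 R(1) e1 by (intro bexI[of _ 1] bexI[of _ g1]) auto
    from loc_unit_mult[OF w(1) this] have "loc_unit (w * (1 / g1))" .
    moreover have "f = (w * (1 / g1)) * t ^ Suc i"
      using g1(4) e_nz[OF g1(3)] w(2) by (simp add: field_simps)
    ultimately show ?thesis by blast
  qed
qed

lemma decomp: "f \<in> A \<Longrightarrow> f \<noteq> 0 \<Longrightarrow> \<exists>w i. loc_unit w \<and> f = w * t ^ i"
  using order[of f] decomp_aux by metis

theorem dvr: "dvr_set (fractions A) (local_ring_at A e) t"
  unfolding dvr_set_def
proof (intro conjI ballI)
  have inA: "f \<in> local_ring_at A e" if "f \<in> A" for f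
    unfolding local_ring_at_def using R(1) e1 that by (intro CollectI exI[of _ f] exI[of _ 1]) auto
  show "t \<in> local_ring_at A e" "t \<noteq> 0" using inA t by auto
  show "local_ring_at A e \<subseteq> fractions A" unfolding local_ring_at_def fractions_def using e_nz by blast
  have "u - v \<in> local_ring_at A e \<and> u * v \<in> local_ring_at A e"
    if uv: "u \<in> local_ring_at A e" "v \<in> local_ring_at A e" for u v
  proof -
    obtain f g f' g' where fg: "f \<in> A" "g \<in> A" "e g \<noteq> 0" "f' \<in> A" "g' \<in> A" "e g' \<noteq> 0" "u = f / g" "v = f' / g'"
      using uv by (auto simp: local_ring_at_def)
    have "u - v = (f * g' - f' * g) / (g * g')" "u * v = (f * f') / (g * g')"
      using fg e_nz[OF fg(3)] e_nz[OF fg(6)] by (auto simp: field_simps)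
    moreover have "f * g' - f' * g \<in> A" "f * f' \<in> A" "g * g' \<in> A" "e (g * g') \<noteq> 0"
      using fg R(4,6) e_mult by auto
    ultimately show ?thesis unfolding local_ring_at_def by blast
  qed
  then show "subring_set (local_ring_at A e)" using inA[OF R(1)] by (auto simp: subring_set_def)
  show "inverse t \<notin> local_ring_at A e"
  proof
    assume "inverse t \<in> local_ring_at A e"
    then obtain f g where fg: "f \<in> A" "g \<in> A" "e g \<noteq> 0" "inverse t = f / g" by (auto simp: local_ring_at_def)
    then have "g = f * t" using t e_nz[OF fg(3)] by (simp add: field_simps)
    then show False using fg e_mult[OF fg(1) t(1)] t by simp
  qed
  fix z assume "z \<in> fractions A - {0}"
  then obtain f g where fg: "f \<in> A" "g \<in> A" "g \<noteq> 0" "f \<noteq> 0" "z = f / g" by (auto simp: fractions_def)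
  obtain w i where w: "loc_unit w" "f = w * t ^ i" using decomp fg by blast
  obtain v j where v: "loc_unit v" "g = v * t ^ j" using decomp fg by blast
  define u where "u = w * inverse v"
  have u: "u \<in> local_ring_at A e" "u \<noteq> 0" "inverse u \<in> local_ring_at A e"
    using loc_unitD[OF loc_unit_mult[OF w(1) loc_unitD(4)[OF v(1)]]] by (auto simp: u_def)
  have zu: "z = u * t ^ i / t ^ j" using fg w v by (simp add: u_def divide_inverse)
  show "\<exists>u m. u \<in> local_ring_at A e \<and> u \<noteq> 0 \<and> inverse u \<in> local_ring_at A e \<and> (z = u * t ^ m \<or> z = u / t ^ m)"
  proof (cases "j \<le> i")
    case True
    then have "z = u * t ^ (i - j)" using zu t by (simp add: power_diff)
    with u show ?thesis by blast
  next
    case False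
    then have "t ^ j = t ^ (j - i) * t ^ i" by (simp add: power_add[symmetric])
    then have "z = u / t ^ (j - i)" using zu t by simp
    with u show ?thesis by blast
  qed
qed

lemma nonunits_local_ring: "f \<in> A \<Longrightarrow> g \<in> A \<Longrightarrow> e g \<noteq> 0 \<Longrightarrow> f / g \<in> nonunits (local_ring_at A e) \<longleftrightarrow> e f = 0"
proof
  assume fg: "f \<in> A" "g \<in> A" "e g \<noteq> 0"
  {
    assume "f / g \<in> nonunits (local_ring_at A e)"
    then have nu: "f / g = 0 \<or> inverse (f / g) \<notin> local_ring_at A e" by (simp add: nonunits_def)
    show "e f = 0"
    proof (rule ccontr)
      assume "e f \<noteq> 0"
      then have "inverse (f / g) \<in> local_ring_at A e" using fg by (auto simp: local_ring_at_def)
      with nu e_nz[OF \<open>e f \<noteq> 0\<close>] e_nz[OF fg(3)] show False by simp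
    qed
  }
  assume ef: "e f = 0"
  have "inverse (f / g) \<notin> local_ring_at A e" if "f \<noteq> 0"
  proof
    assume "inverse (f / g) \<in> local_ring_at A e"
    then obtain f' g' where fg': "f' \<in> A" "g' \<in> A" "e g' \<noteq> 0" "g / f = f' / g'" by (auto simp: local_ring_at_def)
    then have "g * g' = f' * f" using that e_nz[OF fg'(3)] by (simp add: frac_eq_eq)
    then have "e g * e g' = e f' * e f" using e_mult fg fg' by metis
    with ef fg fg' show False by simp
  qed
  then show "f / g \<in> nonunits (local_ring_at A e)" using fg by (auto simp: nonunits_def local_ring_at_def)
qed

text \<open>The evaluation extends to quotients by \<open>\<phi>\<close>. The assumption makes the
  values of \<open>e\<close> on \<open>A\<close> closed under inverses, so quotients take no new
  values.\<close>

theorem residue_card: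
  assumes inv: "\<And>f. f \<in> A \<Longrightarrow> inverse (e f) \<in> e ` A"
  shows "prime_norm (ring_on (fractions A)) (local_ring_at A e) = card (e ` A)"
proof -
  define V where "V = local_ring_at A e"
  define \<phi> where "\<phi> z = (THE w. \<exists>f\<in>A. \<exists>g\<in>A. e g \<noteq> 0 \<and> z = f / g \<and> w = e f / e g)" for z
  have \<phi>: "\<phi> (f / g) = e f / e g" if "f \<in> A" "g \<in> A" "e g \<noteq> 0" for f g
    unfolding \<phi>_def
  proof (rule the_equality)
    show "\<exists>f'\<in>A. \<exists>g'\<in>A. e g' \<noteq> 0 \<and> f / g = f' / g' \<and> e f / e g = e f' / e g'" using that by blast
    fix w assume "\<exists>f'\<in>A. \<exists>g'\<in>A. e g' \<noteq> 0 \<and> f / g = f' / g' \<and> w = e f' / e g'"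
    then obtain f' g' where *: "f' \<in> A" "g' \<in> A" "e g' \<noteq> 0" "f / g = f' / g'" "w = e f' / e g'" by blast
    then have "f * g' = f' * g" using that e_nz by (simp add: frac_eq_eq)
    then have "e f * e g' = e f' * e g" using that * e_mult by metis
    then show "w = e f / e g" using * that by (simp add: frac_eq_eq)
  qed
  have "prime_norm (ring_on (fractions A)) V = card (\<phi> ` V)"
    unfolding V_def
  proof (rule prime_norm_ring_on[OF dvr])
    fix a b assume "a \<in> local_ring_at A e" "b \<in> local_ring_at A e"
    then obtain f g f' g' where fg: "f \<in> A" "g \<in> A" "e g \<noteq> 0" "f' \<in> A" "g' \<in> A" "e g' \<noteq> 0" "a = f / g" "b = f' / g'"
      by (auto simp: local_ring_at_def)
    have ab: "a - b = (f * g' - f' * g) / (g * g')" using fg e_nz[OF fg(3)] e_nz[OF fg(6)] by (auto simp: field_simps)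
    have "a - b \<in> nonunits (local_ring_at A e) \<longleftrightarrow> e (f * g' - f' * g) = 0"
      unfolding ab using fg R(4,6) e_mult by (intro nonunits_local_ring) auto
    also have "\<dots> \<longleftrightarrow> e f * e g' = e f' * e g" using fg R(6) e_mult e_diff by simp
    also have "\<dots> \<longleftrightarrow> \<phi> a = \<phi> b" using fg \<phi> by (simp add: frac_eq_eq)
    finally show "\<phi> a = \<phi> b \<longleftrightarrow> a - b \<in> nonunits (local_ring_at A e)" by simp
  qed
  also have "\<phi> ` V = e ` A"
  proof (intro equalityI subsetI)
    fix w assume "w \<in> \<phi> ` V"
    then obtain f g where fg: "f \<in> A" "g \<in> A" "e g \<noteq> 0" "w = e f / e g" using \<phi> by (auto simp: V_def local_ring_at_def)
    obtain h where h: "h \<in> A" "inverse (e g) = e h" using inv[OF fg(2)] by auto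
    then have "w = e (f * h)" using fg e_mult by (simp add: divide_inverse)
    then show "w \<in> e ` A" using R(6) fg h by blast
  next
    fix w assume "w \<in> e ` A"
    then obtain f where "f \<in> A" "w = e f" by blast
    then have "w = \<phi> (f / 1)" using \<phi>[of f 1] R(1) e1 by auto
    moreover have "f / 1 \<in> V" unfolding V_def local_ring_at_def using \<open>f \<in> A\<close> R(1) e1 by (intro CollectI exI[of _ f] exI[of _ 1]) auto
    ultimately show "w \<in> \<phi> ` V" by blast
  qed
  finally show ?thesis by (simp add: V_def)
qed

end

section \<open>Places of the curve\<close>

lemma finite_field_generator:
  fixes E :: "'a::field set"
  assumes E: "subfield_set E" "finite E"
  obtains \<gamma> where "\<gamma> \<in> E" "\<gamma> \<noteq> 0" "\<And>z. z \<in> E \<Longrightarrow> z \<noteq> 0 \<Longrightarrow> \<exists>m. z = \<gamma> ^ m"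
proof -
  interpret field "ring_on E" by (rule field_ring_on[OF E(1)])
  obtain \<gamma> where g: "\<gamma> \<in> carrier (mult_of (ring_on E))"
    "carrier (mult_of (ring_on E)) = {\<gamma> [^]\<^bsub>ring_on E\<^esub> i | i::nat . i \<in> UNIV}"
    using finite_field_mult_group_has_gen E(2) by auto
  have pw: "\<gamma> [^]\<^bsub>ring_on E\<^esub> i = \<gamma> ^ i" for i :: nat
    by (induction i) (auto simp: mult.commute)
  show ?thesis
    by (rule that[of \<gamma>]) (use g in \<open>auto simp: pw\<close>)
qed

locale curve = artin_schreier_base q k T n s
  for q k :: nat and T :: "'a::alg_closed_field itself" and n s :: nat +
  fixes x y :: 'a
  assumes transc: "\<And>f. f \<in> FP \<Longrightarrow> poly f x = 0 \<Longrightarrow> f = 0"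
    and curve_eq: "y ^ 2 = x ^ (q ^ n) - x"
begin

definition D :: "'a poly" where
  "D = Polynomial.monom 1 (q ^ n) + Polynomial.monom (-1) 1"

lemma Q_gt_1: "q ^ n > 1"
  using q_gt_1 n_pos by (rule one_less_power)

lemma D_FP: "D \<in> FP"
  unfolding D_def by (intro FP_add FP_monom Fix_uminus Fix_1)

lemma poly_D: "poly D z = z ^ (q ^ n) - z"
  by (simp add: D_def poly_monom)

lemma degree_D: "Polynomial.degree D = q ^ n"
  unfolding D_def using Q_gt_1 by (subst degree_add_eq_left) (auto simp: Polynomial.degree_monom_eq)

lemma pderiv_D: "pderiv D = - 1"
proof -
  have "of_nat (q ^ n) = (0::'a)"
    using k_pos by (simp add: q_power of_nat_eq_0_iff_char_dvd)
  then show ?thesis by (simp add: D_def pderiv_add pderiv_monom one_pCons monom_0)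
qed

definition cv :: "'a poly \<Rightarrow> 'a poly \<Rightarrow> 'a \<Rightarrow> 'a \<Rightarrow> 'a" where
  "cv u v a b = poly u a + poly v a * b"

definition coord_ring :: "'a set" where
  "coord_ring = {cv u v x y |u v. u \<in> FP \<and> v \<in> FP}"

text \<open>Coordinate functions are elements of the field rather than formal expressions, so
  evaluation has to recover \<open>u\<close> and \<open>v\<close>; \<open>cv_eq_0\<close> shows that
  they are unique.\<close>

definition ev :: "'a \<Rightarrow> 'a \<Rightarrow> 'a \<Rightarrow> 'a" where
  "ev a b z = (THE w. \<exists>u\<in>FP. \<exists>v\<in>FP. z = cv u v x y \<and> w = cv u v a b)"

lemma curve_eq': "y ^ 2 = poly D x" by (simp add: curve_eq poly_D)

lemma cv_mult: "b ^ 2 = poly D a \<Longrightarrow>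
    cv u v a b * cv u' v' a b = cv (u * u' + v * v' * D) (u * v' + v * u') a b"
proof -
  assume b: "b ^ 2 = poly D a"
  have "cv u v a b * cv u' v' a b = poly u a * poly u' a + poly v a * poly v' a * b ^ 2
      + (poly u a * poly v' a + poly v a * poly u' a) * b"
    by (simp add: cv_def algebra_simps power2_eq_square)
  then show ?thesis by (simp add: b cv_def)
qed

lemma cv_diff: "cv u v a b - cv u' v' a b = cv (u - u') (v - v') a b"
  by (simp add: cv_def algebra_simps)

lemma cv_conj: "b ^ 2 = poly D a \<Longrightarrow> cv u v a b * cv u (- v) a b = poly (u ^ 2 - v ^ 2 * D) a"
  by (subst cv_mult) (auto simp: cv_def power2_eq_square)

text \<open>Parity of degrees: \<open>D\<close> has odd degree \<open>q ^ n\<close>, so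
  \<open>u ^ 2\<close> and \<open>v ^ 2 * D\<close> cannot have the same degree.\<close>

lemma norm_eq_0:
  assumes "u \<in> FP" "v \<in> FP" "u ^ 2 - v ^ 2 * D = 0"
  shows "u = 0 \<and> v = 0"
proof (cases "v = 0")
  case True with assms show ?thesis by simp
next
  case False
  have eq: "u ^ 2 = v ^ 2 * D" using assms by simp
  have "D \<noteq> 0" using degree_D by (metis Polynomial.degree_0 q_power_pos less_irrefl)
  have "u \<noteq> 0" using eq False \<open>D \<noteq> 0\<close> by auto
  then have "2 * Polynomial.degree u = 2 * Polynomial.degree v + q ^ n"
    using arg_cong[OF eq, of Polynomial.degree] False \<open>D \<noteq> 0\<close>
    by (simp add: degree_mult_eq power2_eq_square degree_D)
  moreover have "odd (q ^ n)" using odd_q by simp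
  ultimately show ?thesis by presburger
qed

lemma cv_eq_0:
  assumes "u \<in> FP" "v \<in> FP" "cv u v x y = 0"
  shows "u = 0 \<and> v = 0"
proof -
  have "poly (u ^ 2 - v ^ 2 * D) x = 0" using cv_conj[OF curve_eq', of u v] assms by simp
  then have "u ^ 2 - v ^ 2 * D = 0" using assms D_FP by (intro transc FP_diff FP_mult FP_power)
  then show ?thesis using norm_eq_0 assms by blast
qed

lemma ev_cv: "u \<in> FP \<Longrightarrow> v \<in> FP \<Longrightarrow> ev a b (cv u v x y) = cv u v a b"
  unfolding ev_def
proof (rule the_equality)
  assume uv: "u \<in> FP" "v \<in> FP"
  then show "\<exists>u'\<in>FP. \<exists>v'\<in>FP. cv u v x y = cv u' v' x y \<and> cv u v a b = cv u' v' a b" by blast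
  fix w assume "\<exists>u'\<in>FP. \<exists>v'\<in>FP. cv u v x y = cv u' v' x y \<and> w = cv u' v' a b"
  then obtain u' v' where u': "u' \<in> FP" "v' \<in> FP" "cv u v x y = cv u' v' x y" "w = cv u' v' a b" by blast
  have "cv (u - u') (v - v') x y = 0" using u'(3) by (simp add: cv_diff[symmetric])
  then have "u - u' = 0 \<and> v - v' = 0" using uv u' by (intro cv_eq_0 FP_diff)
  with u' show "w = cv u v a b" by simp
qed

lemma coord_ringE:
  assumes "f \<in> coord_ring"
  obtains u v where "u \<in> FP" "v \<in> FP" "f = cv u v x y"
  using assms by (auto simp: coord_ring_def)

lemma coord_ringI: "u \<in> FP \<Longrightarrow> v \<in> FP \<Longrightarrow> cv u v x y \<in> coord_ring"
  by (auto simp: coord_ring_def)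

lemma coord_ring_poly: "u \<in> FP \<Longrightarrow> poly u x \<in> coord_ring" and ev_poly: "u \<in> FP \<Longrightarrow> ev a b (poly u x) = poly u a"
  using coord_ringI[of u 0] ev_cv[of u 0] by (auto simp: cv_def)

lemma coord_ring_y: "y \<in> coord_ring" and ev_y: "ev a b y = b"
  using coord_ringI[of 0 1] ev_cv[of 0 1 a b] by (auto simp: cv_def)

lemma coord_ring_x: "x \<in> coord_ring" and ev_x: "ev a b x = a"
  using coord_ring_poly[OF FP_X] ev_poly[OF FP_X, of a b] by auto

lemma ev_1: "ev a b 1 = 1"
  using ev_poly[OF FP_1, of a b] by simp

lemma ev_const: "c \<in> Fix 1 \<Longrightarrow> ev a b c = c" and coord_ring_const: "c \<in> Fix 1 \<Longrightarrow> c \<in> coord_ring"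
  using ev_poly[OF FP_const, of c a b] coord_ring_poly[OF FP_const, of c] by auto

lemma coord_ring_subring: "subring_set coord_ring"
  unfolding subring_set_def
proof (intro conjI ballI)
  show "1 \<in> coord_ring" using coord_ring_poly[OF FP_1] by simp
  fix f g assume "f \<in> coord_ring" "g \<in> coord_ring"
  then obtain u v u' v' where *: "u \<in> FP" "v \<in> FP" "f = cv u v x y" "u' \<in> FP" "v' \<in> FP" "g = cv u' v' x y"
    by (metis coord_ringE)
  show "f - g \<in> coord_ring" unfolding * cv_diff using * by (intro coord_ringI FP_diff)
  show "f * g \<in> coord_ring" unfolding * cv_mult[OF curve_eq'] using * D_FP by (intro coord_ringI FP_add FP_mult)
qed

lemma ev_diff: "f \<in> coord_ring \<Longrightarrow> g \<in> coord_ring \<Longrightarrow> ev a b (f - g) = ev a b f - ev a b g"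
proof -
  assume "f \<in> coord_ring" "g \<in> coord_ring"
  then obtain u v u' v' where *: "u \<in> FP" "v \<in> FP" "f = cv u v x y" "u' \<in> FP" "v' \<in> FP" "g = cv u' v' x y"
    by (metis coord_ringE)
  then show ?thesis by (simp add: cv_diff ev_cv FP_diff)
qed

lemma ev_mult: "b ^ 2 = poly D a \<Longrightarrow> f \<in> coord_ring \<Longrightarrow> g \<in> coord_ring \<Longrightarrow> ev a b (f * g) = ev a b f * ev a b g"
proof -
  assume b: "b ^ 2 = poly D a" and "f \<in> coord_ring" "g \<in> coord_ring"
  then obtain u v u' v' where *: "u \<in> FP" "v \<in> FP" "f = cv u v x y" "u' \<in> FP" "v' \<in> FP" "g = cv u' v' x y"
    by (metis coord_ringE)
  then show ?thesis
    by (simp add: cv_mult[OF b] cv_mult[OF curve_eq'] ev_cv FP_add FP_mult D_FP)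
qed

lemma ev_power: "b ^ 2 = poly D a \<Longrightarrow> f \<in> coord_ring \<Longrightarrow> ev a b (f ^ m) = ev a b f ^ m"
  by (induction m) (auto simp: ev_1 ev_mult subring_setD(7)[OF coord_ring_subring])

lemma ptsD: "(a, b) \<in> pts j \<Longrightarrow> b ^ 2 = poly D a" "(a, b) \<in> pts j \<Longrightarrow> a \<in> Fix j" "(a, b) \<in> pts j \<Longrightarrow> b \<in> Fix j"
  by (auto simp: pts_def poly_D)

definition place :: "'a \<Rightarrow> 'a \<Rightarrow> 'a set" where
  "place a b = local_ring_at coord_ring (ev a b)"

text \<open>The local parameter depends on ramification over the x-line: where
  \<open>b \<noteq> 0\<close> it is the minimal polynomial of \<open>a\<close> evaluated at
  \<open>x\<close>; where \<open>b = 0\<close> it is \<open>y\<close>.\<close>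

lemma local_ring_data_place:
  assumes j: "j > 0" and ab: "(a, b) \<in> pts j"
  shows "\<exists>t. local_ring_data coord_ring (ev a b) t"
proof -
  note b = ptsD(1)[OF ab] and R = subring_setD[OF coord_ring_subring]
  obtain P where P: "P \<in> FP" "P \<noteq> 0" "Polynomial.degree P > 0" "poly P a = 0"
    "\<And>f. f \<in> FP \<Longrightarrow> poly f a = 0 \<Longrightarrow> \<exists>g\<in>FP. f = P * g"
    using minimal_polynomial[OF j ptsD(2)[OF ab]] by metis
  note ord = FP_order[OF P(1,3,5)]
  have Px: "poly P x \<noteq> 0" using transc[OF P(1)] P(2) by blast
  \<comment> \<open>Multiplication by the conjugate replaces \<open>f\<close> by its norm, a
    polynomial in \<open>x\<close>, for which \<open>FP_order\<close> applies.\<close>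
  have norm_order: "\<exists>m. \<exists>g\<in>FP. \<exists>h\<in>coord_ring. poly g a \<noteq> 0 \<and> f * h = poly P x ^ m * poly g x"
    if f: "f \<in> coord_ring" "f \<noteq> 0" for f
  proof -
    obtain u v where uv: "u \<in> FP" "v \<in> FP" "f = cv u v x y" using f(1) by (rule coord_ringE)
    define N where "N = u ^ 2 - v ^ 2 * D"
    have "N \<noteq> 0" using norm_eq_0[OF uv(1,2)] f(2) uv(3) by (auto simp: N_def cv_def)
    moreover have "N \<in> FP" unfolding N_def using uv D_FP by (intro FP_diff FP_mult FP_power)
    ultimately obtain m g where g: "g \<in> FP" "N = P ^ m * g" "poly g a \<noteq> 0" using ord by blast
    have "f * cv u (- v) x y = poly P x ^ m * poly g x"
      unfolding uv(3) cv_conj[OF curve_eq'] N_def[symmetric] g(2) by simp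
    then show ?thesis using g uv coord_ringI[OF uv(1) FP_uminus[OF uv(2)]] by blast
  qed
  show ?thesis
  proof (cases "b = 0")
    case False
    have "local_ring_data coord_ring (ev a b) (poly P x)"
    proof
      fix f assume f: "f \<in> coord_ring" "ev a b f = 0"
      then obtain u v where uv: "u \<in> FP" "v \<in> FP" "f = cv u v x y" by (metis coord_ringE)
      have z: "poly u a + poly v a * b = 0" using f(2) ev_cv[OF uv(1,2), of a b] unfolding uv(3) by (simp add: cv_def)
      show "\<exists>g\<in>coord_ring. \<exists>h\<in>coord_ring. ev a b g \<noteq> 0 \<and> f * g = poly P x * h"
      proof (cases "poly v a = 0")
        case True
        with z have "poly u a = 0" by simp
        with True uv P(5) obtain u' v' where u': "u' \<in> FP" "v' \<in> FP" "u = P * u'" "v = P * v'" by metis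
        then have "f * 1 = poly P x * cv u' v' x y" by (simp add: uv cv_def algebra_simps)
        moreover have "cv u' v' x y \<in> coord_ring" using u' by (intro coord_ringI)
        ultimately show ?thesis using R(1) ev_1 by (metis one_neq_zero)
      next
        case nz: False
        \<comment> \<open>The norm vanishes at \<open>a\<close>, and the conjugate of
          \<open>f\<close> does not vanish at the point, since its sum and difference with
          \<open>f\<close> would give \<open>2 * (poly v a * b) = 0\<close>.\<close>
        define N where "N = u ^ 2 - v ^ 2 * D"
        have "poly N a = (poly u a) ^ 2 - (poly v a * b) ^ 2" by (simp add: N_def power_mult_distrib b)
        also have "\<dots> = (poly u a + poly v a * b) * (poly u a - poly v a * b)" by (simp add: power2_eq_square algebra_simps)
        finally have "poly N a = 0" using z by simp
        moreover have "N \<in> FP" unfolding N_def using uv D_FP by (intro FP_diff FP_mult FP_power)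
        ultimately obtain N' where N': "N' \<in> FP" "N = P * N'" using P(5) by blast
        have "f * cv u (- v) x y = poly P x * poly N' x"
          unfolding uv(3) cv_conj[OF curve_eq'] N_def[symmetric] N'(2) by simp
        moreover have "ev a b (cv u (- v) x y) \<noteq> 0"
        proof
          assume "ev a b (cv u (- v) x y) = 0"
          then have "poly u a - poly v a * b = 0" using ev_cv[OF uv(1) FP_uminus[OF uv(2)], of a b] by (simp add: cv_def)
          with z have "2 * (poly v a * b) = 0" by (simp add: algebra_simps)
          with two_nonzero nz False show False by simp
        qed
        ultimately show ?thesis using coord_ringI[OF uv(1) FP_uminus[OF uv(2)]] coord_ring_poly[OF N'(1)] by blast
      qed
    next
      fix f assume f: "f \<in> coord_ring" "f \<noteq> 0"
      from norm_order[OF this] obtain m g h where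
        "g \<in> FP" "h \<in> coord_ring" "poly g a \<noteq> 0" "f * h = poly P x ^ m * poly g x" by blast
      then show "\<exists>k. \<exists>g\<in>coord_ring. \<exists>h\<in>coord_ring. ev a b g \<noteq> 0 \<and> f * h = poly P x ^ k * g"
        using coord_ring_poly ev_poly by metis
    qed (use P Px ev_poly coord_ring_poly in \<open>auto intro: coord_ring_subring ev_1 ev_diff ev_mult[OF b]\<close>)
    then show ?thesis ..
  next
    case True
    then have "poly D a = 0" using b by simp
    then obtain E where E: "E \<in> FP" "D = P * E" using P(5) D_FP by blast
    \<comment> \<open>\<open>D\<close> has no double root because its derivative is -1, so
      \<open>P\<close> divides it only once and \<open>y * y\<close> is \<open>P\<close> times a
      unit at the point.\<close>
    have Ea: "poly E a \<noteq> 0"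
    proof
      assume "poly E a = 0"
      then have "poly (pderiv D) a = 0" by (simp add: E(2) pderiv_mult P(4))
      then show False by (simp add: pderiv_D)
    qed
    have y2: "y * y = poly P x * poly E x" using curve_eq' by (simp add: E(2) power2_eq_square)
    have "local_ring_data coord_ring (ev a b) y"
    proof
      show "y \<noteq> 0" using cv_eq_0[of 0 1] by (auto simp: cv_def)
      fix f assume f: "f \<in> coord_ring" "ev a b f = 0"
      then obtain u v where uv: "u \<in> FP" "v \<in> FP" "f = cv u v x y" by (metis coord_ringE)
      have "poly u a = 0" using f(2) ev_cv[OF uv(1,2), of a b] True unfolding uv(3) by (simp add: cv_def)
      then obtain u' where u': "u' \<in> FP" "u = P * u'" using P(5) uv by blast
      \<comment> \<open>Since u = P u', the term u E is u' y^2, and a factor \<open>y\<close> comes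
        out of both terms.\<close>
      have "f * poly E x = y * cv (v * E) u' x y"
        by (simp add: uv cv_def u' algebra_simps) (simp add: y2 mult_ac)
      moreover have "cv (v * E) u' x y \<in> coord_ring" using uv E u' by (intro coord_ringI FP_mult)
      ultimately show "\<exists>g\<in>coord_ring. \<exists>h\<in>coord_ring. ev a b g \<noteq> 0 \<and> f * g = y * h"
        using coord_ring_poly[OF E(1)] ev_poly[OF E(1)] Ea by metis
    next
      fix f assume f: "f \<in> coord_ring" "f \<noteq> 0"
      from norm_order[OF this] obtain m g h where
        g: "g \<in> FP" "h \<in> coord_ring" "poly g a \<noteq> 0" "f * h = poly P x ^ m * poly g x" by blast
      have "f * (h * poly E x ^ m) = (poly P x * poly E x) ^ m * poly g x"
        using g(4) by (simp add: power_mult_distrib mult_ac)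
      also have "\<dots> = y ^ (2 * m) * poly g x" by (simp add: y2[symmetric] power_mult power2_eq_square)
      finally have "f * (h * poly E x ^ m) = y ^ (2 * m) * poly g x" .
      moreover have "h * poly E x ^ m \<in> coord_ring" using R(6)[OF g(2) R(7)[OF coord_ring_poly[OF E(1)]]] .
      ultimately show "\<exists>k. \<exists>g\<in>coord_ring. \<exists>h\<in>coord_ring. ev a b g \<noteq> 0 \<and> f * h = y ^ k * g"
        using coord_ring_poly[OF g(1)] ev_poly[OF g(1)] g(3) by metis
    qed (use True coord_ring_subring ev_1 ev_diff ev_mult[OF b] coord_ring_y ev_y in auto)
    then show ?thesis ..
  qed
qed

definition function_field_set :: "'a set" where
  "function_field_set = fractions coord_ring"

lemma function_field_set_subfield: "subfield_set function_field_set"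
  unfolding function_field_set_def by (rule fractions_subfield[OF coord_ring_subring])

lemma coord_ring_subset: "coord_ring \<subseteq> function_field_set"
  unfolding function_field_set_def by (rule fractions_subfield[OF coord_ring_subring])

lemma dvr_place:
  assumes "j > 0" "(a, b) \<in> pts j"
  shows "\<exists>t. dvr_set function_field_set (place a b) t"
proof -
  obtain t where "local_ring_data coord_ring (ev a b) t" using local_ring_data_place[OF assms] ..
  then interpret local_ring_data coord_ring "ev a b" t .
  show ?thesis using dvr by (auto simp: function_field_set_def place_def)
qed

lemma nonunits_place:
  assumes "j > 0" "(a, b) \<in> pts j" "f \<in> coord_ring"
  shows "f \<in> nonunits (place a b) \<longleftrightarrow> ev a b f = 0"
proof -
  obtain t where "local_ring_data coord_ring (ev a b) t" using local_ring_data_place[OF assms(1,2)] ..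
  then interpret local_ring_data coord_ring "ev a b" t .
  show ?thesis using nonunits_local_ring[of f 1] assms(3) R(1) e1 by (simp add: place_def)
qed

lemma coord_ring_place: "coord_ring \<subseteq> place a b"
proof
  fix f assume "f \<in> coord_ring"
  then show "f \<in> place a b" unfolding place_def local_ring_at_def using ev_1 subring_setD(1)[OF coord_ring_subring]
    by (intro CollectI exI[of _ f] exI[of _ 1]) auto
qed

section \<open>Degrees and residue fields of closed points\<close>

definition pt_period :: "'a \<Rightarrow> 'a \<Rightarrow> nat" where
  "pt_period a b = (THE e. e > 0 \<and> (\<forall>i. (a, b) \<in> pts i \<longleftrightarrow> e dvd i))"

lemma Fix_shift: "z \<in> Fix i \<Longrightarrow> z \<in> Fix (i + j) \<longleftrightarrow> z \<in> Fix j"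
  by (simp add: Fix_def frob_frob[symmetric])

lemma pt_period:
  assumes "j > 0" "(a, b) \<in> pts j"
  shows "pt_period a b > 0" "(a, b) \<in> pts i \<longleftrightarrow> pt_period a b dvd i"
proof -
  have "\<exists>e>0. (a, b) \<in> pts e \<and> (\<forall>i. (a, b) \<in> pts i \<longleftrightarrow> e dvd i)"
    by (rule minimal_period[where P = "\<lambda>i. (a, b) \<in> pts i" and j = j]) (use assms in \<open>auto simp: pts_def Fix_shift\<close>)
  then obtain e where e: "e > 0 \<and> (\<forall>i. (a, b) \<in> pts i \<longleftrightarrow> e dvd i)" by blast
  have "pt_period a b = e"
    unfolding pt_period_def
    by (rule the_equality[where P = "\<lambda>e. e > 0 \<and> (\<forall>i. (a, b) \<in> pts i \<longleftrightarrow> e dvd i)", OF e]) (use e in \<open>metis dvd_antisym dvd_refl\<close>)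
  then show "pt_period a b > 0" "(a, b) \<in> pts i \<longleftrightarrow> pt_period a b dvd i" using e by auto
qed

text \<open>The q^m polynomials of degree below \<open>m\<close> take distinct values at
  \<open>\<gamma>\<close>: a difference vanishing there would be a multiple of \<open>P\<close> of
  too small a degree.\<close>

lemma card_le_of_degree:
  assumes E: "subring_set E" "finite E" "Fix 1 \<subseteq> E" "\<gamma> \<in> E"
    and P: "\<And>f. f \<in> FP \<Longrightarrow> poly f \<gamma> = 0 \<Longrightarrow> \<exists>g\<in>FP. f = P * g" and m: "m \<le> Polynomial.degree P"
  shows "q ^ m \<le> card E"
proof -
  define S where "S = {xs. set xs \<subseteq> Fix 1 \<and> length xs = m}"
  have cS: "card S = q ^ m" unfolding S_def using card_Fix[of 1] by (simp add: card_lists_length_eq)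
  have FPS: "Poly xs \<in> FP" if "xs \<in> S" for xs
    using that by (auto simp: S_def FP_def coeff_Poly_eq nth_default_def subset_iff)
  have inj: "inj_on (\<lambda>xs. poly (Poly xs) \<gamma>) S"
  proof (rule inj_onI)
    fix xs ys assume *: "xs \<in> S" "ys \<in> S" "poly (Poly xs) \<gamma> = poly (Poly ys) \<gamma>"
    have "Poly xs - Poly ys \<in> FP" using * FPS by (intro FP_diff)
    moreover have "poly (Poly xs - Poly ys) \<gamma> = 0" using * by simp
    ultimately obtain g where g: "g \<in> FP" "Poly xs - Poly ys = P * g" using P by blast
    have small: "poly.coeff (Poly xs - Poly ys) i = 0" if "i \<ge> m" for i
      using that * by (simp add: S_def coeff_Poly_eq nth_default_def)
    have "Poly xs - Poly ys = 0"
    proof (rule ccontr)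
      assume nz: "Poly xs - Poly ys \<noteq> 0"
      then have "Polynomial.degree P \<le> Polynomial.degree (Poly xs - Poly ys)"
        unfolding g(2) by (intro degree_mult_right_le) auto
      with m have "m \<le> Polynomial.degree (Poly xs - Poly ys)" by simp
      from small[OF this] nz show False by (simp only: leading_coeff_0_iff)
    qed
    then have "Poly xs = Poly ys" by simp
    then have "nth_default 0 xs i = nth_default 0 ys i" for i
      by (metis coeff_Poly_eq)
    then show "xs = ys" using * by (intro nth_equalityI) (auto simp: S_def nth_default_def split: if_splits, metis)
  qed
  have E_sum: "(\<Sum>i\<in>I. h i) \<in> E" if "\<And>i. i \<in> I \<Longrightarrow> h i \<in> E" for I :: "nat set" and h
    using that by (induction I rule: infinite_finite_induct) (auto intro: subring_setD[OF E(1)])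
  have "poly f \<gamma> \<in> E" if "f \<in> FP" for f
    unfolding poly_altdef using FP_coeff[OF that] E(3,4) by (intro E_sum subring_setD(6,7)[OF E(1)]) auto
  then have "card S \<le> card E"
    using FPS by (intro card_inj_on_le[OF inj _ E(2)]) auto
  then show ?thesis by (simp add: cS)
qed

lemma ev_FP: "u \<in> FP \<Longrightarrow> f \<in> coord_ring \<Longrightarrow> poly u f \<in> coord_ring"
  and ev_poly_FP: "b ^ 2 = poly D a \<Longrightarrow> u \<in> FP \<Longrightarrow> f \<in> coord_ring \<Longrightarrow> ev a b (poly u f) = poly u (ev a b f)"
proof -
  note R = subring_setD[OF coord_ring_subring]
  have aux: "poly u f \<in> coord_ring \<and> (b ^ 2 = poly D a \<longrightarrow> ev a b (poly u f) = poly u (ev a b f))"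
    if "u \<in> FP" "f \<in> coord_ring" for u
    using that(1)
  proof (induction u)
    case 0 then show ?case using R(2) ev_const[OF Fix_0] by simp
  next
    case (pCons c u)
    have c: "c \<in> Fix 1" "u \<in> FP"
    proof -
      show "c \<in> Fix 1" using FP_coeff[OF pCons.prems, of 0] by simp
      show "u \<in> FP" unfolding FP_def using FP_coeff[OF pCons.prems, of "Suc i" for i] by simp
    qed
    have m: "- (f * poly u f) \<in> coord_ring" "f * poly u f \<in> coord_ring" using pCons.IH[OF c(2)] that(2) R(3,6) by auto
    have "ev a b (c - (- (f * poly u f))) = ev a b c - ev a b (0 - f * poly u f)"
      using ev_diff[OF coord_ring_const[OF c(1)] m(1)] by simp
    also have "\<dots> = c + ev a b (f * poly u f)"
      using ev_diff[OF R(2) m(2)] ev_const[OF c(1)] ev_const[OF Fix_0] by simp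
    finally show ?case
      using R(5)[OF coord_ring_const[OF c(1)] m(2)] pCons.IH[OF c(2)] that(2) ev_mult[of b a f "poly u f"] by simp
  qed
  show "u \<in> FP \<Longrightarrow> f \<in> coord_ring \<Longrightarrow> poly u f \<in> coord_ring"
   "b ^ 2 = poly D a \<Longrightarrow> u \<in> FP \<Longrightarrow> f \<in> coord_ring \<Longrightarrow> ev a b (poly u f) = poly u (ev a b f)"
    using aux by auto
qed

definition residues :: "'a \<Rightarrow> 'a \<Rightarrow> 'a set" where
  "residues a b = ev a b ` coord_ring"

lemma residues_subset:
  assumes "(a, b) \<in> pts j"
  shows "residues a b \<subseteq> Fix j"
  unfolding residues_def using ptsD(2,3)[OF assms]
  by (auto elim!: coord_ringE simp: ev_cv) (auto simp: cv_def intro!: Fix_add Fix_mult FP_Fix)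

lemma residues_subfield:
  assumes j: "j > 0" and ab: "(a, b) \<in> pts j"
  shows "subfield_set (residues a b)" "finite (residues a b)" "Fix 1 \<subseteq> residues a b"
    "a \<in> residues a b" "b \<in> residues a b"
proof -
  note R = subring_setD[OF coord_ring_subring] and b = ptsD(1)[OF ab]
  show "finite (residues a b)" using residues_subset[OF ab] card_Fix[OF j] finite_subset by blast
  show "Fix 1 \<subseteq> residues a b" unfolding residues_def
    using ev_const[of _ a b] coord_ring_const by (metis imageI subsetI)
  show "a \<in> residues a b" "b \<in> residues a b" unfolding residues_def
    using ev_x[of a b] ev_y[of a b] coord_ring_x coord_ring_y by (metis imageI)+
  have sub: "subring_set (residues a b)"
    unfolding subring_set_def residues_def
    using R(1,4,6) ev_1 ev_diff ev_mult[OF b] by (auto simp: image_iff) metis+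
  moreover have "inverse z \<in> residues a b" if z: "z \<in> residues a b" for z
  proof (cases "z = 0")
    case True then show ?thesis using subring_setD(2)[OF sub] by simp
  next
    case False
    have "q ^ j > 1" using q_gt_1 j by (rule one_less_power)
    then have "q ^ j - 1 = Suc (q ^ j - 2)" by simp
    then have "z * z ^ (q ^ j - 2) = 1"
      using Fix_nonzero_power[OF _ False, of j] residues_subset[OF ab] z by (metis power_Suc subsetD)
    then have "inverse z = z ^ (q ^ j - 2)" by (rule inverse_unique)
    then show ?thesis using subring_setD(7)[OF sub z] by simp
  qed
  ultimately show "subfield_set (residues a b)" by (simp add: subfield_set_def)
qed

text \<open>The residue field is generated by one element \<open>\<gamma>\<close>, whose conjugates are exactly its Frobenius
  powers; so a second point with the same evaluation kernel evaluates \<open>\<gamma>\<close> to such a power.\<close>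

lemma residue_generator:
  assumes j: "j > 0" and ab: "(a, b) \<in> pts j"
  defines "e \<equiv> pt_period a b"
  obtains \<gamma> P where "\<gamma> \<in> residues a b" "\<And>z. z \<in> residues a b \<Longrightarrow> z \<noteq> 0 \<Longrightarrow> \<exists>m. z = \<gamma> ^ m"
    "P \<in> FP" "poly P \<gamma> = 0" "{z. poly P z = 0} = (\<lambda>i. \<gamma> ^ (q ^ i)) ` {..<e}"
    "card (residues a b) = q ^ e"
proof -
  have e: "e > 0" "\<And>i. (a, b) \<in> pts i \<longleftrightarrow> e dvd i" unfolding e_def using pt_period[OF j ab] by auto
  then have abe: "(a, b) \<in> pts e" by simp
  note RF = residues_subfield[OF e(1) abe]
  have RFix: "residues a b \<subseteq> Fix e" by (rule residues_subset[OF abe])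
  obtain \<gamma> where \<gamma>: "\<gamma> \<in> residues a b" "\<gamma> \<noteq> 0" "\<And>z. z \<in> residues a b \<Longrightarrow> z \<noteq> 0 \<Longrightarrow> \<exists>m. z = \<gamma> ^ m"
    using finite_field_generator[OF RF(1,2)] by metis
  have \<gamma>e: "\<gamma> \<in> Fix e" using \<gamma>(1) RFix by blast
  \<comment> \<open>The nonzero residues are powers of \<open>\<gamma>\<close>, so a field
    \<open>Fix i\<close> containing \<open>\<gamma>\<close> contains both coordinates of the
    point.\<close>
  have gen: "\<gamma> \<in> Fix i \<Longrightarrow> e dvd i" for i
  proof -
    assume "\<gamma> \<in> Fix i"
    then have "z \<in> Fix i" if "z \<in> residues a b" for z
      using \<gamma>(3)[OF that] Fix_power by (cases "z = 0") auto
    then have "a \<in> Fix i" "b \<in> Fix i" using RF(4,5) by auto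
    then have "(a, b) \<in> pts i" using abe by (auto simp: pts_def)
    then show "e dvd i" using e(2) by simp
  qed
  obtain P where P: "P \<in> FP" "P \<noteq> 0" "poly P \<gamma> = 0" "\<And>f. f \<in> FP \<Longrightarrow> poly f \<gamma> = 0 \<Longrightarrow> \<exists>g\<in>FP. f = P * g"
    using minimal_polynomial[OF e(1) \<gamma>e] by metis
  define Ob where "Ob = (\<lambda>i. \<gamma> ^ (q ^ i)) ` {..<e}"
  have inj: "inj_on (\<lambda>i. \<gamma> ^ (q ^ i)) {..<e}"
  proof (rule linorder_inj_onI)
    fix i i' assume *: "i < i'" "i \<in> {..<e}" "i' \<in> {..<e}"
    show "\<gamma> ^ (q ^ i) \<noteq> \<gamma> ^ (q ^ i')"
    proof
      assume "\<gamma> ^ (q ^ i) = \<gamma> ^ (q ^ i')"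
      then have "(\<gamma> ^ (q ^ (i' - i))) ^ (q ^ i) = \<gamma> ^ (q ^ i)" using * by (simp add: frob_frob)
      then have "\<gamma> \<in> Fix (i' - i)" using frob_inj by (simp add: Fix_def)
      from gen[OF this] * show False by (auto dest: dvd_imp_le)
    qed
  qed auto
  have cOb: "card Ob = e" unfolding Ob_def using card_image[OF inj] by simp
  have ObP: "Ob \<subseteq> {z. poly P z = 0}"
    unfolding Ob_def using FP_frob[OF P(1), of \<gamma>] P(3) by (auto simp flip: FP_frob[OF P(1)])
  have finP: "finite {z. poly P z = 0}" by (rule poly_roots_finite[OF P(2)])
  have "e \<le> card {z. poly P z = 0}" using card_mono[OF finP ObP] cOb by simp
  also have "\<dots> \<le> Polynomial.degree P" by (rule card_poly_roots_bound[OF P(2)])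
  finally have eP: "e \<le> Polynomial.degree P" .
  \<comment> \<open>This closes a sandwich: the \<open>e\<close> conjugates of
    \<open>\<gamma>\<close> are roots of \<open>P\<close>, so \<open>e\<close> is at most its degree
    d, while q^d \<le> card (residues a b) \<le> q^e.\<close>
  have le: "q ^ m \<le> card (residues a b)" if "m \<le> Polynomial.degree P" for m
    by (rule card_le_of_degree[OF _ RF(2,3) \<gamma>(1) P(4) that]) (use RF(1) in \<open>simp add: subfield_set_def\<close>)
  have ub: "card (residues a b) \<le> q ^ e" using card_mono[OF _ RFix] card_Fix[OF e(1)] by simp
  have "Polynomial.degree P \<le> e"
    using order_trans[OF le[OF order_refl] ub] q_gt_1 by (simp add: power_increasing_iff)
  then have "card {z. poly P z = 0} \<le> e" using card_poly_roots_bound[OF P(2)] by simp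
  then have "Ob = {z. poly P z = 0}" using card_seteq[OF finP ObP] cOb by simp
  moreover have "card (residues a b) = q ^ e" using le[OF eP] ub by simp
  ultimately show ?thesis using that[OF \<gamma>(1,3) P(1,3)] by (simp add: Ob_def)
qed

lemma prime_norm_place:
  assumes "j > 0" "(a, b) \<in> pts j"
  shows "prime_norm (ring_on function_field_set) (place a b) = q ^ pt_period a b"
proof -
  obtain t where "local_ring_data coord_ring (ev a b) t" using local_ring_data_place[OF assms] ..
  then interpret local_ring_data coord_ring "ev a b" t .
  have "prime_norm (ring_on function_field_set) (place a b) = card (residues a b)"
    unfolding function_field_set_def place_def residues_def
  proof (rule residue_card)
    fix f assume "f \<in> coord_ring"
    then have "ev a b f \<in> residues a b" by (simp add: residues_def)
    then show "inverse (ev a b f) \<in> ev a b ` coord_ring"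
      using subfield_setD(2)[OF residues_subfield(1)[OF assms]] by (simp add: residues_def)
  qed
  then show ?thesis using residue_generator[OF assms] by metis
qed

lemma ev_frob: "f \<in> coord_ring \<Longrightarrow> ev (a ^ (q ^ i)) (b ^ (q ^ i)) f = ev a b f ^ (q ^ i)"
  by (auto elim!: coord_ringE simp: ev_cv) (simp add: cv_def FP_frob frob_add power_mult_distrib)

lemma place_frob: "place (a ^ (q ^ i)) (b ^ (q ^ i)) = place a b"
  unfolding place_def local_ring_at_def by (auto simp: ev_frob) (metis ev_frob power_eq_0_iff)+

lemma pts_frob: "(a, b) \<in> pts j \<Longrightarrow> (a ^ (q ^ i), b ^ (q ^ i)) \<in> pts j"
proof -
  assume ab: "(a, b) \<in> pts j"
  have "(b ^ (q ^ i)) ^ 2 = (b ^ 2) ^ (q ^ i)" by (simp only: power_mult[symmetric] mult.commute)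
  also have "\<dots> = (a ^ (q ^ i)) ^ (q ^ n) - a ^ (q ^ i)"
    using ab by (simp add: pts_def frob_diff frob_frob add.commute)
  finally show ?thesis using ab by (simp add: pts_def Fix_power)
qed

text \<open>Equal rings have equal nonunits, so the evaluations have the same kernel. If
  \<open>g\<close> evaluates to \<open>\<gamma>\<close> at the first point, \<open>P\<close> of
  \<open>g\<close> is in the kernel, so at the second point \<open>g\<close> takes a Frobenius power
  of \<open>\<gamma>\<close>; every \<open>f\<close> is a power of \<open>g\<close> modulo the
  kernel or lies in it.\<close>

lemma place_eq_iff:
  assumes j: "j > 0" and ab: "(a, b) \<in> pts j" and j': "j' > 0" and ab': "(a', b') \<in> pts j'"
  shows "place a b = place a' b' \<longleftrightarrow> (\<exists>i<pt_period a b. a' = a ^ (q ^ i) \<and> b' = b ^ (q ^ i))"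
proof
  assume "\<exists>i<pt_period a b. a' = a ^ (q ^ i) \<and> b' = b ^ (q ^ i)"
  then show "place a b = place a' b'" using place_frob by blast
next
  note b = ptsD(1)[OF ab] and b' = ptsD(1)[OF ab'] and R = subring_setD[OF coord_ring_subring]
  assume eq: "place a b = place a' b'"
  have ker: "ev a b f = 0 \<longleftrightarrow> ev a' b' f = 0" if "f \<in> coord_ring" for f
    using nonunits_place[OF j ab that] nonunits_place[OF j' ab' that] eq by simp
  obtain \<gamma> P where \<gamma>: "\<gamma> \<in> residues a b" "\<And>z. z \<in> residues a b \<Longrightarrow> z \<noteq> 0 \<Longrightarrow> \<exists>m. z = \<gamma> ^ m"
    "P \<in> FP" "poly P \<gamma> = 0" "{z. poly P z = 0} = (\<lambda>i. \<gamma> ^ (q ^ i)) ` {..<pt_period a b}"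
    using residue_generator[OF j ab] by metis
  obtain g where g: "g \<in> coord_ring" "ev a b g = \<gamma>" using \<gamma>(1) by (auto simp: residues_def)
  have "ev a b (poly P g) = 0" using ev_poly_FP[OF b \<gamma>(3) g(1)] g(2) \<gamma>(4) by simp
  then have "poly P (ev a' b' g) = 0" using ker[OF ev_FP[OF \<gamma>(3) g(1)]] ev_poly_FP[OF b' \<gamma>(3) g(1)] by simp
  then obtain i where i: "i < pt_period a b" "ev a' b' g = \<gamma> ^ (q ^ i)" using \<gamma>(5) by blast
  have "ev a' b' f = ev a b f ^ (q ^ i)" if f: "f \<in> coord_ring" for f
  proof (cases "ev a b f = 0")
    case True
    then show ?thesis using ker[OF f] by simp
  next
    case False
    then obtain m where m: "ev a b f = \<gamma> ^ m" using \<gamma>(2) f by (auto simp: residues_def)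
    have gm: "g ^ m \<in> coord_ring" using R(7) g by blast
    have "ev a b (f - g ^ m) = 0" using ev_diff[OF f gm] ev_power[OF b g(1)] g m by simp
    then have "ev a' b' (f - g ^ m) = 0" using ker[OF R(4)[OF f gm]] by simp
    then have "ev a' b' f = (\<gamma> ^ (q ^ i)) ^ m" using ev_diff[OF f gm] ev_power[OF b' g(1)] i by simp
    then show ?thesis by (simp add: m power_mult[symmetric] mult.commute)
  qed
  from this[OF coord_ring_x] this[OF coord_ring_y] i(1)
  show "\<exists>i<pt_period a b. a' = a ^ (q ^ i) \<and> b' = b ^ (q ^ i)" by (auto simp: ev_x ev_y)
qed

text \<open>A place corresponds to one Frobenius orbit of points, of size its degree. Frobenius
  carries each orbit member to every other, so all or none of them lie over
  \<open>Fix i\<close>.\<close>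

lemma fibre_place:
  assumes j: "j > 0" and ab: "(a, b) \<in> pts j" and i: "i > 0"
  shows "card {(a', b'). \<exists>j'>0. (a', b') \<in> pts j' \<and> place a' b' = place a b} = pt_period a b"
    "{(a', b') \<in> pts i. place a' b' = place a b} =
      (if pt_period a b dvd i then {(a', b'). \<exists>j'>0. (a', b') \<in> pts j' \<and> place a' b' = place a b} else {})"
proof -
  define e where "e = pt_period a b"
  have e: "e > 0" "\<And>i. (a, b) \<in> pts i \<longleftrightarrow> e dvd i" unfolding e_def using pt_period[OF j ab] by auto
  define S where "S = {(a', b'). \<exists>j'>0. (a', b') \<in> pts j' \<and> place a' b' = place a b}"
  have S: "S = (\<lambda>i. (a ^ (q ^ i), b ^ (q ^ i))) ` {..<e}"
  proof (intro equalityI subsetI)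
    fix z assume "z \<in> S"
    then obtain a' b' j' where z: "z = (a', b')" "j' > 0" "(a', b') \<in> pts j'" "place a b = place a' b'"
      by (auto simp: S_def)
    then obtain i where "i < e" "a' = a ^ (q ^ i)" "b' = b ^ (q ^ i)"
      using place_eq_iff[OF j ab z(2,3)] by (auto simp: e_def)
    then show "z \<in> (\<lambda>i. (a ^ (q ^ i), b ^ (q ^ i))) ` {..<e}" using z(1) by simp
  next
    fix z assume "z \<in> (\<lambda>i. (a ^ (q ^ i), b ^ (q ^ i))) ` {..<e}"
    then obtain i where "z = (a ^ (q ^ i), b ^ (q ^ i))" by blast
    then show "z \<in> S" using pts_frob[OF ab, of i] place_frob[of a i b] j by (auto simp: S_def)
  qed
  have inj: "inj_on (\<lambda>i. (a ^ (q ^ i), b ^ (q ^ i))) {..<e}"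
  proof (rule linorder_inj_onI)
    fix i i' assume *: "i < i'" "i \<in> {..<e}" "i' \<in> {..<e}"
    show "(a ^ (q ^ i), b ^ (q ^ i)) \<noteq> (a ^ (q ^ i'), b ^ (q ^ i'))"
    proof
      assume eq: "(a ^ (q ^ i), b ^ (q ^ i)) = (a ^ (q ^ i'), b ^ (q ^ i'))"
      have "z \<in> Fix (i' - i)" if "z ^ (q ^ i) = z ^ (q ^ i')" for z :: 'a
      proof -
        have "(z ^ (q ^ (i' - i))) ^ (q ^ i) = z ^ (q ^ i)" using * that by (simp add: frob_frob)
        then show ?thesis using frob_inj by (simp add: Fix_def)
      qed
      then have "(a, b) \<in> pts (i' - i)" using eq ab by (auto simp: pts_def)
      with e(2) * show False by (auto dest: dvd_imp_le)
    qed
  qed auto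
  show "card {(a', b'). \<exists>j'>0. (a', b') \<in> pts j' \<and> place a' b' = place a b} = pt_period a b"
    unfolding S_def[symmetric] S card_image[OF inj] by (simp add: e_def)
  have "(a', b') \<in> pts i \<longleftrightarrow> e dvd i" if ab': "(a', b') \<in> S" for a' b'
  proof -
    obtain m where m: "a' = a ^ (q ^ m)" "b' = b ^ (q ^ m)" "m < e" using ab' unfolding S by auto
    have "(a, b) \<in> pts i" if "(a', b') \<in> pts i"
    proof -
      have bk: "(z ^ (q ^ m)) ^ (q ^ (e - m)) = z" if "z \<in> Fix e" for z :: 'a
        using that m(3) by (simp add: frob_frob Fix_def)
      have "a \<in> Fix e" "b \<in> Fix e" using e(2)[of e] by (auto simp: pts_def)
      with bk pts_frob[OF that, of "e - m"] m show ?thesis by simp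
    qed
    then show ?thesis using pts_frob[of a b i m] m e(2) by blast
  qed
  then show "{(a', b') \<in> pts i. place a' b' = place a b} =
      (if pt_period a b dvd i then {(a', b'). \<exists>j'>0. (a', b') \<in> pts j' \<and> place a' b' = place a b} else {})"
    unfolding S_def[symmetric] e_def[symmetric] using i by (auto simp: S_def)
qed

section \<open>Every place where x is regular comes from a point\<close>

lemma subring_poly:
  assumes V: "subring_set V" "Fix 1 \<subseteq> V" and u: "u \<in> FP" and z: "z \<in> V"
  shows "poly u z \<in> V"
proof -
  have sum: "(\<Sum>i\<in>I. h i) \<in> V" if "\<And>i. i \<in> I \<Longrightarrow> h i \<in> V" for I :: "nat set" and h
    using that by (induction I rule: infinite_finite_induct) (auto intro: subring_setD[OF V(1)])
  show ?thesis
    unfolding poly_altdef using FP_coeff[OF u] V(2) z by (intro sum subring_setD(6,7)[OF V(1)]) auto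
qed

lemma function_field_set_minimal:
  assumes S: "subfield_set S" "Fix 1 \<subseteq> S" "x \<in> S" "y \<in> S"
  shows "function_field_set \<subseteq> S"
proof -
  note R = subfield_setD(1)[OF S(1)]
  have "coord_ring \<subseteq> S"
    unfolding coord_ring_def cv_def
    using subring_poly[OF R S(2) _ S(3)] subring_setD(5,6)[OF R] S(4) by auto
  then show ?thesis
    unfolding function_field_set_def fractions_def using subfield_setD(3)[OF S(1)] by auto
qed

lemma one_not_nonunit: "1 \<in> V \<Longrightarrow> 1 \<notin> nonunits V"
  by (simp add: nonunits_def)

text \<open>The maximal ideal \<open>M\<close> meets the polynomials in \<open>x\<close> in the
  multiples of an irreducible one, with a root \<open>a\<close>. The points above \<open>a\<close>
  are \<open>(a, b)\<close> and \<open>(a, - b)\<close>, and primality of \<open>M\<close> picks one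
  of them; its local ring is contained in \<open>V\<close>, hence equal to it by maximality.\<close>

lemma place_classification:
  assumes V: "dvr_set function_field_set V t" and F: "Fix 1 \<subseteq> V" and x: "x \<in> V"
  shows "\<exists>j>0. \<exists>a b. (a, b) \<in> pts j \<and> V = place a b"
proof -
  define M where "M = nonunits V"
  note VR = dvr_setD(1)[OF V] and VK = dvr_setD(2)[OF V] and I = dvr_nonunits_ideal[OF V, folded M_def]
  note RV = subring_setD[OF VR] and RA = subring_setD[OF coord_ring_subring]
  have M1: "1 \<notin> M" using one_not_nonunit RV(1) by (simp add: M_def)
  have MV: "z \<in> V" if "z \<in> M" for z using that by (simp add: M_def nonunits_def)
  have polyV: "poly u x \<in> V" if "u \<in> FP" for u by (rule subring_poly[OF VR F that x])
  \<comment> \<open>\<open>y\<close> is integral over the polynomials in \<open>x\<close>: if it had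
    a pole, dividing \<open>y ^ 2 = poly D x\<close> by \<open>y ^ 2\<close> would put 1 into
    \<open>M\<close>.\<close>
  have yV: "y \<in> V"
  proof (rule ccontr)
    assume y: "y \<notin> V"
    have "y \<in> function_field_set" using coord_ring_y coord_ring_subset by blast
    then have iy: "inverse y \<in> V" using dvr_valuation[OF V _ y] by blast
    have y0: "y \<noteq> 0" using y RV(2) by auto
    have "inverse y \<in> M" using iy y by (simp add: M_def nonunits_def)
    then have "(poly D x * inverse y) * inverse y \<in> M" using RV(6)[OF polyV[OF D_FP] iy] I(3) by blast
    moreover have "(poly D x * inverse y) * inverse y = 1"
      using y0 by (simp add: curve_eq'[symmetric] power2_eq_square field_simps)
    ultimately show False using M1 by simp
  qed
  have AV: "f \<in> V" if "f \<in> coord_ring" for f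
    using that by (rule coord_ringE) (simp add: cv_def RV(5,6) polyV yV)
  \<comment> \<open>The numerator \<open>f\<close> of the uniformizer is a nonzero coordinate
    function in \<open>M\<close>, and its norm is a nonzero polynomial in \<open>x\<close> that lies
    in \<open>M\<close>.\<close>
  have "t \<in> M" using dvr_setD(3,5)[OF V] by (simp add: M_def nonunits_def)
  moreover have "t \<in> function_field_set" using dvr_setD(2,3)[OF V] by blast
  then obtain f g where fg: "f \<in> coord_ring" "g \<in> coord_ring" "g \<noteq> 0" "t = f / g"
    by (auto simp: function_field_set_def fractions_def)
  ultimately have "g * t \<in> M" using I(3) AV by blast
  then have fM: "f \<in> M" and f0: "f \<noteq> 0" using fg dvr_setD(4)[OF V] by auto
  obtain u v where uv: "u \<in> FP" "v \<in> FP" "f = cv u v x y" using fg(1) by (rule coord_ringE)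
  define N where "N = u ^ 2 - v ^ 2 * D"
  have NFP: "N \<in> FP" unfolding N_def using uv D_FP by (intro FP_diff FP_mult FP_power)
  have N0: "N \<noteq> 0" using norm_eq_0[OF uv(1,2)] f0 uv(3) by (auto simp: N_def cv_def)
  have "cv u (- v) x y * f \<in> M"
    using I(3)[OF fM] AV coord_ringI[OF uv(1) FP_uminus[OF uv(2)]] by blast
  then have "poly N x \<in> M"
    using cv_conj[OF curve_eq', of u v] uv(3) by (simp add: N_def mult.commute)
  define S where "S = {f \<in> FP. f \<noteq> 0 \<and> poly f x \<in> M}"
  have "N \<in> S" using NFP N0 \<open>poly N x \<in> M\<close> by (simp add: S_def)
  then obtain P0 where P0: "P0 \<in> S" "\<And>f. f \<in> S \<Longrightarrow> Polynomial.degree P0 \<le> Polynomial.degree f"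
    using arg_min_nat_lemma[of "\<lambda>f. f \<in> S" _ Polynomial.degree] by blast
  have deg0: "Polynomial.degree P0 > 0"
  proof (rule ccontr)
    assume "\<not> Polynomial.degree P0 > 0"
    then obtain c where c: "P0 = [:c:]" using degree_eq_zeroE by blast
    then have "c \<noteq> 0" "c \<in> M" using P0(1) by (auto simp: S_def)
    moreover have "c \<in> Fix 1" using P0(1) FP_coeff[of P0 0] c by (simp add: S_def)
    then have "inverse c \<in> V" using F Fix_inverse by blast
    ultimately show False by (simp add: M_def nonunits_def)
  qed
  obtain a where a: "poly P0 a = 0" using alg_closed_imp_poly_has_root[OF deg0] ..
  obtain i where i: "i > 0" "a \<in> Fix i" using algebraic_Fix[of P0 a] a P0(1) by (auto simp: S_def)
  obtain P where P: "P \<in> FP" "P \<noteq> 0" "Polynomial.degree P > 0" "poly P a = 0"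
    "\<And>f. f \<in> FP \<Longrightarrow> poly f a = 0 \<Longrightarrow> \<exists>g\<in>FP. f = P * g"
    using minimal_polynomial[OF i] by metis
  have PM: "poly P x \<in> M"
  proof -
    obtain E where E: "E \<in> FP" "P0 = P * E" using P(5)[of P0] P0(1) a unfolding S_def by blast
    have "poly P x * poly E x \<in> M" using P0(1) E(2) by (simp add: S_def)
    then have "poly P x \<in> M \<or> poly E x \<in> M" using I(4)[OF polyV[OF P(1)] polyV[OF E(1)]] by blast
    moreover have "poly E x \<notin> M"
    proof
      assume "poly E x \<in> M"
      moreover have "E \<noteq> 0" using P0(1) E by (auto simp: S_def)
      ultimately have "Polynomial.degree P0 \<le> Polynomial.degree E" using P0(2) E(1) by (simp add: S_def)
      moreover have "Polynomial.degree P0 = Polynomial.degree P + Polynomial.degree E"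
        using E(2) P(2) \<open>E \<noteq> 0\<close> by (simp add: degree_mult_eq)
      ultimately show False using P(3) by simp
    qed
    ultimately show ?thesis by blast
  qed
  have vanish: "poly w x \<in> M" if w: "w \<in> FP" "poly w a = 0" for w
  proof -
    obtain w' where w': "w' \<in> FP" "w = P * w'" using P(5) w by blast
    have "poly w' x * poly P x \<in> M" by (rule I(3)[OF PM polyV[OF w'(1)]])
    then show ?thesis by (simp add: w'(2) mult.commute)
  qed
  obtain b where b: "b ^ 2 = poly D a" using nth_root_exists[of 2 "poly D a"] by auto
  \<comment> \<open>Frobenius of \<open>Fix i\<close> sends \<open>b\<close> to a square root of the
    same value, hence to \<open>b\<close> or \<open>- b\<close>; applied twice it fixes
    \<open>b\<close>.\<close>
  have b2: "b \<in> Fix (2 * i)"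
  proof -
    have "(b ^ (q ^ i)) ^ 2 = (b ^ 2) ^ (q ^ i)" by (simp only: power_mult[symmetric] mult.commute)
    also have "\<dots> = b ^ 2" using FP_Fix[OF D_FP i(2)] b by (simp add: Fix_def)
    finally have "b ^ (q ^ i) = b \<or> b ^ (q ^ i) = - b" by (simp add: power2_eq_iff)
    then have "(b ^ (q ^ i)) ^ (q ^ i) = b" by (auto simp: frob_uminus)
    then show ?thesis by (simp add: Fix_def frob_frob mult_2)
  qed
  define j where "j = 2 * i"
  have j: "j > 0" using i by (simp add: j_def)
  have abj: "(a, b) \<in> pts j" "(a, - b) \<in> pts j"
    using b b2 i(2) Fix_mono[of i j] Fix_uminus[of b j] by (auto simp: pts_def poly_D[symmetric] j_def)
  \<comment> \<open>Were both points excluded, witnesses \<open>f\<close> and \<open>g\<close>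
    outside \<open>M\<close> would have a product vanishing at both. Then \<open>poly u a\<close>
    and \<open>poly v a * b\<close> are 0, which puts the product into \<open>M\<close>.\<close>
  have "\<exists>c. (a, c) \<in> pts j \<and> (\<forall>f\<in>coord_ring. ev a c f = 0 \<longrightarrow> f \<in> M)"
  proof (rule ccontr)
    assume neg: "\<not> ?thesis"
    obtain f where f: "f \<in> coord_ring" "ev a b f = 0" "f \<notin> M" using neg abj(1) by blast
    obtain g where g: "g \<in> coord_ring" "ev a (- b) g = 0" "g \<notin> M" using neg abj(2) by blast
    have h: "f * g \<in> coord_ring" using RA(6) f g by blast
    have hM: "f * g \<notin> M" using I(4)[of f g] f g AV by blast
    obtain u v where uv: "u \<in> FP" "v \<in> FP" "f * g = cv u v x y" using h by (rule coord_ringE)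
    have "ev a b (f * g) = 0" using ev_mult[OF ptsD(1)[OF abj(1)] f(1) g(1)] f(2) by simp
    then have 1: "poly u a + poly v a * b = 0" using ev_cv[OF uv(1,2), of a b] by (simp add: uv(3) cv_def)
    have "ev a (- b) (f * g) = 0" using ev_mult[OF ptsD(1)[OF abj(2)] f(1) g(1)] g(2) by simp
    then have 2: "poly u a - poly v a * b = 0" using ev_cv[OF uv(1,2), of a "- b"] by (simp add: uv(3) cv_def)
    have "2 * poly u a = 0" using 1 2 by (simp add: algebra_simps)
    then have ua: "poly u a = 0" using two_nonzero by simp
    with 1 have vb: "poly v a * b = 0" by simp
    have "poly v x * y \<in> M"
    proof (cases "b = 0")
      case True
      then have "poly D x \<in> M" using vanish[OF D_FP] b by simp
      then have "y * y \<in> M" by (simp add: curve_eq'[symmetric] power2_eq_square)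
      then have "y \<in> M" using I(4)[OF yV yV] by blast
      then show ?thesis using I(3) polyV[OF uv(2)] by blast
    next
      case False
      then have "poly v x \<in> M" using vanish[OF uv(2)] vb by simp
      then have "y * poly v x \<in> M" by (rule I(3)[OF _ yV])
      then show ?thesis by (simp add: mult.commute)
    qed
    then have "f * g \<in> M" using I(1) vanish[OF uv(1) ua] by (simp add: uv(3) cv_def)
    with hM show False ..
  qed
  then obtain c where c: "(a, c) \<in> pts j" "\<And>f. f \<in> coord_ring \<Longrightarrow> ev a c f = 0 \<Longrightarrow> f \<in> M" by blast
  have "place a c \<subseteq> V"
  proof
    fix z assume "z \<in> place a c"
    then obtain f g where fg: "f \<in> coord_ring" "g \<in> coord_ring" "ev a c g \<noteq> 0" "z = f / g"
      by (auto simp: place_def local_ring_at_def)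
    have "ev a c g \<in> residues a c" using fg(2) by (simp add: residues_def)
    then have "inverse (ev a c g) \<in> residues a c"
      using subfield_setD(2)[OF residues_subfield(1)[OF j c(1)]] by blast
    \<comment> \<open>\<open>h\<close> inverts \<open>g\<close> modulo the evaluation kernel, hence
      modulo \<open>M\<close>; so \<open>g\<close> is a unit of \<open>V\<close>.\<close>
    then obtain h where h: "h \<in> coord_ring" "ev a c h = inverse (ev a c g)" by (auto simp: residues_def)
    have hg: "h * g \<in> coord_ring" using RA(6) h fg by blast
    have "ev a c (h * g - 1) = 0"
      using ev_diff[OF hg RA(1)] ev_mult[OF ptsD(1)[OF c(1)] h(1) fg(2)] ev_1 fg(3) h(2) by simp
    then have *: "h * g - 1 \<in> M" using c(2) RA(4)[OF hg RA(1)] by blast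
    have "g \<notin> M"
    proof
      assume "g \<in> M"
      then have "h * g \<in> M" using I(3) AV[OF h(1)] by blast
      from I(2)[OF this *] M1 show False by simp
    qed
    then have "inverse g \<in> V" using AV[OF fg(2)] by (simp add: M_def nonunits_def)
    then show "z \<in> V" using RV(6) AV[OF fg(1)] fg(4) by (simp add: divide_inverse)
  qed
  moreover obtain t' where "dvr_set function_field_set (place a c) t'" using dvr_place[OF j c(1)] by blast
  ultimately have "place a c = V" using dvr_maximal[OF function_field_set_subfield _ V] by blast
  with j c(1) show ?thesis by blast
qed

section \<open>Point counts expressed through degrees of places\<close>

abbreviation primes :: "'a set set" where
  "primes \<equiv> function_field_primes (Fix 1) (ring_on function_field_set)"

abbreviation pnorm :: "'a set \<Rightarrow> nat" where
  "pnorm \<equiv> prime_norm (ring_on function_field_set)"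

definition prime_deg :: "'a set \<Rightarrow> nat" where
  "prime_deg V = (THE e. pnorm V = q ^ e)"

lemma prime_deg_eq: "pnorm V = q ^ e \<Longrightarrow> prime_deg V = e"
  unfolding prime_deg_def using q_gt_1 by (intro the_equality) auto

lemma place_prime: "j > 0 \<Longrightarrow> (a, b) \<in> pts j \<Longrightarrow> place a b \<in> primes \<and> x \<in> place a b"
proof -
  assume ab: "j > 0" "(a, b) \<in> pts j"
  have "Fix 1 \<subseteq> place a b" "x \<in> place a b"
    using coord_ring_place[of a b] coord_ring_const coord_ring_x by auto
  then show ?thesis
    unfolding function_field_primes_iff[OF function_field_set_subfield] using dvr_place[OF ab] by simp
qed

lemma finite_prime_is_place:
  assumes "V \<in> primes" "x \<in> V"
  obtains j a b where "j > 0" "(a, b) \<in> pts j" "V = place a b"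
  using assms place_classification function_field_primes_iff[OF function_field_set_subfield] by metis

text \<open>Grouping the points by their place: a place of degree dividing \<open>j\<close> is hit
  by exactly as many points of \<open>pts j\<close> as its degree, any other place by none.\<close>

lemma finite_primes_count:
  assumes j: "j > 0"
  shows "finite {V \<in> primes. x \<in> V \<and> prime_deg V dvd j}"
    "(\<Sum>V | V \<in> primes \<and> x \<in> V \<and> prime_deg V dvd j. prime_deg V) = card (pts j)"
proof -
  have deg: "prime_deg (place a b) = pt_period a b" if "j > 0" "(a, b) \<in> pts j" for j a b
    using prime_deg_eq[OF prime_norm_place[OF that]] .
  have eq: "{V \<in> primes. x \<in> V \<and> prime_deg V dvd j} = (\<lambda>(a, b). place a b) ` pts j"
  proof (intro equalityI subsetI)
    fix V assume V: "V \<in> {V \<in> primes. x \<in> V \<and> prime_deg V dvd j}"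
    then obtain j' a b where *: "j' > 0" "(a, b) \<in> pts j'" "V = place a b"
      using finite_prime_is_place[of V] by auto
    then have "pt_period a b dvd j" using deg[OF *(1,2)] V by simp
    then have "(a, b) \<in> pts j" using pt_period(2)[OF *(1,2)] by simp
    then show "V \<in> (\<lambda>(a, b). place a b) ` pts j" using *(3) by (intro image_eqI[of _ _ "(a, b)"]) auto
  next
    fix V assume "V \<in> (\<lambda>(a, b). place a b) ` pts j"
    then obtain a b where ab: "(a, b) \<in> pts j" "V = place a b" by auto
    then show "V \<in> {V \<in> primes. x \<in> V \<and> prime_deg V dvd j}"
      using place_prime[OF j ab(1)] deg[OF j ab(1)] pt_period(2)[OF j ab(1)] ab by simp
  qed
  then show "finite {V \<in> primes. x \<in> V \<and> prime_deg V dvd j}" using finite_pts[OF j] by simp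
  have "card (pts j) = (\<Sum>z\<in>pts j. 1)" by simp
  also have "\<dots> = (\<Sum>V\<in>(\<lambda>(a, b). place a b) ` pts j. \<Sum>z\<in>{z \<in> pts j. (\<lambda>(a, b). place a b) z = V}. 1)"
    by (rule sum.image_gen[OF finite_pts[OF j]])
  also have "\<dots> = (\<Sum>V\<in>(\<lambda>(a, b). place a b) ` pts j. prime_deg V)"
  proof (rule sum.cong[OF refl])
    fix V assume "V \<in> (\<lambda>(a, b). place a b) ` pts j"
    then obtain a b where ab: "(a, b) \<in> pts j" "V = place a b" by auto
    have "{z \<in> pts j. (\<lambda>(a, b). place a b) z = V} = {(a', b') \<in> pts j. place a' b' = place a b}" using ab by auto
    then show "(\<Sum>z\<in>{z \<in> pts j. (\<lambda>(a, b). place a b) z = V}. 1) = prime_deg V"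
      using fibre_place[OF j ab(1) j] deg[OF j ab(1)] ab pt_period(2)[OF j ab(1), of j] by simp
  qed
  finally show "(\<Sum>V | V \<in> primes \<and> x \<in> V \<and> prime_deg V dvd j. prime_deg V) = card (pts j)"
    using eq by simp
qed

section \<open>The place at infinity\<close>

lemma x_nonzero: "x \<noteq> 0"
  using transc[OF FP_X] by auto

text \<open>Division of x^Q - x by x^(Q + 1) turns it into the negative of the same expression in
  1/x; the half exponent is an integer as Q is odd, and \<open>I\<close> absorbs the sign.\<close>

definition y_inf :: 'a where "y_inf = I * y / x ^ ((q ^ n + 1) div 2)"

text \<open>The curve looks the same at infinity: the substitution \<open>x \<mapsto> 1/x\<close> preserves its equation because
  \<open>-1\<close> is a square.\<close>

lemma curve_at_infinity: "curve q k n s (inverse x) y_inf"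
proof unfold_locales
  fix f assume f: "f \<in> FP" "poly f (inverse x) = 0"
  have "reflect_poly f \<in> FP" using f(1) by (auto simp: FP_def coeff_reflect_poly)
  moreover have "poly (reflect_poly f) x = 0"
    using f(2) x_nonzero by (simp add: poly_reflect_poly_nz)
  ultimately show "f = 0" using transc by (metis reflect_poly_eq_0_iff)
next
  have "2 * ((q ^ n + 1) div 2) = q ^ n + 1" using odd_q by simp
  then have "(x ^ ((q ^ n + 1) div 2)) ^ 2 = x ^ (q ^ n) * x"
    by (metis power_add power_mult power_one_right mult.commute)
  then have "y_inf ^ 2 = - (x ^ (q ^ n) - x) / (x ^ (q ^ n) * x)"
    by (simp add: y_inf_def power_mult_distrib power_divide I_square curve_eq)
  also have "\<dots> = inverse x ^ (q ^ n) - inverse x"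
    using x_nonzero by (simp add: field_simps)
  finally show "y_inf ^ 2 = inverse x ^ (q ^ n) - inverse x" .
qed

lemma function_field_set_at_infinity:
  "curve.function_field_set q (inverse x) y_inf = function_field_set"
proof
  interpret inf: curve q k T n s "inverse x" y_inf by (rule curve_at_infinity)
  note K = function_field_set_subfield and Ki = inf.function_field_set_subfield
  have F: "Fix 1 \<subseteq> function_field_set" "Fix 1 \<subseteq> inf.function_field_set"
    using coord_ring_const coord_ring_subset inf.coord_ring_const inf.coord_ring_subset by blast+
  have mem: "x \<in> function_field_set" "y \<in> function_field_set" "inverse x \<in> inf.function_field_set" "y_inf \<in> inf.function_field_set"
    using coord_ring_x coord_ring_y coord_ring_subset inf.coord_ring_x inf.coord_ring_y inf.coord_ring_subset by blast+
  have "y_inf \<in> function_field_set" unfolding y_inf_def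
    using I_Fix[of 1] F mem subring_setD(6,7)[OF subfield_setD(1)[OF K]] by (intro subfield_setD(3)[OF K]) auto
  then show "inf.function_field_set \<subseteq> function_field_set"
    using F mem subfield_setD(2)[OF K] by (intro inf.function_field_set_minimal[OF K]) auto
  have x: "x \<in> inf.function_field_set" using subfield_setD(2)[OF Ki mem(3)] by simp
  have "y = - I * y_inf * x ^ ((q ^ n + 1) div 2)"
    using x_nonzero I_square by (simp add: y_inf_def mult.assoc[symmetric])
  also have "\<dots> \<in> inf.function_field_set"
    using I_Fix[of 1] F mem x by (intro subring_setD(3,6,7)[OF subfield_setD(1)[OF Ki]]) auto
  finally show "function_field_set \<subseteq> inf.function_field_set"
    using F x by (intro function_field_set_minimal[OF Ki]) auto
qed

definition place_inf :: "'a set" where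
  "place_inf = curve.place q (inverse x) y_inf 0 0"

text \<open>A prime without \<open>x\<close> contains \<open>inverse x\<close> as a nonunit, so in
  the chart at infinity it is the place of a point with first coordinate 0; the equation then forces
  the second to be 0. Both coordinates being constants, the degree is 1.\<close>

lemma place_inf:
  shows "place_inf \<in> primes" "x \<notin> place_inf" "pnorm place_inf = q ^ 1" "V \<in> primes \<Longrightarrow> x \<notin> V \<Longrightarrow> V = place_inf"
proof -
  interpret inf: curve q k T n s "inverse x" y_inf by (rule curve_at_infinity)
  note eq = function_field_set_at_infinity
  have pts0: "(0, 0) \<in> pts i" for i using q_power_pos[of n] by (simp add: pts_def zero_power del: q_power_pos)
  have per: "inf.pt_period 0 0 = 1" using inf.pt_period(2)[OF zero_less_one pts0, of 1] pts0[of 1] by simp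
  show "place_inf \<in> primes" using inf.place_prime[OF zero_less_one pts0] by (simp add: place_inf_def eq)
  show "pnorm place_inf = q ^ 1" using inf.prime_norm_place[OF zero_less_one pts0] per by (simp add: place_inf_def eq)
  have "inverse x \<in> nonunits place_inf"
    using inf.nonunits_place[OF zero_less_one pts0 inf.coord_ring_x] inf.ev_x by (simp add: place_inf_def)
  then show "x \<notin> place_inf" using x_nonzero by (simp add: nonunits_def)
  assume V: "V \<in> primes" "x \<notin> V"
  then obtain t where t: "dvr_set function_field_set V t" using function_field_primes_iff[OF function_field_set_subfield] by blast
  have "inverse x \<in> V"
    using dvr_valuation[OF t _ V(2)] coord_ring_x coord_ring_subset by blast
  moreover from this obtain j a b where jab: "j > 0" "(a, b) \<in> pts j" "V = inf.place a b"
    using inf.finite_prime_is_place[of V] V(1) by (metis eq)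
  ultimately have "inverse x \<in> nonunits (inf.place a b)" using V(2) by (simp add: nonunits_def)
  then have "a = 0" using inf.nonunits_place[OF jab(1,2) inf.coord_ring_x] inf.ev_x by simp
  moreover have "b = 0" using jab(2) \<open>a = 0\<close> q_power_pos[of n] by (simp add: pts_def zero_power del: q_power_pos)
  ultimately show "V = place_inf" using jab(3) by (simp add: place_inf_def)
qed

theorem primes_count:
  shows "V \<in> primes \<Longrightarrow> pnorm V = q ^ prime_deg V \<and> prime_deg V > 0"
    and "j > 0 \<Longrightarrow> finite {V \<in> primes. prime_deg V dvd j}"
    and "j > 0 \<Longrightarrow> (\<Sum>V | V \<in> primes \<and> prime_deg V dvd j. prime_deg V) = card (pts j) + 1"
proof -
  have deg_inf: "prime_deg place_inf = 1" using prime_deg_eq[OF place_inf(3)] .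
  show "pnorm V = q ^ prime_deg V \<and> prime_deg V > 0" if V: "V \<in> primes"
  proof (cases "x \<in> V")
    case True
    then obtain j a b where jab: "j > 0" "(a, b) \<in> pts j" "V = place a b"
      using finite_prime_is_place[OF V] by metis
    show ?thesis
      using prime_norm_place[OF jab(1,2)] prime_deg_eq[OF prime_norm_place[OF jab(1,2)]] pt_period(1)[OF jab(1,2)] jab(3)
      by simp
  next
    case False
    then show ?thesis using place_inf(4)[OF V] place_inf(3) deg_inf by simp
  qed
  assume j: "j > 0"
  have split: "{V \<in> primes. prime_deg V dvd j} = insert place_inf {V \<in> primes. x \<in> V \<and> prime_deg V dvd j}"
  proof (intro equalityI subsetI)
    fix V assume "V \<in> {V \<in> primes. prime_deg V dvd j}"
    then show "V \<in> insert place_inf {V \<in> primes. x \<in> V \<and> prime_deg V dvd j}"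
      using place_inf(4)[of V] by (cases "x \<in> V") simp_all
  next
    fix V assume "V \<in> insert place_inf {V \<in> primes. x \<in> V \<and> prime_deg V dvd j}"
    then show "V \<in> {V \<in> primes. prime_deg V dvd j}"
      using place_inf(1) deg_inf by (cases "V = place_inf") simp_all
  qed
  show "finite {V \<in> primes. prime_deg V dvd j}" unfolding split using finite_primes_count(1)[OF j] by simp
  show "(\<Sum>V | V \<in> primes \<and> prime_deg V dvd j. prime_deg V) = card (pts j) + 1"
    unfolding split using finite_primes_count[OF j] place_inf(2) deg_inf by simp
qed

section \<open>The field of constants\<close>

text \<open>Polynomials over a ring record are coefficient lists with the leading coefficient first,
  hence \<open>rev\<close>.\<close>

lemma ring_on_eval: "ring.eval (ring_on K) p z = poly (Poly (rev p)) (z :: 'a)" if K: "subring_set K" for K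
proof -
  interpret domain "ring_on K" by (rule domain_ring_on[OF K])
  have pw: "w [^]\<^bsub>ring_on K\<^esub> (m::nat) = w ^ m" for w :: 'a and m by (induction m) (auto simp: mult.commute)
  show ?thesis
    by (induction p) (auto simp: Poly_append poly_monom pw algebra_simps)
qed

lemma ring_on_poly:
  assumes K: "subring_set K" and p: "p \<in> carrier (Fix 1 [X]\<^bsub>ring_on K\<^esub>)"
  shows "Poly (rev p) \<in> FP" "Poly (rev p) = 0 \<Longrightarrow> p = []"
proof -
  have pp: "set p \<subseteq> Fix 1" "p \<noteq> [] \<Longrightarrow> hd p \<noteq> 0"
    using p by (auto simp: univ_poly_def polynomial_def)
  show "Poly (rev p) \<in> FP"
    using pp(1) by (auto simp: FP_def coeff_Poly_eq nth_default_def rev_nth subset_iff)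
  assume "Poly (rev p) = 0"
  then obtain m where "rev p = replicate m 0" by (auto simp: Poly_eq_0)
  then have "p = replicate m 0" by (metis rev_replicate rev_rev_ident)
  then show "p = []" using pp(2) by (cases m) auto
qed

lemma subfield_Fix_ring_on: "subfield (Fix 1) (ring_on function_field_set)"
proof -
  note K = function_field_set_subfield
  interpret field "ring_on function_field_set" by (rule field_ring_on[OF K])
  have FK: "Fix 1 \<subseteq> function_field_set" using coord_ring_const coord_ring_subset by blast
  have "subring_set (Fix 1)" using Fix_1 Fix_diff Fix_mult by (auto simp: subring_set_def)
  then have "subring (Fix 1) (ring_on function_field_set)"
    using subring_ring_on[OF subfield_setD(1)[OF K]] FK by simp
  then show ?thesis
    using ring_on_inv[OF K] FK Fix_inverse by (intro subfieldI') auto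
qed

text \<open>Nonzero elements of \<open>Fix j\<close> are roots of unity and hence never nonunits.
  The place at infinity has only constants as residues, so \<open>a - c\<close> is a nonunit for
  some constant \<open>c\<close>; being in \<open>Fix j\<close>, it is 0.\<close>

lemma infinite_place_algebraic:
  assumes a: "a \<in> function_field_set" and j: "j > 0" "a \<in> Fix j"
  shows "a \<in> Fix 1"
proof -
  interpret inf: curve q k T n s "inverse x" y_inf by (rule curve_at_infinity)
  have pts0: "(0, 0) \<in> pts 1" using q_power_pos[of n] by (simp add: pts_def zero_power del: q_power_pos)
  define V where "V = inf.place 0 0"
  obtain t where t: "dvr_set inf.function_field_set V t" using inf.dvr_place[OF zero_less_one pts0] by (auto simp: V_def)
  note RV = subring_setD[OF dvr_setD(1)[OF t]] and M = dvr_nonunits_ideal[OF t]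
  have root: "w \<notin> nonunits V" if w: "w \<noteq> 0" "w \<in> Fix j \<or> inverse w \<in> Fix j" for w
  proof
    assume wM: "w \<in> nonunits V"
    then have wV: "w \<in> V" by (simp add: nonunits_def)
    have "q ^ j > 1" using q_gt_1 j(1) by (rule one_less_power)
    then obtain N where N: "q ^ j - 1 = Suc N" by (metis Suc_diff_Suc diff_Suc_1 One_nat_def)
    have "w \<in> Fix j" using w Fix_inverse[of "inverse w" j] by auto
    then have "w ^ Suc N = 1" using Fix_nonzero_power[OF _ w(1), of j] N by simp
    moreover have "w ^ N * w \<in> nonunits V" using M(3)[OF wM RV(7)[OF wV]] .
    ultimately have "1 \<in> nonunits V" by (simp add: mult.commute)
    then show False using RV(1) by (simp add: nonunits_def)
  qed
  have "a \<in> V"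
  proof (rule ccontr)
    assume nV: "a \<notin> V"
    then have "a \<noteq> 0" using RV(2) by auto
    have "inverse a \<in> V" using dvr_valuation[OF t _ nV] a function_field_set_at_infinity by simp
    then have "inverse a \<in> nonunits V" using nV by (simp add: nonunits_def)
    then show False using root[of "inverse a"] \<open>a \<noteq> 0\<close> j(2) by simp
  qed
  then obtain f g where fg: "f \<in> inf.coord_ring" "g \<in> inf.coord_ring" "inf.ev 0 0 g \<noteq> 0" "a = f / g"
    by (auto simp: V_def inf.place_def local_ring_at_def)
  note RA = subring_setD[OF inf.coord_ring_subring]
  define c where "c = inf.ev 0 0 f / inf.ev 0 0 g"
  have c: "c \<in> Fix 1"
    unfolding c_def using inf.residues_subset[OF pts0] fg(1,2) by (intro Fix_divide) (auto simp: inf.residues_def)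
  have cA: "c \<in> inf.coord_ring" by (rule inf.coord_ring_const[OF c])
  have h: "f - c * g \<in> inf.coord_ring" using RA(4,6) fg cA by blast
  have "inf.ev 0 0 (f - c * g) = 0"
    using inf.ev_diff[OF fg(1) RA(6)[OF cA fg(2)]] inf.ev_mult[OF inf.ptsD(1)[OF pts0] cA fg(2)] inf.ev_const[OF c] fg(3)
    by (simp add: c_def)
  then have "f - c * g \<in> nonunits V" using inf.nonunits_place[OF zero_less_one pts0 h] by (simp add: V_def)
  moreover have "inverse g \<in> V"
    unfolding V_def inf.place_def local_ring_at_def
    using fg RA(1) by (intro CollectI exI[of _ 1] exI[of _ g]) (auto simp: divide_inverse)
  ultimately have "inverse g * (f - c * g) \<in> nonunits V" by (rule M(3))
  moreover have "g \<noteq> 0" using fg(3) inf.ev_const[OF Fix_0, of 0 0] by auto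
  then have "inverse g * (f - c * g) = a - c" by (simp add: fg(4) field_simps)
  ultimately have "a - c \<in> nonunits V" by simp
  moreover have "a - c \<in> Fix j" using j c Fix_mono[of 1 j] by (intro Fix_diff) auto
  ultimately have "a - c = 0" using root by blast
  then show ?thesis using c by simp
qed

theorem global_function_field_curve: "global_function_field q (Fix 1) (ring_on function_field_set)"
proof -
  define K where "K = function_field_set"
  have K: "subfield_set K" using function_field_set_subfield by (simp add: K_def)
  note KR = subfield_setD(1)[OF K]
  interpret field "ring_on K" by (rule field_ring_on[OF K])
  have F: "subfield (Fix 1) (ring_on K)" using subfield_Fix_ring_on by (simp add: K_def)
  have FK: "Fix 1 \<subseteq> K" using coord_ring_const coord_ring_subset by (auto simp: K_def)
  have xK: "x \<in> K" and yK: "y \<in> K" using coord_ring_x coord_ring_y coord_ring_subset by (auto simp: K_def)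
  have kernel: "a_kernel (Fix 1 [X]\<^bsub>ring_on K\<^esub>) (ring_on K) (\<lambda>p. eval p x) = {[]}"
  proof -
    have "p = []" if "p \<in> carrier (Fix 1 [X]\<^bsub>ring_on K\<^esub>)" "eval p x = 0" for p
      using ring_on_poly[OF KR that(1)] transc that(2) ring_on_eval[OF KR, of p x] by simp
    then show ?thesis by (auto simp: a_kernel_def' univ_poly_zero_closed)
  qed
  have tr: "transcendental (Fix 1) x"
    using trivial_ker_imp_transcendental[OF subfieldE(1)[OF F] _ kernel] xK by (simp add: over_def)
  define E where "E = generate_field (ring_on K) (insert x (Fix 1))"
  have EK: "E \<subseteq> K" unfolding E_def using generate_field_incl[of "insert x (Fix 1)"] xK FK by simp
  have Esf: "subfield E (ring_on K)" unfolding E_def by (rule generate_field_is_subfield) (use xK FK in simp)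
  have E: "subfield_set E"
    unfolding subfield_set_def
  proof
    show "subring_set E" using subfieldE(1)[OF Esf] subring_ring_on[OF KR] by simp
    show "\<forall>a\<in>E. inverse a \<in> E"
    proof
      fix a assume a: "a \<in> E"
      show "inverse a \<in> E"
      proof (cases "a = 0")
        case False
        then show ?thesis using generate_field.m_inv[of a "ring_on K" "insert x (Fix 1)"] a EK ring_on_inv[OF K, of a]
          by (auto simp: E_def)
      qed (use a in simp)
    qed
  qed
  have FE: "Fix 1 \<subseteq> E" "x \<in> E" unfolding E_def by (auto intro: generate_field.incl)
  note ER = subfield_setD(1)[OF E]
  \<comment> \<open>Multiplying numerator and denominator by the conjugate of the denominator leaves
    a denominator in \<open>x\<close> alone, so two generators over \<open>E\<close> are
    enough.\<close>
  have "Span E [1, y] = K"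
  proof
    show "Span E [1, y] \<subseteq> K" using Span_in_carrier[of E "[1, y]"] EK yK subring_setD(1)[OF KR] by simp
    show "K \<subseteq> Span E [1, y]"
    proof
      fix z assume "z \<in> K"
      then obtain f g where fg: "f \<in> coord_ring" "g \<in> coord_ring" "g \<noteq> 0" "z = f / g"
        by (auto simp: K_def function_field_set_def fractions_def)
      obtain u v where uv: "u \<in> FP" "v \<in> FP" "g = cv u v x y" using fg(2) by (rule coord_ringE)
      define N where "N = u ^ 2 - v ^ 2 * D"
      have NFP: "N \<in> FP" unfolding N_def using uv D_FP by (intro FP_diff FP_mult FP_power)
      have "N \<noteq> 0" using norm_eq_0[OF uv(1,2)] fg(3) uv(3) by (auto simp: N_def cv_def)
      then have Nx: "poly N x \<noteq> 0" using transc[OF NFP] by blast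
      have gg: "g * cv u (- v) x y = poly N x" unfolding uv(3) N_def by (rule cv_conj[OF curve_eq'])
      have cg: "cv u (- v) x y \<in> coord_ring" using coord_ringI[OF uv(1) FP_uminus[OF uv(2)]] .
      have "f * cv u (- v) x y \<in> coord_ring" using subring_setD(6)[OF coord_ring_subring fg(1) cg] .
      then obtain u' v' where uv': "u' \<in> FP" "v' \<in> FP" "f * cv u (- v) x y = cv u' v' x y" by (rule coord_ringE)
      have cg0: "cv u (- v) x y \<noteq> 0" using gg Nx by auto
      have "z = (f * cv u (- v) x y) / (g * cv u (- v) x y)" using fg cg0 by simp
      also have "\<dots> = poly u' x / poly N x * 1 + (poly v' x / poly N x * y + 0)"
        unfolding gg uv'(3) by (simp add: cv_def add_divide_distrib)
      finally have "z = poly u' x / poly N x * 1 + (poly v' x / poly N x * y + 0)" .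
      moreover have e: "poly u' x / poly N x \<in> E" "poly v' x / poly N x \<in> E"
        using subring_poly[OF ER FE(1) _ FE(2)] uv' NFP by (auto intro!: subfield_setD(3)[OF E])
      moreover have "poly v' x / poly N x * y + 0 \<in> line_extension E y {0}"
        unfolding line_extension_mem_iff using e(2) by (intro bexI[of _ "poly v' x / poly N x"] bexI[of _ 0]) auto
      ultimately have "z \<in> line_extension E 1 (line_extension E y {0})"
        unfolding line_extension_mem_iff[of z] by auto
      then show "z \<in> Span E [1, y]" by simp
    qed
  qed
  then have fd: "finite_dimension E K"
    using Span_finite_dimension[OF Esf, of "[1, y]"] yK subring_setD(1)[OF KR] by simp
  have alg: "a \<in> Fix 1" if a: "a \<in> K" "(algebraic over (Fix 1)) a" for a
  proof -
    obtain p where p: "p \<in> carrier (Fix 1 [X]\<^bsub>ring_on K\<^esub>)" "p \<noteq> []" "eval p a = 0"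
      using algebraicE[OF subfieldE(1)[OF F] _ a(2)] a(1) by auto
    have "Poly (rev p) \<noteq> 0" "Poly (rev p) \<in> FP" "poly (Poly (rev p)) a = 0"
      using ring_on_poly[OF KR p(1)] p ring_on_eval[OF KR, of p a] by auto
    then obtain j where "j > 0" "a \<in> Fix j" using algebraic_Fix by metis
    then show ?thesis using infinite_place_algebraic a(1) by (simp add: K_def)
  qed
  have "function_field (Fix 1) (ring_on K)"
    unfolding function_field_def using field_axioms F xK tr fd by (auto simp: E_def)
  then show ?thesis
    unfolding global_function_field_def using alg[unfolded over_def] card_Fix[of 1] by (simp add: K_def)
qed

end

section \<open>Counting effective divisors\<close>

locale graded_primes =
  fixes Pr :: "'b set" and dg :: "'b \<Rightarrow> nat"
  assumes dg_pos: "V \<in> Pr \<Longrightarrow> dg V > 0"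
    and fin_dvd: "j > 0 \<Longrightarrow> finite {V \<in> Pr. dg V dvd j}"
begin

definition deg :: "'b multiset \<Rightarrow> nat" where "deg D = (\<Sum>V\<in>#D. dg V)"

definition Eff :: "nat \<Rightarrow> 'b multiset set" where
  "Eff m = {D. set_mset D \<subseteq> Pr \<and> deg D = m}"

text \<open>For the primes of a curve this weighted count is the number of its points over the
  extension of degree \<open>j\<close>, those at infinity included.\<close>

definition N :: "nat \<Rightarrow> nat" where "N j = (\<Sum>V | V \<in> Pr \<and> dg V dvd j. dg V)"

definition bounded :: "nat \<Rightarrow> 'b set" where "bounded m = {V \<in> Pr. dg V \<le> m}"

lemma finite_bounded: "finite (bounded m)"
proof -
  have "bounded m \<subseteq> (\<Union>j\<in>{1..m}. {V \<in> Pr. dg V dvd j})"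
  proof
    fix V assume "V \<in> bounded m"
    then have "dg V \<in> {1..m}" "V \<in> {W \<in> Pr. dg W dvd dg V}" using dg_pos[of V] by (auto simp: bounded_def)
    then show "V \<in> (\<Union>j\<in>{1..m}. {V \<in> Pr. dg V dvd j})" by blast
  qed
  moreover have "finite (\<Union>j\<in>{1..m}. {V \<in> Pr. dg V dvd j})" using fin_dvd by auto
  ultimately show ?thesis by (rule finite_subset)
qed

lemma deg_count_superset:
  assumes "finite S" "set_mset D \<subseteq> S"
  shows "deg D = (\<Sum>V\<in>S. dg V * count D V)"
  using assms(2)
proof (induction D)
  case (add V D)
  have "(\<Sum>W\<in>S. dg W * count (add_mset V D) W) = (\<Sum>W\<in>S. dg W * count D W + (if W = V then dg V else 0))"
    by (rule sum.cong) auto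
  also have "\<dots> = deg D + dg V" using add assms(1) by (simp add: sum.distrib)
  finally show ?case by (simp add: deg_def)
qed (simp add: deg_def)

lemma deg_count: "deg D = (\<Sum>V\<in>set_mset D. dg V * count D V)"
  by (rule deg_count_superset) auto

lemma count_mult_le: "dg V * count D V \<le> deg D"
proof (cases "V \<in># D")
  case True
  then show ?thesis unfolding deg_count by (intro member_le_sum) auto
qed (simp add: not_in_iff)

lemma Eff_bounded:
  assumes "D \<in> Eff m"
  shows "set_mset D \<subseteq> bounded m" "count D V \<le> m" "size D \<le> m"
proof -
  have D: "set_mset D \<subseteq> Pr" "deg D = m" using assms by (auto simp: Eff_def)
  show "set_mset D \<subseteq> bounded m"
  proof
    fix V assume V: "V \<in># D"
    then have "dg V \<le> dg V * count D V" by simp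
    from order_trans[OF this count_mult_le] D(2) have "dg V \<le> m" by metis
    then show "V \<in> bounded m" using D V by (auto simp: bounded_def)
  qed
  show "count D V \<le> m"
  proof (cases "V \<in># D")
    case True
    then have "dg V > 0" using dg_pos D by auto
    then have "count D V \<le> dg V * count D V" by simp
    from order_trans[OF this count_mult_le] D(2) show ?thesis by metis
  qed (simp add: not_in_iff)
  have "size D = (\<Sum>V\<in>set_mset D. count D V)" by (simp add: size_multiset_overloaded_eq)
  also have "\<dots> \<le> (\<Sum>V\<in>set_mset D. dg V * count D V)"
    using dg_pos D by (intro sum_mono) (auto simp: subset_iff Suc_le_eq)
  finally show "size D \<le> m" using D by (simp add: deg_count)
qed

lemma finite_Eff: "finite (Eff m)"
proof -
  have "Eff m \<subseteq> mset ` {xs. set xs \<subseteq> bounded m \<and> length xs \<le> m}"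
  proof
    fix D assume D: "D \<in> Eff m"
    obtain xs where xs: "mset xs = D" using ex_mset by blast
    with Eff_bounded[OF D] have "set xs \<subseteq> bounded m" "length xs \<le> m"
      by (auto simp flip: set_mset_mset size_mset)
    with xs show "D \<in> mset ` {xs. set xs \<subseteq> bounded m \<and> length xs \<le> m}" by blast
  qed
  then show ?thesis using finite_lists_length_le[OF finite_bounded] finite_subset by blast
qed

lemma Eff_0: "Eff 0 = {{#}}"
proof
  show "Eff 0 \<subseteq> {{#}}" using Eff_bounded(3)[of _ 0] by auto
qed (simp add: Eff_def deg_def)

text \<open>Removing \<open>i\<close> copies of \<open>V\<close> is a bijection onto the divisors of
  degree \<open>m - i * dg V\<close>; the guard handles truncated subtraction.\<close>

lemma card_Eff_count:
  assumes V: "V \<in> Pr"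
  shows "card {D \<in> Eff m. i \<le> count D V} = (if i * dg V \<le> m then card (Eff (m - i * dg V)) else 0)"
proof (cases "i * dg V \<le> m")
  case True
  have deg_rep: "deg (D + replicate_mset i V) = deg D + i * dg V" for D
    by (simp add: deg_def mult.commute)
  have "bij_betw (\<lambda>D. D + replicate_mset i V) (Eff (m - i * dg V)) {D \<in> Eff m. i \<le> count D V}"
  proof (rule bij_betwI[of _ _ _ "\<lambda>D. D - replicate_mset i V"])
    show "(\<lambda>D. D + replicate_mset i V) \<in> Eff (m - i * dg V) \<rightarrow> {D \<in> Eff m. i \<le> count D V}"
      using True V by (auto simp: Eff_def deg_rep split: if_splits)
    show "(\<lambda>D. D - replicate_mset i V) \<in> {D \<in> Eff m. i \<le> count D V} \<rightarrow> Eff (m - i * dg V)"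
    proof
      fix D assume D: "D \<in> {D \<in> Eff m. i \<le> count D V}"
      then have "D - replicate_mset i V + replicate_mset i V = D"
        by (simp add: count_le_replicate_mset_subset_eq subset_mset.diff_add)
      then have "deg D = deg (D - replicate_mset i V) + i * dg V" using deg_rep by metis
      with D show "D - replicate_mset i V \<in> Eff (m - i * dg V)" by (auto simp: Eff_def dest: in_diffD)
    qed
  qed (auto simp: count_le_replicate_mset_subset_eq subset_mset.diff_add)
  then show ?thesis using True by (simp add: bij_betw_same_card)
next
  case False
  have "\<not> i \<le> count D V" if "D \<in> Eff m" for D
  proof
    assume "i \<le> count D V"
    then have "i * dg V \<le> dg V * count D V" by (simp add: mult.commute)
    with count_mult_le[of V D] that False show False by (auto simp: Eff_def)
  qed
  then have "{D \<in> Eff m. i \<le> count D V} = {}" by blast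
  with False show ?thesis by (simp only: card.empty if_False)
qed

text \<open>Coefficientwise form of \<open>u Z'(u) = (\<Sum> N\<^sub>j u\<^sup>j) Z(u)\<close>, by double counting the total degree.\<close>

theorem card_Eff_recurrence: "m * card (Eff m) = (\<Sum>j=1..m. N j * card (Eff (m - j)))"
proof -
  have "m * card (Eff m) = (\<Sum>D\<in>Eff m. deg D)" by (simp add: Eff_def)
  also have "\<dots> = (\<Sum>D\<in>Eff m. \<Sum>V\<in>bounded m. dg V * count D V)"
  proof (rule sum.cong[OF refl])
    fix D assume "D \<in> Eff m"
    then show "deg D = (\<Sum>V\<in>bounded m. dg V * count D V)"
      using Eff_bounded(1) finite_bounded by (intro deg_count_superset)
  qed
  also have "\<dots> = (\<Sum>V\<in>bounded m. dg V * (\<Sum>D\<in>Eff m. count D V))"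
    by (subst sum.swap) (simp add: sum_distrib_left)
  also have "\<dots> = (\<Sum>V\<in>bounded m. dg V * (\<Sum>j | j \<in> {1..m} \<and> dg V dvd j. card (Eff (m - j))))"
  proof (rule sum.cong[OF refl])
    fix V assume "V \<in> bounded m"
    then have V: "V \<in> Pr" "dg V > 0" using dg_pos by (auto simp: bounded_def)
    \<comment> \<open>A multiplicity is the number of \<open>i \<ge> 1\<close> not exceeding it,
      which turns the sum into the counts of \<open>card_Eff_count\<close>.\<close>
    have "(\<Sum>D\<in>Eff m. count D V) = (\<Sum>D\<in>Eff m. \<Sum>i=1..m. if i \<le> count D V then 1 else 0)"
    proof (rule sum.cong[OF refl])
      fix D assume D: "D \<in> Eff m"
      have "{1..m} \<inter> {i. i \<le> count D V} = {1..count D V}" using Eff_bounded(2)[OF D, of V] by auto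
      then show "count D V = (\<Sum>i=1..m. if i \<le> count D V then 1 else 0)" by (simp add: sum.If_cases)
    qed
    also have "\<dots> = (\<Sum>i=1..m. card {D \<in> Eff m. i \<le> count D V})"
      by (subst sum.swap) (simp add: sum.If_cases finite_Eff Int_def)
    also have "\<dots> = (\<Sum>i=1..m. if i * dg V \<le> m then card (Eff (m - i * dg V)) else 0)"
      by (simp add: card_Eff_count[OF V(1)])
    also have "\<dots> = (\<Sum>i | i \<in> {1..m} \<and> i * dg V \<le> m. card (Eff (m - i * dg V)))"
      by (simp add: sum.If_cases Int_def)
    \<comment> \<open>The substitution \<open>j = i * dg V\<close> makes divisibility of
      \<open>j\<close> by the degree appear, the condition in \<open>N\<close>.\<close>
    also have "\<dots> = (\<Sum>j | j \<in> {1..m} \<and> dg V dvd j. card (Eff (m - j)))"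
    proof (rule sum.reindex_bij_witness[of _ "\<lambda>j. j div dg V" "\<lambda>i. i * dg V"])
      fix i assume "i \<in> {i \<in> {1..m}. i * dg V \<le> m}"
      then show "i * dg V div dg V = i" "i * dg V \<in> {j \<in> {1..m}. dg V dvd j}" using V(2) by auto
    next
      fix j assume j: "j \<in> {j \<in> {1..m}. dg V dvd j}"
      then have "j div dg V \<le> m" using div_le_dividend le_trans by (metis (no_types, lifting) atLeastAtMost_iff mem_Collect_eq)
      moreover have "j div dg V \<ge> 1" using j V(2) by (auto simp: dvd_def)
      ultimately show "j div dg V * dg V = j" "j div dg V \<in> {i \<in> {1..m}. i * dg V \<le> m}" using j by auto
    qed auto
    finally show "dg V * (\<Sum>D\<in>Eff m. count D V) = dg V * (\<Sum>j | j \<in> {1..m} \<and> dg V dvd j. card (Eff (m - j)))" by simp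
  qed
  also have "\<dots> = (\<Sum>V\<in>bounded m. \<Sum>j=1..m. if dg V dvd j then dg V * card (Eff (m - j)) else 0)"
    by (simp add: sum.If_cases Int_def sum_distrib_left)
  also have "\<dots> = (\<Sum>j=1..m. \<Sum>V\<in>bounded m. if dg V dvd j then dg V * card (Eff (m - j)) else 0)"
    by (rule sum.swap)
  also have "\<dots> = (\<Sum>j=1..m. N j * card (Eff (m - j)))"
  proof (rule sum.cong[OF refl])
    fix j assume j: "j \<in> {1..m}"
    then have "bounded m \<inter> {V. dg V dvd j} = {V. V \<in> Pr \<and> dg V dvd j}"
      by (auto simp: bounded_def dest: dvd_imp_le)
    then show "(\<Sum>V\<in>bounded m. if dg V dvd j then dg V * card (Eff (m - j)) else 0) = N j * card (Eff (m - j))"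
      using finite_bounded by (simp add: sum.If_cases N_def sum_distrib_right)
  qed
  finally show ?thesis .
qed

end

section \<open>The generating function of effective divisors\<close>

unbundle no vec_syntax

definition geo_fps :: "complex \<Rightarrow> complex fps" where "geo_fps c = Abs_fps (\<lambda>i. c ^ i)"

lemma geo_fps_mult: "geo_fps c * (1 - fps_const c * fps_X) = 1"
proof (rule fps_ext)
  fix m show "(geo_fps c * (1 - fps_const c * fps_X)) $ m = (1 :: complex fps) $ m"
    by (cases m) (auto simp: geo_fps_def right_diff_distrib fps_mult_right_const_nth mult.assoc[symmetric])
qed

lemma fps_deriv_geo_fps: "fps_deriv (geo_fps c) = fps_const c * geo_fps c ^ 2"
proof -
  have "fps_deriv (geo_fps c * (1 - fps_const c * fps_X)) = 0" by (simp add: geo_fps_mult)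
  then have *: "fps_deriv (geo_fps c) * (1 - fps_const c * fps_X) = fps_const c * geo_fps c"
    by (simp add: algebra_simps)
  have "fps_deriv (geo_fps c) = fps_deriv (geo_fps c) * (1 - fps_const c * fps_X) * geo_fps c"
    using geo_fps_mult[of c] by (simp add: mult.assoc mult.commute)
  also have "\<dots> = fps_const c * geo_fps c ^ 2" unfolding * by (simp add: power2_eq_square mult.assoc)
  finally show ?thesis .
qed

lemma geo_fps_conv:
  assumes "norm c * norm u < 1"
  shows "ereal (norm u) < fps_conv_radius (geo_fps c)" "eval_fps (geo_fps c) u = 1 / (1 - c * u)"
proof -
  show "eval_fps (geo_fps c) u = 1 / (1 - c * u)"
    using assms by (simp add: eval_fps_def geo_fps_def power_mult_distrib[symmetric] suminf_geometric norm_mult)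
  show "ereal (norm u) < fps_conv_radius (geo_fps c)"
  proof (cases "c = 0")
    case True
    have "geo_fps 0 = 1" by (rule fps_ext) (simp add: geo_fps_def power_0_left)
    then show ?thesis using True by simp
  next
    case False
    have "ereal (norm u) < ereal (1 / norm c)" using assms False by (simp add: field_simps)
    also have "\<dots> \<le> fps_conv_radius (geo_fps c)"
      unfolding fps_conv_radius_def geo_fps_def
    proof (rule conv_radius_geI_ex)
      fix r :: real assume r: "0 < r" "ereal r < ereal (1 / norm c)"
      then have "norm c * r < 1" using False by (simp add: field_simps)
      then have "summable (\<lambda>i. (c * of_real r) ^ i)" using r by (intro summable_geometric) (simp add: norm_mult)
      then show "\<exists>z. norm z = r \<and> summable (\<lambda>i. fps_nth (Abs_fps (\<lambda>i. c ^ i)) i * z ^ i)"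
        using r by (intro exI[of _ "of_real r"]) (simp add: power_mult_distrib)
    qed
    finally show ?thesis .
  qed
qed

text \<open>The hypotheses record the point counts of the curve with the place at infinity added,
  and \<open>r\<close> is the genus divided by \<open>n\<close>.\<close>

locale zeta_data = graded_primes Pr dg
  for Pr :: "'b set" and dg :: "'b \<Rightarrow> nat" +
  fixes q n r :: nat
  assumes q_gt_1: "q > 1" and n_pos: "n > 0" and r_def: "2 * n * r = q ^ n - 1"
    and N_even: "j > 0 \<Longrightarrow> 2 * n dvd j \<Longrightarrow> N j + (q ^ n - 1) * q ^ (j div 2) = q ^ j + 1"
    and N_odd: "j > 0 \<Longrightarrow> \<not> 2 * n dvd j \<Longrightarrow> N j = q ^ j + 1"
begin

definition Q :: complex where "Q = of_nat (q ^ n)"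

definition lpoly :: "complex poly" where "lpoly = 1 - Polynomial.monom Q (2 * n)"

definition lfac :: "complex fps" where "lfac = 1 - fps_const Q * fps_X ^ (2 * n)"

text \<open>The expansion of 1 / (1 - Q X^(2n)), that is, the inverse of
  \<open>lfac\<close>.\<close>

definition H :: "complex fps" where
  "H = Abs_fps (\<lambda>j. if 2 * n dvd j then Q ^ (j div (2 * n)) else 0)"

definition Z :: "complex fps" where "Z = lfac ^ r * geo_fps 1 * geo_fps (of_nat q)"

lemma H_lfac: "H * lfac = 1"
proof (rule fps_ext)
  fix m
  have "(H * lfac) $ m = H $ m - (if 2 * n \<le> m then Q * H $ (m - 2 * n) else 0)"
    by (simp add: lfac_def right_diff_distrib mult.left_commute[of H] fps_mult_left_const_nth fps_X_power_mult_right_nth)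
  also have "\<dots> = (1 :: complex fps) $ m"
  proof (cases "2 * n \<le> m")
    case True
    then obtain m' where m': "m = m' + 2 * n" by (metis add.commute le_Suc_ex)
    have "2 * n dvd m \<longleftrightarrow> 2 * n dvd m'" unfolding m' by (rule dvd_add_left_iff) simp
    moreover have "m div (2 * n) = Suc (m' div (2 * n))" unfolding m' using n_pos by simp
    ultimately show ?thesis using True n_pos by (simp add: H_def m')
  next
    case False
    then show ?thesis using n_pos by (cases "m = 0") (auto simp: H_def dest: dvd_imp_le)
  qed
  finally show "(H * lfac) $ m = (1 :: complex fps) $ m" .
qed

text \<open>The intended logarithmic derivative X Z' / Z. Its constant term is set to 0 because
  \<open>N 0\<close> has no meaning as a point count.\<close>

definition G :: "complex fps" where "G = Abs_fps (\<lambda>j. if j = 0 then 0 else of_nat (N j))"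

lemma G_eq: "G = fps_X * geo_fps 1 + fps_const (of_nat q) * fps_X * geo_fps (of_nat q)
    - fps_const (Q - 1) * (fps_const Q * fps_X ^ (2 * n) * H)"
proof (rule fps_ext)
  fix j
  define W where "W = fps_const Q * fps_X ^ (2 * n) * H"
  \<comment> \<open>At \<open>j = 2 * n * d\<close> the coefficient is Q^d = q^(j/2), the square
    root of the field size as in the correction term of \<open>N_even\<close>.\<close>
  have third: "W $ j = (if j > 0 \<and> 2 * n dvd j then of_nat (q ^ (j div 2)) else 0)"
  proof (cases "2 * n \<le> j")
    case True
    then obtain m' where m': "j = m' + 2 * n" by (metis add.commute le_Suc_ex)
    have "2 * n dvd j \<longleftrightarrow> 2 * n dvd m'" unfolding m' by (rule dvd_add_left_iff) simp
    moreover have "Q * Q ^ (m' div (2 * n)) = of_nat (q ^ (j div 2))" if dv: "2 * n dvd m'"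
    proof -
      from dv obtain d where d: "m' = 2 * n * d" by (elim dvdE)
      have "j div 2 = n * Suc d" unfolding m' d by simp
      then show ?thesis using n_pos by (simp add: d Q_def power_mult power_add)
    qed
    ultimately show ?thesis using True n_pos unfolding W_def
      by (simp add: mult.assoc fps_mult_left_const_nth fps_X_power_mult_nth H_def m')
  next
    case False
    then show ?thesis unfolding W_def
      by (auto simp: mult.assoc fps_mult_left_const_nth fps_X_power_mult_nth dest: dvd_imp_le)
  qed
  have "(fps_X * geo_fps 1 + fps_const (of_nat q) * fps_X * geo_fps (of_nat q)
    - fps_const (Q - 1) * W) $ j =
     (if j = 0 then 0 else 1 + of_nat q ^ j - (Q - 1) * (if 2 * n dvd j then of_nat (q ^ (j div 2)) else 0))"
    using third by (cases j) (simp_all add: fps_mult_left_const_nth mult.assoc geo_fps_def)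
  also have "\<dots> = G $ j"
  proof (cases "j = 0")
    case False
    define M where "M = q ^ n - 1"
    have Q1: "Q - 1 = of_nat M"
      using q_gt_1 by (simp add: Q_def M_def of_nat_diff Suc_le_eq)
    show ?thesis
    proof (cases "2 * n dvd j")
      case True
      have "of_nat (N j + M * q ^ (j div 2)) = (of_nat (q ^ j + 1) :: complex)"
        using N_even[OF _ True] False unfolding M_def by simp
      then show ?thesis using False True by (simp add: G_def Q1 algebra_simps)
    qed (use False N_odd in \<open>simp add: G_def\<close>)
  qed (simp add: G_def)
  finally show "G $ j = (fps_X * geo_fps 1 + fps_const (of_nat q) * fps_X * geo_fps (of_nat q)
    - fps_const (Q - 1) * (fps_const Q * fps_X ^ (2 * n) * H)) $ j" by (simp add: W_def)
qed

lemma r_pos: "r > 0"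
proof -
  have "q ^ n > 1" using q_gt_1 n_pos by (rule one_less_power)
  with r_def show ?thesis by (cases r) auto
qed

text \<open>Logarithmic derivatives add up over the three factors; the power of \<open>lfac\<close>
  brings in the factor 2nr = Q - 1, which is the multiplicity of the missing points.\<close>

lemma Z_deriv: "fps_X * fps_deriv Z = G * Z"
proof -
  have rQ: "of_nat (2 * n * r) = Q - 1"
    unfolding r_def using q_gt_1 by (simp add: Q_def of_nat_diff Suc_le_eq)
  have "fps_X * fps_deriv lfac = - (fps_const (of_nat (2 * n)) * (fps_const Q * fps_X ^ (2 * n)))"
  proof (rule fps_ext)
    fix i
    have "(fps_X * fps_deriv f) $ i = of_nat i * f $ i" for f :: "complex fps" by (cases i) auto
    then show "(fps_X * fps_deriv lfac) $ i = (- (fps_const (of_nat (2 * n)) * (fps_const Q * fps_X ^ (2 * n)))) $ i"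
      by (auto simp: lfac_def fps_X_power_iff)
  qed
  moreover have "lfac ^ (r - 1) = lfac ^ r * H"
  proof -
    have "lfac ^ r = lfac ^ (r - 1) * lfac" using r_pos by (metis Suc_diff_1 power_Suc2)
    then show ?thesis using H_lfac by (simp add: mult.assoc mult.commute)
  qed
  moreover have "fps_X * fps_deriv (lfac ^ r) = fps_const (of_nat r) * (fps_X * fps_deriv lfac) * lfac ^ (r - 1)"
    unfolding fps_deriv_power by (simp only: mult_ac)
  ultimately have "fps_X * fps_deriv (lfac ^ r) =
      fps_const (of_nat r) * (- (fps_const (of_nat (2 * n)) * (fps_const Q * fps_X ^ (2 * n)))) * (lfac ^ r * H)"
    by metis
  also have "\<dots> = - (fps_const (of_nat r) * fps_const (of_nat (2 * n))) * (fps_const Q * fps_X ^ (2 * n) * H) * lfac ^ r"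
    by (simp only: mult_minus_left mult_minus_right mult_ac)
  also have "fps_const (of_nat r) * fps_const (of_nat (2 * n)) = fps_const (Q - 1)"
    unfolding rQ[symmetric] by (simp add: mult_ac)
  finally have d: "fps_X * fps_deriv (lfac ^ r) = - fps_const (Q - 1) * (fps_const Q * fps_X ^ (2 * n) * H) * lfac ^ r" .
  have "fps_X * fps_deriv Z = (fps_X * fps_deriv (lfac ^ r)) * geo_fps 1 * geo_fps (of_nat q)
     + lfac ^ r * (fps_X * geo_fps 1 ^ 2) * geo_fps (of_nat q)
     + lfac ^ r * geo_fps 1 * (fps_X * (fps_const (of_nat q) * geo_fps (of_nat q) ^ 2))"
    unfolding Z_def fps_deriv_mult fps_deriv_geo_fps by (simp add: algebra_simps)
  also have "\<dots> = G * Z"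
  proof -
    define \<kappa> where "\<kappa> = fps_const (Q - 1)"
    show ?thesis
      unfolding d G_eq Z_def \<kappa>_def[symmetric] by (simp add: algebra_simps power2_eq_square)
  qed
  finally show ?thesis .
qed

text \<open>Both sides equal 1 at \<open>m = 0\<close> and satisfy the same recurrence, given by
  \<open>card_Eff_recurrence\<close> on one side and by the coefficients of \<open>Z_deriv\<close>
  on the other.\<close>

lemma card_Eff_eq: "of_nat (card (Eff m)) = Z $ m"
proof (induction m rule: less_induct)
  case (less m)
  show ?case
  proof (cases "m = 0")
    case True
    then show ?thesis using n_pos by (simp add: Eff_0 Z_def geo_fps_def lfac_def fps_power_zeroth_eq_one)
  next
    case False
    have "of_nat m * of_nat (card (Eff m)) = (\<Sum>j=1..m. of_nat (N j) * (of_nat (card (Eff (m - j))) :: complex))"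
      using arg_cong[OF card_Eff_recurrence[of m], of "of_nat :: nat \<Rightarrow> complex"] by simp
    also have "\<dots> = (\<Sum>j=1..m. G $ j * Z $ (m - j))"
      using less by (intro sum.cong) (auto simp: G_def)
    also have "\<dots> = (\<Sum>j=0..m. G $ j * Z $ (m - j))"
      by (rule sum.mono_neutral_left) (auto simp: G_def Suc_le_eq)
    also have "\<dots> = (fps_X * fps_deriv Z) $ m" by (simp add: Z_deriv fps_mult_nth)
    also have "\<dots> = of_nat m * Z $ m" using False by (cases m) auto
    finally show ?thesis using False by simp
  qed
qed

lemma lfac_poly: "lfac ^ r = fps_of_poly (lpoly ^ r)"
  by (simp add: lfac_def lpoly_def fps_of_poly_power fps_of_poly_diff fps_of_poly_monom)

definition zeta_rat :: "complex \<Rightarrow> complex" where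
  "zeta_rat u = (1 - Q * u ^ (2 * n)) ^ r / ((1 - u) * (1 - of_nat q * u))"

lemma card_Eff_sums:
  assumes "of_nat q * norm u < (1::real)"
  shows "(\<lambda>m. of_nat (card (Eff m)) * u ^ m) sums zeta_rat u"
    "summable (\<lambda>m. norm (of_nat (card (Eff m)) * u ^ m))"
proof -
  have "norm u \<le> of_nat q * norm u" using q_gt_1 by (simp add: mult_le_cancel_right1)
  then have u1: "norm (1::complex) * norm u < 1" using assms by simp
  have u2: "norm (of_nat q :: complex) * norm u < 1" using assms by simp
  note g1 = geo_fps_conv[OF u1] and g2 = geo_fps_conv[OF u2]
  have c1: "ereal (norm u) < fps_conv_radius (lfac ^ r * geo_fps 1)"
    using g1(1) fps_conv_radius_mult[of "lfac ^ r" "geo_fps 1"] by (simp add: lfac_poly)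
  have c2: "ereal (norm u) < fps_conv_radius Z"
    unfolding Z_def using c1 g2(1) fps_conv_radius_mult[of "lfac ^ r * geo_fps 1" "geo_fps (of_nat q)"]
    by (metis less_le_trans min_less_iff_conj)
  have "eval_fps Z u = zeta_rat u"
    unfolding Z_def using c1 g1 g2
    by (simp add: eval_fps_mult lfac_poly eval_fps_of_poly zeta_rat_def lpoly_def poly_monom)
  then show "(\<lambda>m. of_nat (card (Eff m)) * u ^ m) sums zeta_rat u"
    using sums_eval_fps[OF c2] by (simp add: card_Eff_eq)
  show "summable (\<lambda>m. norm (of_nat (card (Eff m)) * u ^ m))"
    using norm_summable_fps[OF c2] by (simp add: card_Eff_eq)
qed

text \<open>The unordered sum is grouped by degree. This is justified by absolute convergence: each
  degree has finitely many divisors, and the power series converges absolutely at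
  \<open>u\<close>.\<close>

theorem infsum_Eff:
  assumes "of_nat q * norm u < (1::real)"
  shows "(\<Sum>\<^sub>\<infinity>D\<in>{D. set_mset D \<subseteq> Pr}. u ^ deg D) = zeta_rat u"
proof -
  have inner: "infsum (\<lambda>D. f (deg D)) (Eff m) = of_nat (card (Eff m)) * f m" for f :: "nat \<Rightarrow> complex" and m
  proof -
    have "infsum (\<lambda>D. f (deg D)) (Eff m) = (\<Sum>D\<in>Eff m. f (deg D))" by (rule infsum_finite[OF finite_Eff])
    also have "\<dots> = (\<Sum>D\<in>Eff m. f m)" by (rule sum.cong) (auto simp: Eff_def)
    finally show ?thesis by simp
  qed
  have inner': "infsum (\<lambda>D. f (deg D)) (Eff m) = of_nat (card (Eff m)) * f m" for f :: "nat \<Rightarrow> real" and m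
  proof -
    have "infsum (\<lambda>D. f (deg D)) (Eff m) = (\<Sum>D\<in>Eff m. f (deg D))" by (rule infsum_finite[OF finite_Eff])
    also have "\<dots> = (\<Sum>D\<in>Eff m. f m)" by (rule sum.cong) (auto simp: Eff_def)
    finally show ?thesis by simp
  qed
  have "(\<lambda>z. norm (case z of (m, D) \<Rightarrow> u ^ deg D)) summable_on Sigma UNIV Eff"
    unfolding Infinite_Sum.abs_summable_on_Sigma_iff
  proof
    show "\<forall>m\<in>UNIV. (\<lambda>D. norm (case (m, D) of (m, D) \<Rightarrow> u ^ deg D)) summable_on Eff m"
      by (simp add: finite_Eff)
    have "summable (\<lambda>m. norm (of_nat (card (Eff m)) * norm u ^ m))"
      using card_Eff_sums(2)[OF assms] by (simp add: norm_mult norm_power)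
    then have "(\<lambda>m. of_nat (card (Eff m)) * norm u ^ m) summable_on UNIV"
      by (rule norm_summable_imp_summable_on)
    then show "(\<lambda>m. norm (infsum (\<lambda>D. norm (case (m, D) of (m, D) \<Rightarrow> u ^ deg D)) (Eff m))) summable_on UNIV"
      using inner'[of "\<lambda>i. norm u ^ i"] by (simp add: norm_power)
  qed
  then have summ: "(\<lambda>(m, D). u ^ deg D) summable_on Sigma UNIV Eff"
    by (rule abs_summable_summable)
  have bij: "bij_betw (\<lambda>D. (deg D, D)) {D. set_mset D \<subseteq> Pr} (Sigma UNIV Eff)"
    by (rule bij_betwI[of _ _ _ snd]) (auto simp: Eff_def)
  have "(\<Sum>\<^sub>\<infinity>D\<in>{D. set_mset D \<subseteq> Pr}. u ^ deg D) = infsum (\<lambda>(m, D). u ^ deg D) (Sigma UNIV Eff)"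
    using infsum_reindex_bij_betw[OF bij, of "\<lambda>(m, D). u ^ deg D"] by simp
  also have "\<dots> = (\<Sum>\<^sub>\<infinity>m. \<Sum>\<^sub>\<infinity>D\<in>Eff m. u ^ deg D)"
    using infsum_Sigma'_banach[OF summ] by simp
  also have "\<dots> = (\<Sum>\<^sub>\<infinity>m. of_nat (card (Eff m)) * u ^ m)"
    using inner[of "\<lambda>i. u ^ i"] by simp
  also have "\<dots> = zeta_rat u"
    using norm_summable_imp_has_sum[OF card_Eff_sums(2)[OF assms] card_Eff_sums(1)[OF assms]] by (rule infsumI)
  finally show ?thesis .
qed

end

text \<open>The difference vanishes near 2, hence off a sparse set by the identity theorem. Thus
  \<open>f\<close> and \<open>g\<close> agree in a punctured neighbourhood of each point, and
  niceness fixes the value there: 0 at a pole, the limit otherwise.\<close>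

lemma nicely_meromorphic_unique:
  assumes f: "f nicely_meromorphic_on UNIV" and g: "g nicely_meromorphic_on UNIV"
    and eq: "\<And>s. Re s > 1 \<Longrightarrow> f s = g s"
  shows "f = g"
proof
  fix z
  have "(\<lambda>s. f s - g s) meromorphic_on UNIV"
    using f g by (intro meromorphic_intros) (auto simp: nicely_meromorphic_on_def)
  then have "(\<forall>\<^sub>\<approx>z\<in>UNIV. f z - g z = 0) \<or> (\<forall>\<^sub>\<approx>z\<in>UNIV. f z - g z \<noteq> 0)"
    by (rule meromorphic_imp_constant_or_avoid) auto
  moreover have "\<not> (\<forall>\<^sub>\<approx>z\<in>UNIV. f z - g z \<noteq> 0)"
  proof
    assume "\<forall>\<^sub>\<approx>z\<in>UNIV. f z - g z \<noteq> 0"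
    then have "eventually (\<lambda>z. f z - g z \<noteq> 0) (at (2::complex))" by (simp add: eventually_cosparse_open_eq)
    moreover have "eventually (\<lambda>z. z \<in> {s. Re s > 1}) (at (2::complex))"
      by (rule eventually_at_in_open') (auto intro: open_halfspace_Re_gt)
    ultimately have "eventually (\<lambda>z. False) (at (2::complex))"
      by eventually_elim (use eq in auto)
    then show False by simp
  qed
  ultimately have "\<forall>\<^sub>\<approx>z\<in>UNIV. f z - g z = 0" by blast
  then have ev: "eventually (\<lambda>w. f w = g w) (at z)" by (simp add: eventually_cosparse_open_eq)
  have pole: "is_pole f z \<longleftrightarrow> is_pole g z" by (rule is_pole_cong[OF ev refl])
  show "f z = g z"
  proof (cases "is_pole f z")
    case True
    have np: "h z = 0" if "is_pole h z" "h nicely_meromorphic_on UNIV" for h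
    proof -
      have "\<not> h \<midarrow>z\<rightarrow> h z"
        using that(1) at_neq_bot not_tendsto_and_filterlim_at_infinity unfolding is_pole_def by blast
      with that(2) show ?thesis by (auto simp: nicely_meromorphic_on_def)
    qed
    show ?thesis using np[of f] np[of g] True pole f g by simp
  next
    case False
    then have "f \<midarrow>z\<rightarrow> f z" "g \<midarrow>z\<rightarrow> g z" using pole f g by (auto simp: nicely_meromorphic_on_def)
    moreover have "f \<midarrow>z\<rightarrow> g z" using tendsto_cong[OF ev] \<open>g \<midarrow>z\<rightarrow> g z\<close> by blast
    ultimately show ?thesis using LIM_unique by blast
  qed
qed

section \<open>Invariance under isomorphisms\<close>

locale ring_isomorphism =
  fixes R :: "'a ring" and S :: "'b ring" and h :: "'a \<Rightarrow> 'b"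
  assumes R: "ring R" and S: "ring S" and h: "h \<in> ring_iso R S"
begin

sublocale hom: ring_hom_ring R S h
  using R S h by (intro ring_hom_ringI2) (auto simp: ring_iso_def)

lemma bij: "bij_betw h (carrier R) (carrier S)"
  using h by (simp add: ring_iso_def)

lemma inj: "inj_on h (carrier R)" and surj: "h ` carrier R = carrier S"
  using bij by (auto simp: bij_betw_def)

abbreviation g :: "'b \<Rightarrow> 'a" where "g \<equiv> inv_into (carrier R) h"

lemma g_iso: "g \<in> ring_iso S R"
  by (rule ring_iso_set_sym[OF R h])

lemma g_h [simp]: "a \<in> carrier R \<Longrightarrow> g (h a) = a"
  by (rule inv_into_f_f[OF inj])

lemma h_g [simp]: "b \<in> carrier S \<Longrightarrow> h (g b) = b"
  using surj by (intro f_inv_into_f) simp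

lemma g_image: "A \<subseteq> carrier R \<Longrightarrow> g ` h ` A = A"
  by (force simp: image_image subset_iff)

lemma h_image: "B \<subseteq> carrier S \<Longrightarrow> h ` g ` B = B"
  by (force simp: image_image subset_iff)

lemma g_closed: "b \<in> carrier S \<Longrightarrow> g b \<in> carrier R"
  using surj by (metis inv_into_into)

sublocale inv: ring_hom_ring S R g
  using R S g_iso by (intro ring_hom_ringI2) (auto simp: ring_iso_def)

lemma inverse_isomorphism: "ring_isomorphism S R g"
  using R S g_iso by unfold_locales

lemma ideal_image: "ideal J R \<Longrightarrow> ideal (h ` J) S"
proof -
  assume J: "ideal J R"
  then have "J \<subseteq> carrier R" by (simp add: ideal.Icarr subsetI)
  then have "{s \<in> carrier S. g s \<in> J} = h ` J"
    using h_g g_h surj by (force simp: subset_iff image_iff)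
  with inv.ideal_vimage[OF J] show ?thesis by simp
qed

lemma maximalideal_image:
  assumes "maximalideal P R"
  shows "maximalideal (h ` P) S"
proof -
  interpret P: maximalideal P R by fact
  have PC: "P \<subseteq> carrier R" using P.Icarr by blast
  show ?thesis
  proof (rule maximalidealI)
    show "ideal (h ` P) S" by (rule ideal_image[OF P.is_ideal])
    show "carrier S \<noteq> h ` P"
    proof
      assume "carrier S = h ` P"
      then have "g ` carrier S = P" using g_image[OF PC] by simp
      moreover have "g ` carrier S = carrier R" using g_image[of "carrier R"] surj by simp
      ultimately show False using P.I_notcarr by simp
    qed
    fix J assume J: "ideal J S" "h ` P \<subseteq> J" "J \<subseteq> carrier S"
    interpret I: ring_isomorphism S R g by (rule inverse_isomorphism)
    have "P \<subseteq> g ` J" using image_mono[OF J(2), of g] g_image[OF PC] by simp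
    moreover have "g ` J \<subseteq> carrier R" using J(3) g_closed by blast
    ultimately have "g ` J = P \<or> g ` J = carrier R" using P.I_maximal I.ideal_image[OF J(1)] by blast
    then show "J = h ` P \<or> J = carrier S" using h_image[OF J(3)] surj by metis
  qed
qed

lemma field_image: "field R \<Longrightarrow> field S"
  using field.ring_iso_imp_img_field[of R h S] h hom.hom_zero by simp

lemma principal_domain_image:
  assumes "principal_domain R"
  shows "principal_domain S"
proof -
  interpret P: principal_domain R by fact
  have "domain S" using domain.ring_iso_imp_img_domain[OF P.domain_axioms h] hom.hom_zero by simp
  then interpret domain S .
  interpret I: ring_isomorphism S R g by (rule inverse_isomorphism)
  show ?thesis
  proof
    fix J assume J: "ideal J S"
    then have JC: "J \<subseteq> carrier S" by (simp add: ideal.Icarr subsetI)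
    obtain a where a: "a \<in> carrier R" "g ` J = PIdl\<^bsub>R\<^esub> a" using P.exists_gen[OF I.ideal_image[OF J]] by blast
    have "J = h ` (PIdl\<^bsub>R\<^esub> a)" using h_image[OF JC] a(2) by simp
    also have "\<dots> = PIdl\<^bsub>S\<^esub> (h a)"
    proof (intro equalityI subsetI)
      fix z assume "z \<in> h ` (PIdl\<^bsub>R\<^esub> a)"
      then obtain w where w: "w \<in> carrier R" "z = h (w \<otimes>\<^bsub>R\<^esub> a)" by (auto simp: cgenideal_def)
      then have "z = h w \<otimes>\<^bsub>S\<^esub> h a" using a(1) by simp
      then show "z \<in> PIdl\<^bsub>S\<^esub> (h a)" using w(1) by (auto simp: cgenideal_def)
    next
      fix z assume "z \<in> PIdl\<^bsub>S\<^esub> (h a)"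
      then obtain w where w: "w \<in> carrier S" "z = w \<otimes>\<^bsub>S\<^esub> h a" by (auto simp: cgenideal_def)
      then have "z = h (g w \<otimes>\<^bsub>R\<^esub> a)" using a(1) g_closed[OF w(1)] by simp
      then show "z \<in> h ` (PIdl\<^bsub>R\<^esub> a)" using g_closed[OF w(1)] by (auto simp: cgenideal_def)
    qed
    finally show "\<exists>a\<in>carrier S. J = PIdl\<^bsub>S\<^esub> a" using a(1) hom.hom_closed by blast
  qed
qed

lemma discrete_valuation_ring_image:
  assumes "discrete_valuation_ring R"
  shows "discrete_valuation_ring S"
    "(THE P. maximalideal P S) = h ` (THE P. maximalideal P R)"
    "maximalideal (THE P. maximalideal P R) R"
proof -
  interpret I: ring_isomorphism S R g by (rule inverse_isomorphism)
  obtain P where P: "maximalideal P R" "\<And>P'. maximalideal P' R \<Longrightarrow> P' = P"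
    using assms by (auto simp: discrete_valuation_ring_def)
  have uniq: "P' = h ` P" if P': "maximalideal P' S" for P'
  proof -
    have "P' \<subseteq> carrier S" using P' unfolding maximalideal_def by (auto dest: ideal.Icarr)
    then show ?thesis using P(2)[OF I.maximalideal_image[OF P']] h_image by metis
  qed
  have "\<not> field S" using assms I.field_image by (auto simp: discrete_valuation_ring_def)
  moreover have "\<exists>!P. maximalideal P S" using maximalideal_image[OF P(1)] uniq by (rule ex1I)
  ultimately show "discrete_valuation_ring S"
    using assms principal_domain_image unfolding discrete_valuation_ring_def by simp
  have R': "(THE P. maximalideal P R) = P" using P by (rule the_equality)
  show "(THE P. maximalideal P S) = h ` (THE P. maximalideal P R)"
    unfolding R' using maximalideal_image[OF P(1)] uniq by (rule the_equality)
  show "maximalideal (THE P. maximalideal P R) R" unfolding R' by (rule P(1))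
qed

lemma card_quotient_image:
  assumes "P \<subseteq> carrier R"
  shows "card (carrier (S Quot (h ` P))) = card (carrier (R Quot P))"
proof -
  have coset: "(h ` P) +>\<^bsub>S\<^esub> h a = h ` (P +>\<^bsub>R\<^esub> a)" if "a \<in> carrier R" for a
    using assms that by (auto simp: a_r_coset_def' image_iff subset_iff)
  have "carrier (S Quot (h ` P)) = (\<lambda>C. h ` C) ` carrier (R Quot P)"
  proof -
    have "carrier (S Quot (h ` P)) = (\<lambda>b. (h ` P) +>\<^bsub>S\<^esub> b) ` h ` carrier R"
      unfolding surj by (auto simp: FactRing_def A_RCOSETS_def')
    also have "\<dots> = (\<lambda>a. h ` (P +>\<^bsub>R\<^esub> a)) ` carrier R"
      unfolding image_image using coset by (rule image_cong[OF refl])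
    also have "\<dots> = (\<lambda>C. h ` C) ` carrier (R Quot P)"
      by (auto simp: FactRing_def A_RCOSETS_def')
    finally show ?thesis .
  qed
  moreover have "inj_on (\<lambda>C. h ` C) (carrier (R Quot P))"
  proof (rule inj_onI)
    fix C C' assume *: "C \<in> carrier (R Quot P)" "C' \<in> carrier (R Quot P)" "h ` C = h ` C'"
    have "C \<subseteq> carrier R" if "C \<in> carrier (R Quot P)" for C
      using that assms by (auto simp: FactRing_def A_RCOSETS_def' a_r_coset_def' subset_iff)
    with * show "C = C'" using g_image by metis
  qed
  ultimately show ?thesis by (simp add: card_image)
qed

end

section \<open>Transport of primes, zeta functions and function fields\<close>

locale field_isomorphism = ring_isomorphism K L h
  for K :: "'a ring" and L :: "'b ring" and h +
  assumes K: "field K"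
begin

lemma L: "field L" by (rule field_image[OF K])

lemma inverse_field_isomorphism: "field_isomorphism L K g"
  using inverse_isomorphism L by (simp add: field_isomorphism_def field_isomorphism_axioms_def)

lemma h_inv: "a \<in> carrier K \<Longrightarrow> a \<noteq> \<zero>\<^bsub>K\<^esub> \<Longrightarrow> h (inv\<^bsub>K\<^esub> a) = inv\<^bsub>L\<^esub> (h a)"
proof -
  assume a: "a \<in> carrier K" "a \<noteq> \<zero>\<^bsub>K\<^esub>"
  interpret K: field K by (rule K)
  interpret L: field L by (rule L)
  have inv: "inv\<^bsub>K\<^esub> a \<in> carrier K" "a \<otimes>\<^bsub>K\<^esub> inv\<^bsub>K\<^esub> a = \<one>\<^bsub>K\<^esub>" using a K.field_Units by auto
  have "h a \<otimes>\<^bsub>L\<^esub> h (inv\<^bsub>K\<^esub> a) = \<one>\<^bsub>L\<^esub>" using inv a hom.hom_mult[of a "inv\<^bsub>K\<^esub> a"] hom.hom_one by simp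
  then show ?thesis using L.comm_inv_char[of "h a" "h (inv\<^bsub>K\<^esub> a)"] a inv by simp
qed

lemma h_nonzero: "a \<in> carrier K \<Longrightarrow> h a = \<zero>\<^bsub>L\<^esub> \<longleftrightarrow> a = \<zero>\<^bsub>K\<^esub>"
  using hom.hom_zero by (metis g_h hom.R.zero_closed)

lemma subring_isomorphism:
  assumes "subring V K"
  shows "subring (h ` V) L" "ring_isomorphism (K\<lparr>carrier := V\<rparr>) (L\<lparr>carrier := h ` V\<rparr>) h"
proof -
  note V = subringE[OF assms]
  show sub: "subring (h ` V) L" by (rule hom.img_is_subring[OF assms])
  show "ring_isomorphism (K\<lparr>carrier := V\<rparr>) (L\<lparr>carrier := h ` V\<rparr>) h"
  proof (rule ring_isomorphism.intro)
    show "ring (K\<lparr>carrier := V\<rparr>)" by (rule hom.R.subring_is_ring[OF assms])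
    show "ring (L\<lparr>carrier := h ` V\<rparr>)" by (rule hom.S.subring_is_ring[OF sub])
    have "inj_on h V" using inj V(1) inj_on_subset by blast
    then show "h \<in> ring_iso (K\<lparr>carrier := V\<rparr>) (L\<lparr>carrier := h ` V\<rparr>)"
      using V(1) by (intro ring_iso_memI) (auto simp: bij_betw_def subset_iff)
  qed
qed

lemma prime_image:
  assumes "V \<in> function_field_primes F K"
  shows "h ` V \<in> function_field_primes (h ` F) L" "prime_norm L (h ` V) = prime_norm K V"
proof -
  have V: "subring V K" "F \<subseteq> V" "discrete_valuation_ring (K\<lparr>carrier := V\<rparr>)"
     "\<And>z. z \<in> carrier K \<Longrightarrow> \<exists>a\<in>V. \<exists>b\<in>V - {\<zero>\<^bsub>K\<^esub>}. z = a \<otimes>\<^bsub>K\<^esub> inv\<^bsub>K\<^esub> b"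
    using assms by (auto simp: function_field_primes_def)
  have VC: "V \<subseteq> carrier K" using subringE(1)[OF V(1)] .
  interpret K: field K by (rule K)
  interpret sub: ring_isomorphism "K\<lparr>carrier := V\<rparr>" "L\<lparr>carrier := h ` V\<rparr>" h
    by (rule subring_isomorphism(2)[OF V(1)])
  note dvr = sub.discrete_valuation_ring_image[OF V(3)]
  have "\<exists>a\<in>h ` V. \<exists>b\<in>h ` V - {\<zero>\<^bsub>L\<^esub>}. z = a \<otimes>\<^bsub>L\<^esub> inv\<^bsub>L\<^esub> b" if z: "z \<in> carrier L" for z
  proof -
    obtain a b where ab: "a \<in> V" "b \<in> V" "b \<noteq> \<zero>\<^bsub>K\<^esub>" "g z = a \<otimes>\<^bsub>K\<^esub> inv\<^bsub>K\<^esub> b" using V(4)[OF g_closed[OF z]] by blast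
    have c: "a \<in> carrier K" "b \<in> carrier K" "inv\<^bsub>K\<^esub> b \<in> carrier K" using ab VC K.field_Units by auto
    have "z = h a \<otimes>\<^bsub>L\<^esub> inv\<^bsub>L\<^esub> (h b)"
      using h_g[OF z] ab(4) hom.hom_mult[OF c(1,3)] h_inv[OF c(2) ab(3)] by simp
    moreover have "h b \<noteq> \<zero>\<^bsub>L\<^esub>" using h_nonzero c(2) ab(3) by simp
    ultimately show ?thesis using ab by blast
  qed
  then show "h ` V \<in> function_field_primes (h ` F) L"
    using subring_isomorphism(1)[OF V(1)] V(2) dvr(1) by (auto simp: function_field_primes_def)
  have "(THE P. maximalideal P (K\<lparr>carrier := V\<rparr>)) \<subseteq> V"
    using dvr(3) by (auto simp: maximalideal_def dest: ideal.Icarr)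
  then show "prime_norm L (h ` V) = prime_norm K V"
    using sub.card_quotient_image by (simp add: prime_norm_def residue_field_def dvr(2))
qed

text \<open>Primes correspond by taking images, with the same norms, so the two Dirichlet series
  agree and the definite descriptions of the zeta functions have the same condition.\<close>

lemma zeta_image:
  assumes F: "F \<subseteq> carrier K"
  shows "function_field_zeta (h ` F) L = function_field_zeta F K"
proof -
  interpret I: field_isomorphism L K g by (rule inverse_field_isomorphism)
  have primeC: "V \<subseteq> carrier K" if "V \<in> function_field_primes F K" for V
    using that by (auto simp: function_field_primes_def dest: subringE(1))
  have primeC': "V \<subseteq> carrier L" if "V \<in> function_field_primes (h ` F) L" for V
    using that by (auto simp: function_field_primes_def dest: subringE(1))
  have bk: "g ` V \<in> function_field_primes F K" if "V \<in> function_field_primes (h ` F) L" for V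
    using I.prime_image(1)[OF that] g_image[OF F] by simp
  have bij: "bij_betw (image_mset ((`) h)) (effective_divisors F K) (effective_divisors (h ` F) L)"
  proof (rule bij_betwI[of _ _ _ "image_mset ((`) g)"])
    show "image_mset ((`) h) \<in> effective_divisors F K \<rightarrow> effective_divisors (h ` F) L"
      using prime_image(1) by (auto simp: effective_divisors_def subset_iff)
    show "image_mset ((`) g) \<in> effective_divisors (h ` F) L \<rightarrow> effective_divisors F K"
      using bk by (auto simp: effective_divisors_def subset_iff)
    show "image_mset ((`) g) (image_mset ((`) h) D) = D" if "D \<in> effective_divisors F K" for D
    proof -
      have "image_mset (\<lambda>V. g ` h ` V) D = image_mset id D"
      proof (rule image_mset_cong)
        fix V assume "V \<in># D"
        then have "V \<in> function_field_primes F K" using that by (auto simp: effective_divisors_def)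
        then show "g ` h ` V = id V" using g_image[OF primeC] by simp
      qed
      then show ?thesis by (simp add: image_mset.compositionality o_def)
    qed
    show "image_mset ((`) h) (image_mset ((`) g) D) = D" if "D \<in> effective_divisors (h ` F) L" for D
    proof -
      have "image_mset (\<lambda>V. h ` g ` V) D = image_mset id D"
      proof (rule image_mset_cong)
        fix V assume "V \<in># D"
        then have "V \<in> function_field_primes (h ` F) L" using that by (auto simp: effective_divisors_def)
        then show "h ` g ` V = id V" using h_image[OF primeC'] by simp
      qed
      then show ?thesis by (simp add: image_mset.compositionality o_def)
    qed
  qed
  have norm: "divisor_norm L (image_mset ((`) h) D) = divisor_norm K D" if "D \<in> effective_divisors F K" for D
  proof -
    have "image_mset (\<lambda>V. prime_norm L (h ` V)) D = image_mset (prime_norm K) D"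
      using that prime_image(2) by (intro image_mset_cong) (auto simp: effective_divisors_def)
    then show ?thesis by (simp add: divisor_norm_def image_mset.compositionality o_def)
  qed
  have "(\<Sum>\<^sub>\<infinity>D\<in>effective_divisors (h ` F) L. of_nat (divisor_norm L D) powr (- s)) =
        (\<Sum>\<^sub>\<infinity>D\<in>effective_divisors F K. of_nat (divisor_norm K D) powr (- s))" for s :: complex
    using infsum_reindex_bij_betw[OF bij, of "\<lambda>D. of_nat (divisor_norm L D) powr (- s)", symmetric] norm
    by (simp cong: infsum_cong)
  then show ?thesis by (simp add: function_field_zeta_def)
qed

lemma generate_field_image_subset:
  assumes "H \<subseteq> carrier K"
  shows "h ` generate_field K H \<subseteq> generate_field L (h ` H)"
proof
  interpret K: field K by (rule K)
  fix z assume "z \<in> h ` generate_field K H"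
  then obtain w where w: "w \<in> generate_field K H" "z = h w" by blast
  have "h w \<in> generate_field L (h ` H)"
    using w(1)
  proof induction
    case one then show ?case using hom.hom_one generate_field.one[of L] by simp
  next
    case (incl w) then show ?case by (intro generate_field.incl) auto
  next
    case (a_inv w)
    then show ?case using hom.hom_a_inv[of w] K.generate_field_in_carrier[OF assms] generate_field.a_inv[of "h w" L] by simp
  next
    case (m_inv w)
    then have "w \<in> carrier K" using K.generate_field_in_carrier[OF assms] by blast
    then show ?case using m_inv h_inv[of w] h_nonzero[of w] generate_field.m_inv[of "h w" L] by simp
  next
    case (eng_add w1 w2)
    then show ?case using hom.hom_add[of w1 w2] K.generate_field_in_carrier[OF assms] generate_field.eng_add[of "h w1" L _ "h w2"] by simp
  next
    case (eng_mult w1 w2)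
    then show ?case using hom.hom_mult[of w1 w2] K.generate_field_in_carrier[OF assms] generate_field.eng_mult[of "h w1" L _ "h w2"] by simp
  qed
  with w show "z \<in> generate_field L (h ` H)" by simp
qed

lemma generate_field_image:
  assumes H: "H \<subseteq> carrier K"
  shows "generate_field L (h ` H) = h ` generate_field K H"
proof
  interpret K: field K by (rule K)
  interpret L: field L by (rule L)
  interpret I: field_isomorphism L K g by (rule inverse_field_isomorphism)
  have HC: "h ` H \<subseteq> carrier L" using H by auto
  have "g ` generate_field L (h ` H) \<subseteq> generate_field K H"
    using I.generate_field_image_subset[OF HC] g_image[OF H] by simp
  then show "generate_field L (h ` H) \<subseteq> h ` generate_field K H"
    using h_image[OF L.generate_field_incl[OF HC]] by (metis image_mono)
  show "h ` generate_field K H \<subseteq> generate_field L (h ` H)" by (rule generate_field_image_subset[OF H])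
qed

lemma algebraic_image:
  assumes F: "subfield F K" and b: "b \<in> carrier L" and alg: "ring.algebraic L (h ` F) b"
  shows "ring.algebraic K F (g b)"
proof -
  interpret K: field K by (rule K)
  interpret L: field L by (rule L)
  have "subfield (h ` F) L" using hom.img_is_subfield(2)[OF F] L.one_not_zero by simp
  moreover have "g \<in> Ring.ring_hom L K" using g_iso by (simp add: ring_iso_def)
  ultimately have "(ring.algebraic K over (g ` h ` F)) (g b)"
    using algebraic_hom[of g L K "h ` F" b] L K b alg by (simp add: over_def)
  then show ?thesis using g_image[OF subfieldE(3)[OF F]] by (simp add: over_def)
qed

theorem global_function_field_image:
  assumes "global_function_field q F K"
  shows "global_function_field q (h ` F) L"
proof -
  interpret K: field K by (rule K)
  interpret L: field L by (rule L)
  have ff: "subfield F K" and const: "\<And>a. a \<in> carrier K \<Longrightarrow> ring.algebraic K F a \<Longrightarrow> a \<in> F" and F: "finite F" "card F = q"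
    using assms by (auto simp: global_function_field_def function_field_def)
  obtain x where x: "x \<in> carrier K" "ring.transcendental K F x"
     "ring.finite_dimension K (generate_field K (insert x F)) (carrier K)"
    using assms by (auto simp: global_function_field_def function_field_def)
  have FC: "F \<subseteq> carrier K" using subfieldE(3)[OF ff] .
  have sub: "subfield (h ` F) L" using hom.img_is_subfield(2)[OF ff] L.one_not_zero by simp
  have "ring.transcendental L (h ` F) (h x)"
  proof (rule ccontr)
    assume "\<not> ring.transcendental L (h ` F) (h x)"
    then have "ring.algebraic K F (g (h x))" using algebraic_image[OF ff hom.hom_closed[OF x(1)]] by blast
    then show False using x by simp
  qed
  moreover have "ring.finite_dimension L (generate_field L (insert (h x) (h ` F))) (carrier L)"
  proof -
    have iF: "insert x F \<subseteq> carrier K" using x FC by simp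
    obtain d where d: "ring.dimension K d (generate_field K (insert x F)) (carrier K)"
      using x(3) by (auto simp: hom.R.finite_dimension_def)
    have "ring.dimension L d (h ` generate_field K (insert x F)) (h ` carrier K)"
      using hom.inj_hom_dimension[OF K.generate_field_is_subfield[OF iF] L.one_not_zero inj d] .
    then show ?thesis
      using generate_field_image[OF iF] surj by (auto simp: hom.S.finite_dimension_def)
  qed
  ultimately have "function_field (h ` F) L"
    unfolding function_field_def using L sub x(1) by (auto intro!: bexI[of _ "h x"])
  moreover have "a \<in> h ` F" if "a \<in> carrier L" "ring.algebraic L (h ` F) a" for a
    using const[OF g_closed[OF that(1)] algebraic_image[OF ff that]] that(1) by (metis h_g image_eqI)
  moreover have "finite (h ` F)" "card (h ` F) = q"
    using F card_image[OF inj_on_subset[OF inj FC]] by auto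
  ultimately show ?thesis by (simp add: global_function_field_def)
qed

end

text \<open>Isomorphism classes are taken among rings on natural numbers, whereas the curves give
  subsets of another type; the structure is carried over along an enumeration.\<close>

lemma countable_field_copy:
  fixes K :: "'a ring"
  assumes K: "field K" and count: "countable (carrier K)"
  obtains N :: "nat ring" and h where "field_isomorphism K N h"
proof -
  interpret K: field K by (rule K)
  define h where "h = to_nat_on (carrier K)"
  define g where "g = inv_into (carrier K) h"
  define N :: "nat ring" where "N = \<lparr>carrier = h ` carrier K, monoid.mult = (\<lambda>a b. h (g a \<otimes>\<^bsub>K\<^esub> g b)),
      one = h \<one>\<^bsub>K\<^esub>, ring.zero = h \<zero>\<^bsub>K\<^esub>, add = (\<lambda>a b. h (g a \<oplus>\<^bsub>K\<^esub> g b))\<rparr>"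
  have inj: "inj_on h (carrier K)" unfolding h_def by (rule inj_on_to_nat_on[OF count])
  have gh: "a \<in> carrier K \<Longrightarrow> g (h a) = a" for a unfolding g_def by (rule inv_into_f_f[OF inj])
  have iso: "h \<in> ring_iso K N"
    using inj by (intro ring_iso_memI) (auto simp: N_def gh bij_betw_def)
  \<comment> \<open>\<open>ring_iso_imp_img_field\<close> yields a field only after resetting zero
    to the image of zero, which changes nothing here.\<close>
  have "N\<lparr>zero := h \<zero>\<^bsub>K\<^esub>\<rparr> = N" by (simp add: N_def)
  then have "field N" using K.ring_iso_imp_img_field[OF iso] by simp
  then have "field_isomorphism K N h"
    using iso K field.is_ring[OF K] field.is_ring[OF \<open>field N\<close>]
    by (intro field_isomorphism.intro ring_isomorphism.intro field_isomorphism_axioms.intro)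
  then show ?thesis by (rule that)
qed

section \<open>Zeta values in the critical strip\<close>

lemma nat_power_powr: "q > 0 \<Longrightarrow> (of_nat (q ^ m) :: complex) powr z = (of_nat q powr z) ^ m"
proof -
  assume q: "q > 0"
  have "(of_nat (q ^ m) :: complex) powr z = exp (z * of_real (ln (real (q ^ m))))"
    using q Ln_of_nat[of "q ^ m"] unfolding powr_def by (simp del: of_nat_power)
  also have "ln (real (q ^ m)) = real m * ln (real q)" using q by (simp add: ln_realpow)
  also have "exp (z * of_real (real m * ln (real q))) = exp (z * of_real (ln (real q))) ^ m"
    by (simp add: exp_of_nat_mult[symmetric] mult_ac)
  also have "exp (z * of_real (ln (real q))) = of_nat q powr z" using q by (simp add: powr_def Ln_of_nat)
  finally show ?thesis .
qed

lemma first_nonzero_taylor_coeff_nonzero: "f z \<noteq> 0 \<Longrightarrow> first_nonzero_taylor_coeff f z = f z"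
proof -
  assume f: "f z \<noteq> 0"
  have 0: "fps_nth (fps_expansion f z) 0 = f z" by (simp add: fps_expansion_def)
  then have "subdegree (fps_expansion f z) = 0" using f by (simp add: subdegree_eq_0)
  then show ?thesis by (simp add: first_nonzero_taylor_coeff_def 0)
qed

context zeta_data
begin

text \<open>\<open>remove_sings\<close> takes limits where they exist and 0 at poles, the normal
  form required by \<open>function_field_zeta\<close>.\<close>

definition zeta_fun :: "complex \<Rightarrow> complex" where
  "zeta_fun = remove_sings (\<lambda>s. zeta_rat (of_nat q powr (- s)))"

lemma zeta_rat_analytic:
  assumes "of_nat q powr (- s) \<noteq> (1::complex)" "of_nat q * of_nat q powr (- s) \<noteq> (1::complex)"
  shows "(\<lambda>s. zeta_rat (of_nat q powr (- s))) analytic_on {s}"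
  unfolding zeta_rat_def powr_def using q_gt_1 assms
  by (auto intro!: analytic_intros simp: powr_def)

lemma zeta_fun_eq:
  assumes "of_nat q powr (- s) \<noteq> (1::complex)" "of_nat q * of_nat q powr (- s) \<noteq> (1::complex)"
  shows "zeta_fun s = zeta_rat (of_nat q powr (- s))"
  unfolding zeta_fun_def using zeta_rat_analytic[OF assms] by (rule remove_sings_at_analytic)

lemma zeta_fun_nicely_meromorphic: "zeta_fun nicely_meromorphic_on UNIV"
  unfolding zeta_fun_def
proof (rule remove_sings_nicely_meromorphic)
  have "(\<lambda>s. of_nat q powr (- s) :: complex) meromorphic_on UNIV"
    unfolding powr_def using q_gt_1 by (intro analytic_on_imp_meromorphic_on) (auto intro!: analytic_intros)
  then show "(\<lambda>s. zeta_rat (of_nat q powr (- s))) meromorphic_on UNIV"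
    unfolding zeta_rat_def by (intro meromorphic_intros)
qed

text \<open>The numerator is (1 - w)^r with w = (q u^2)^n, and \<sigma> > 1/2 gives 0 < w < 1. From
  1 - w \<le> exp(-w) and r \<ge> q^n / (4n) comes the exponent w q^n / (4n) = ((q u)^2)^n /
  (4n).\<close>

lemma zeta_fun_bound:
  fixes \<sigma> :: real
  assumes \<sigma>: "1 / 2 < \<sigma>" "\<sigma> < 1"
  defines "u \<equiv> real q powr (- \<sigma>)"
  shows "zeta_fun (of_real \<sigma>) \<noteq> 0"
    "norm (zeta_fun (of_real \<sigma>)) \<le> exp (- (((real q * u) ^ 2) ^ n / (4 * real n))) / (\<bar>1 - u\<bar> * \<bar>1 - real q * u\<bar>)"
proof -
  have uc: "of_nat q powr (- of_real \<sigma>) = (of_real u :: complex)"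
    using q_gt_1 powr_of_real[of "real q" "- \<sigma>"] by (simp add: u_def)
  have u0: "u > 0" using q_gt_1 by (simp add: u_def)
  have "u < real q powr 0" unfolding u_def using \<sigma> q_gt_1 by (intro powr_less_mono) auto
  then have u1: "u < 1" using q_gt_1 by simp
  have qu: "real q * u = real q powr (1 - \<sigma>)" using q_gt_1 by (simp add: u_def powr_diff powr_minus divide_inverse)
  have "real q powr 0 < real q powr (1 - \<sigma>)" using \<sigma> q_gt_1 by (intro powr_less_mono) auto
  then have qu1: "real q * u > 1" using q_gt_1 qu by simp
  define \<rho> where "\<rho> = real q * u ^ 2"
  have "u ^ 2 = real q powr (- 2 * \<sigma>)"
    unfolding u_def power2_eq_square powr_add[symmetric] by simp
  then have "\<rho> = real q powr (1 - 2 * \<sigma>)"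
    using q_gt_1 by (simp add: \<rho>_def powr_diff powr_minus divide_inverse)
  moreover have "real q powr (1 - 2 * \<sigma>) < real q powr 0" using \<sigma> q_gt_1 by (intro powr_less_mono) auto
  ultimately have \<rho>: "0 < \<rho>" "\<rho> < 1" using q_gt_1 u0 by (auto simp: \<rho>_def)
  define w where "w = \<rho> ^ n"
  have w: "0 < w" "w < 1" using \<rho> n_pos by (auto simp: w_def power_less_one_iff)
  have eq: "zeta_fun (of_real \<sigma>) = of_real ((1 - w) ^ r / ((1 - u) * (1 - real q * u)))"
  proof -
    have ne: "(of_real u :: complex) \<noteq> 1" "of_nat q * of_real u \<noteq> (1 :: complex)"
    proof -
      show "(of_real u :: complex) \<noteq> 1" using u1 by (metis of_real_eq_1_iff less_irrefl)
      have "of_nat q * of_real u = (of_real (real q * u) :: complex)" by simp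
      then show "of_nat q * of_real u \<noteq> (1 :: complex)" using qu1 by (metis of_real_eq_1_iff less_irrefl)
    qed
    have "zeta_fun (of_real \<sigma>) = zeta_rat (of_real u)" using zeta_fun_eq[of "of_real \<sigma>"] ne by (simp add: uc)
    also have "\<dots> = of_real ((1 - w) ^ r / ((1 - u) * (1 - real q * u)))"
    proof -
      have "w = real q ^ n * u ^ (2 * n)" unfolding w_def \<rho>_def power_mult_distrib power_mult ..
      then have "Q * of_real u ^ (2 * n) = (of_real w :: complex)" by (simp add: Q_def)
      then show ?thesis by (simp add: zeta_rat_def)
    qed
    finally show ?thesis .
  qed
  show "zeta_fun (of_real \<sigma>) \<noteq> 0" unfolding eq of_real_eq_0_iff using w u1 qu1 by simp
  have "(1 - w) ^ r \<le> exp (- w) ^ r" using w exp_ge_add_one_self[of "- w"] by (intro power_mono) auto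
  also have "\<dots> = exp (- (w * real r))" by (simp add: exp_of_nat_mult[symmetric] mult.commute)
  also have "\<dots> \<le> exp (- (((real q * u) ^ 2) ^ n / (4 * real n)))"
  proof -
    have "real (2 * n * r) = real (q ^ n) - 1" unfolding r_def using q_gt_1 by (simp add: of_nat_diff Suc_le_eq)
    then have "real r = (real (q ^ n) - 1) / (2 * real n)" using n_pos by (simp add: field_simps)
    \<comment> \<open>This crude halving accounts for the 4 in place of 2 in the bound.\<close>
    moreover have "real (q ^ n) - 1 \<ge> real (q ^ n) / 2"
    proof -
      have "q ^ n > 1" using q_gt_1 n_pos by (rule one_less_power)
      then have "real (q ^ n) \<ge> 2" by linarith
      then show ?thesis by simp
    qed
    ultimately have "real r \<ge> real (q ^ n) / 2 / (2 * real n)" by (metis divide_right_mono of_nat_0_le_iff of_nat_mult of_nat_numeral)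
    then have "w * (real (q ^ n) / 2 / (2 * real n)) \<le> w * real r" using w by (intro mult_left_mono) auto
    moreover have "w * (real (q ^ n) / 2 / (2 * real n)) = ((real q * u) ^ 2) ^ n / (4 * real n)"
      by (simp add: w_def \<rho>_def power_mult_distrib power2_eq_square)
    ultimately have "((real q * u) ^ 2) ^ n / (4 * real n) \<le> w * real r" by (simp only:)
    then show ?thesis by simp
  qed
  finally have "(1 - w) ^ r \<le> exp (- (((real q * u) ^ 2) ^ n / (4 * real n)))" .
  moreover have "norm (zeta_fun (of_real \<sigma>)) = (1 - w) ^ r / (\<bar>1 - u\<bar> * \<bar>1 - real q * u\<bar>)"
    unfolding eq norm_of_real using w by (simp add: abs_mult)
  ultimately show "norm (zeta_fun (of_real \<sigma>)) \<le> exp (- (((real q * u) ^ 2) ^ n / (4 * real n))) / (\<bar>1 - u\<bar> * \<bar>1 - real q * u\<bar>)"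
    by (simp add: divide_right_mono)
qed

end

text \<open>On Re s > 1 the series in the norms is the sum of \<open>infsum_Eff\<close> at u =
  q^(-s), as |q u| < 1 there; uniqueness of the continuation settles the definite
  description.\<close>

lemma function_field_zeta_eq:
  assumes "zeta_data Pr dg q n r"
    and Pr: "Pr = function_field_primes F K" and norm: "\<And>V. V \<in> Pr \<Longrightarrow> prime_norm K V = q ^ dg V"
  shows "function_field_zeta F K = zeta_data.zeta_fun q n r"
proof -
  interpret zeta_data Pr dg q n r by fact
  have eff: "effective_divisors F K = {D. set_mset D \<subseteq> Pr}" by (simp add: effective_divisors_def Pr)
  have nm: "divisor_norm K D = q ^ deg D" if "set_mset D \<subseteq> Pr" for D
    using that by (induction D) (auto simp: divisor_norm_def deg_def norm power_add)
  have series: "(\<Sum>\<^sub>\<infinity>D\<in>effective_divisors F K. of_nat (divisor_norm K D) powr (- s)) = zeta_fun s" if s: "Re s > 1" for s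
  proof -
    define u where "u = (of_nat q powr (- s) :: complex)"
    have nu: "norm u = real q powr (- Re s)" using q_gt_1 by (simp add: u_def norm_powr_real_powr)
    have "real q * norm u = real q powr (1 - Re s)" using q_gt_1 by (simp add: nu powr_diff powr_minus divide_inverse)
    also have "\<dots> < real q powr 0" using s q_gt_1 by (intro powr_less_mono) auto
    finally have qu: "real q * norm u < 1" using q_gt_1 by simp
    have "norm u \<le> real q * norm u" using q_gt_1 by (simp add: mult_le_cancel_right1)
    then have "u \<noteq> 1" "of_nat q * u \<noteq> 1" using qu by (auto simp: norm_mult dest: arg_cong[where f = norm])
    then have "zeta_fun s = zeta_rat u" using zeta_fun_eq[of s] by (simp add: u_def)
    also have "\<dots> = (\<Sum>\<^sub>\<infinity>D\<in>{D. set_mset D \<subseteq> Pr}. u ^ deg D)" using infsum_Eff[OF qu] by simp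
    also have "\<dots> = (\<Sum>\<^sub>\<infinity>D\<in>{D. set_mset D \<subseteq> Pr}. of_nat (divisor_norm K D) powr (- s))"
    proof (rule infsum_cong)
      fix D assume "D \<in> {D. set_mset D \<subseteq> Pr}"
      then have "divisor_norm K D = q ^ deg D" using nm by simp
      then show "u ^ deg D = of_nat (divisor_norm K D) powr (- s)"
        using q_gt_1 nat_power_powr[of q "deg D" "- s"] by (simp add: u_def)
    qed
    finally show ?thesis by (simp add: eff)
  qed
  show ?thesis
    unfolding function_field_zeta_def
  proof (rule the_equality)
    show "zeta_fun nicely_meromorphic_on UNIV \<and> (\<forall>s. Re s > 1 \<longrightarrow> zeta_fun s =
        (\<Sum>\<^sub>\<infinity>D\<in>effective_divisors F K. of_nat (divisor_norm K D) powr (- s)))"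
      using zeta_fun_nicely_meromorphic series by simp
    fix f assume "f nicely_meromorphic_on UNIV \<and> (\<forall>s. Re s > 1 \<longrightarrow> f s =
        (\<Sum>\<^sub>\<infinity>D\<in>effective_divisors F K. of_nat (divisor_norm K D) powr (- s)))"
    then show "f = zeta_fun"
      using zeta_fun_nicely_meromorphic series by (intro nicely_meromorphic_unique) auto
  qed
qed

text \<open>Exponential growth beats linear growth, so the exponent tends to minus infinity along
  all \<open>n\<close> and in particular along the powers of two.\<close>

lemma bound_tendsto_0:
  fixes c C :: real
  assumes "c > 1"
  shows "(\<lambda>a. exp (- (c ^ (2 ^ a) / (4 * real (2 ^ a)))) / C) \<longlonglongrightarrow> 0"
proof -
  have "(\<lambda>n. real n / c ^ n) \<longlonglongrightarrow> 0" using assms by (intro lim_n_over_pown) simp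
  then have "(\<lambda>n. 4 * (real n / c ^ n)) \<longlonglongrightarrow> 4 * 0" by (intro tendsto_intros)
  then have t: "(\<lambda>n. 4 * real n / c ^ n) \<longlonglongrightarrow> 0" by simp
  have "LIM n sequentially. inverse (4 * real n / c ^ n) :> at_top"
    using assms by (intro filterlim_inverse_at_top[OF t] eventually_sequentiallyI[of 1]) auto
  then have "LIM n sequentially. c ^ n / (4 * real n) :> at_top" by (simp add: inverse_eq_divide)
  then have "((\<lambda>n. exp (- (c ^ n / (4 * real n)))) \<longlonglongrightarrow> 0)"
    by (intro filterlim_compose[OF exp_at_bot] filterlim_compose[OF filterlim_uminus_at_bot_at_top])
  then have l: "(\<lambda>n. exp (- (c ^ n / (4 * real n))) / C) \<longlonglongrightarrow> 0"
    using tendsto_divide_zero by blast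
  have "strict_mono (\<lambda>a::nat. (2::nat) ^ a)" by (simp add: strict_mono_def)
  from LIMSEQ_subseq_LIMSEQ[OF l this] show ?thesis by (simp add: o_def)
qed

text \<open>Squaring Q turns Q - 1 into (Q - 1)(Q + 1), and the even factor Q + 1 supplies the next
  2. This makes (q^n - 1) / (2n), the exponent of the numerator, an integer.\<close>

lemma two_power_dvd: "odd (q::nat) \<Longrightarrow> 2 * 2 ^ a dvd q ^ (2 ^ a) - 1"
proof (induction a)
  case (Suc a)
  define Q where "Q = q ^ (2 ^ a)"
  have "odd Q" using Suc.prems by (simp add: Q_def)
  have "q ^ (2 ^ Suc a) - 1 = (Q - 1) * (Q + 1)"
    using \<open>odd Q\<close> by (cases Q) (auto simp: Q_def power_mult power2_eq_square power_add mult_2 algebra_simps)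
  moreover have "2 * 2 ^ a dvd Q - 1" using Suc by (simp add: Q_def)
  moreover have "2 dvd Q + 1" using \<open>odd Q\<close> by simp
  ultimately have "(2 * 2 ^ a) * 2 dvd q ^ (2 ^ Suc a) - 1" by (metis mult_dvd_mono)
  then show ?case by (simp add: mult_ac)
qed simp

context curve
begin

lemma countable_function_field_set: "countable function_field_set"
proof -
  have "FP \<subseteq> Poly ` lists (Fix 1)"
  proof
    fix f assume "f \<in> FP"
    then have "set (coeffs f) \<subseteq> Fix 1" by (auto simp: coeffs_def FP_def)
    then have "coeffs f \<in> lists (Fix 1)" by auto
    then show "f \<in> Poly ` lists (Fix 1)" by (metis Poly_coeffs image_eqI)
  qed
  moreover have "countable (lists (Fix 1))" using card_Fix[of 1] by (simp add: countable_finite)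
  ultimately have FP: "countable FP" by (meson countable_image countable_subset)
  have "coord_ring = (\<lambda>(u, v). cv u v x y) ` (FP \<times> FP)" by (auto simp: coord_ring_def)
  then have A: "countable coord_ring" using FP by simp
  have "function_field_set \<subseteq> (\<lambda>(f, g). f / g) ` (coord_ring \<times> coord_ring)"
    by (auto simp: function_field_set_def fractions_def)
  then show ?thesis using A by (meson countable_SIGMA countable_image countable_subset)
qed

lemma zeta_data_curve: "zeta_data primes prime_deg q n ((q ^ n - 1) div (2 * n))"
proof -
  interpret graded_primes primes prime_deg
    using primes_count by unfold_locales auto
  have N: "N j = card (pts j) + 1" if "j > 0" for j
    unfolding N_def by (rule primes_count(3)[OF that])
  show ?thesis
  proof
    show "q > 1" "n > 0" using q_gt_1 n_pos by auto
    show "2 * n * ((q ^ n - 1) div (2 * n)) = q ^ n - 1"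
      using two_power_dvd[OF odd_q, of s] by (simp add: n_def)
    show "N j = q ^ j + 1" if "j > 0" "\<not> 2 * n dvd j" for j
      using N[OF that(1)] card_pts_odd[OF that] by simp
    show "N j + (q ^ n - 1) * q ^ (j div 2) = q ^ j + 1" if j: "j > 0" "2 * n dvd j" for j
    proof -
      obtain h where h: "j = 2 * (n * h)" using j(2) by (metis dvdE mult.assoc)
      then have "j div 2 = n * h" by simp
      then show ?thesis using N[OF j(1)] card_pts_even[OF j(1) h] by simp
    qed
  qed
qed

end

context frobenius_field
begin

text \<open>The equation \<open>z ^ q = z\<close> that cuts out the constants is preserved by
  \<open>g\<close>, and cardinalities agree. So an isomorphism between two of the curves' fields
  respects the constants that enter the zeta function.\<close>

lemma Fix_iso_image:
  assumes K: "subfield_set K" "Fix 1 \<subseteq> K" and L: "subfield_set L" "Fix 1 \<subseteq> L"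
    and g: "g \<in> ring_iso (ring_on K) (ring_on (L :: 'a set))"
  shows "g ` Fix 1 = Fix 1"
proof (rule card_subset_eq)
  have KR: "subring_set K" using K(1) by (rule subfield_setD)
  have hom: "g 1 = 1" "\<And>a b. a \<in> K \<Longrightarrow> b \<in> K \<Longrightarrow> g (a * b) = g a * g b" and inj: "inj_on g K"
    using g by (auto simp: ring_iso_def Ring.ring_hom_def bij_betw_def)
  have pw: "g (z ^ m) = g z ^ m" if "z \<in> K" for z m
    using that by (induction m) (auto simp: hom subring_setD(7)[OF KR])
  show "finite (Fix 1)" using card_Fix[of 1] by simp
  show "g ` Fix 1 \<subseteq> Fix 1"
  proof
    fix w assume "w \<in> g ` Fix 1"
    then obtain z where z: "w = g z" "z \<in> Fix 1" by blast
    then have "z \<in> K" "z ^ (q ^ 1) = z" using K(2) unfolding Fix_def by blast+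
    then show "w \<in> Fix 1" using pw[of z "q ^ 1"] z(1) by (simp add: Fix_def)
  qed
  show "card (g ` Fix 1) = card (Fix 1)" using inj_on_subset[OF inj K(2)] by (rule card_image)
qed

end

text \<open>The conditions on \<open>x\<close> are the ones easily checked in a concrete field; they
  amount to transcendence over the constants, because nonzero algebraic elements are roots of
  unity.\<close>

theorem not_northcott_of_transcendental:
  fixes x :: "'a::alg_closed_field" and \<sigma> B :: real
  assumes char: "Factorial_Ring.prime CHAR('a)" "q = CHAR('a) ^ k" "k > 0" and q4: "q mod 4 = 1"
    and x: "x \<noteq> 0" "\<And>N. N > 0 \<Longrightarrow> x ^ N \<noteq> 1"
    and B: "B > 0" and \<sigma>: "1 / 2 < \<sigma>" "\<sigma> < 1"
  shows "\<not> northcott_property q (complex_of_real \<sigma>) B"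
proof
  assume north: "northcott_property q (complex_of_real \<sigma>) B"
  interpret frobenius_field q k "TYPE('a)" using char by unfold_locales
  \<comment> \<open>A root of a nonzero member of \<open>FP\<close> lies in some
    \<open>Fix j\<close>, where nonzero elements have order dividing q^j - 1.\<close>
  have transc: "f = 0" if f: "f \<in> FP" "poly f x = 0" for f
  proof (rule ccontr)
    assume "f \<noteq> 0"
    then obtain j where j: "j > 0" "x \<in> Fix j" using algebraic_Fix f by metis
    have "q ^ j > 1" using q_gt_1 j(1) by (rule one_less_power)
    then obtain N where N: "q ^ j = Suc N" "N > 0" by (cases "q ^ j") auto
    then have "x ^ N * x = 1 * x" using j(2) by (simp add: Fix_def)
    then have "x ^ N = 1" using x(1) by simp
    with x(2) N(2) show False by simp
  qed
  define y where "y a = (SOME y. y ^ 2 = x ^ (q ^ (2 ^ a)) - x)" for a :: nat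
  have y: "y a ^ 2 = x ^ (q ^ (2 ^ a)) - x" for a
  proof -
    have "\<exists>y. y ^ 2 = x ^ (q ^ (2 ^ a)) - x" by (rule nth_root_exists) simp
    then show ?thesis unfolding y_def by (rule someI_ex)
  qed
  have curve: "curve q k (2 ^ a) a x (y a)" for a
    using q4 transc y by unfold_locales auto
  define K where "K a = curve.function_field_set q x (y a)" for a
  have KF: "subfield_set (K a)" "Fix 1 \<subseteq> K a" "countable (K a)" "global_function_field q (Fix 1) (ring_on (K a))" for a
  proof -
    interpret C: curve q k "TYPE('a)" "2 ^ a" a x "y a" by (rule curve)
    show "subfield_set (K a)" "countable (K a)" "global_function_field q (Fix 1) (ring_on (K a))"
      unfolding K_def using C.function_field_set_subfield C.countable_function_field_set C.global_function_field_curve by auto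
    show "Fix 1 \<subseteq> K a" unfolding K_def using C.coord_ring_const C.coord_ring_subset by blast
  qed
  define u where "u = real q powr (- \<sigma>)"
  define val where "val a = first_nonzero_taylor_coeff (function_field_zeta (Fix 1) (ring_on (K a))) (of_real \<sigma>)" for a
  define bd where "bd a = exp (- (((real q * u) ^ 2) ^ (2 ^ a) / (4 * real (2 ^ a)))) / (\<bar>1 - u\<bar> * \<bar>1 - real q * u\<bar>)" for a :: nat
  have val: "val a \<noteq> 0" "norm (val a) \<le> bd a" for a
  proof -
    interpret C: curve q k "TYPE('a)" "2 ^ a" a x "y a" by (rule curve)
    interpret Z: zeta_data C.primes C.prime_deg q "2 ^ a" "(q ^ (2 ^ a) - 1) div (2 * 2 ^ a)"
      by (rule C.zeta_data_curve)
    have "function_field_zeta (Fix 1) (ring_on (K a)) = Z.zeta_fun"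
      unfolding K_def using C.primes_count(1) by (intro function_field_zeta_eq[OF C.zeta_data_curve]) auto
    then have "val a = Z.zeta_fun (of_real \<sigma>)"
      unfolding val_def using first_nonzero_taylor_coeff_nonzero Z.zeta_fun_bound(1)[OF \<sigma>] by simp
    then show "val a \<noteq> 0" "norm (val a) \<le> bd a"
      using Z.zeta_fun_bound[OF \<sigma>] by (auto simp: bd_def u_def)
  qed
  have "bd \<longlonglongrightarrow> 0"
  proof -
    have "real q * u = real q powr (1 - \<sigma>)" using q_gt_1 by (simp add: u_def powr_diff powr_minus divide_inverse)
    moreover have "real q powr 0 < real q powr (1 - \<sigma>)" using \<sigma> q_gt_1 by (intro powr_less_mono) auto
    ultimately have "(real q * u) ^ 2 > 1" using q_gt_1 by (simp add: one_less_power)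
    then show ?thesis unfolding bd_def by (rule bound_tendsto_0)
  qed
  then have small: "eventually (\<lambda>a. norm (val a) < \<epsilon>) sequentially" if "\<epsilon> > 0" for \<epsilon>
    using order_tendstoD(2)[of bd 0 sequentially \<epsilon>] that val(2) by (auto elim!: eventually_mono intro: le_less_trans)
  have "\<exists>(N :: nat ring) h. field_isomorphism (ring_on (K a)) N h" for a
  proof -
    have "countable (carrier (ring_on (K a)))" using KF(3) by simp
    with field_ring_on[OF KF(1)] obtain N :: "nat ring" and h where "field_isomorphism (ring_on (K a)) N h"
      by (rule countable_field_copy)
    then show ?thesis by blast
  qed
  then obtain N :: "nat \<Rightarrow> nat ring" and h where iso: "field_isomorphism (ring_on (K a)) (N a) (h a)" for a by metis
  have N: "global_function_field q (h a ` Fix 1) (N a)"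
      "zeta_special_value (h a ` Fix 1) (N a) (of_real \<sigma>) = val a" for a
  proof -
    interpret field_isomorphism "ring_on (K a)" "N a" "h a" by (rule iso)
    show "global_function_field q (h a ` Fix 1) (N a)" by (rule global_function_field_image[OF KF(4)])
    show "zeta_special_value (h a ` Fix 1) (N a) (of_real \<sigma>) = val a"
      using zeta_image[of "Fix 1"] KF(2) by (simp add: zeta_special_value_def val_def)
  qed
  \<comment> \<open>An isomorphism of the copies is pulled back to the original fields, since
    \<open>Fix_iso_image\<close> speaks of subsets of one type.\<close>
  have inv: "val a = val b" if ab: "N a \<simeq> N b" for a b
  proof -
    interpret A: field_isomorphism "ring_on (K a)" "N a" "h a" by (rule iso)
    interpret Bi: field_isomorphism "ring_on (K b)" "N b" "h b" by (rule iso)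
    obtain \<theta> where \<theta>: "\<theta> \<in> ring_iso (N a) (N b)" using ab by (auto simp: is_ring_iso_def)
    define g where "g = Bi.g \<circ> (\<theta> \<circ> h a)"
    have g: "g \<in> ring_iso (ring_on (K a)) (ring_on (K b))"
      unfolding g_def by (intro ring_iso_set_trans[OF ring_iso_set_trans[OF A.h \<theta>] Bi.g_iso])
    have "field_isomorphism (ring_on (K a)) (ring_on (K b)) g"
      using g field_ring_on[OF KF(1), of a] field_ring_on[OF KF(1), of b]
      by (intro field_isomorphism.intro ring_isomorphism.intro field_isomorphism_axioms.intro field.is_ring)
    then interpret G: field_isomorphism "ring_on (K a)" "ring_on (K b)" g .
    have "g ` Fix 1 = Fix 1" by (rule Fix_iso_image[OF KF(1,2) KF(1,2) g])
    then show ?thesis using G.zeta_image[of "Fix 1"] KF(2)[of a] by (simp add: val_def)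
  qed
  define S where "S = {a. norm (val a) \<le> B}"
  define cls where "cls a = function_field_iso_rel q `` {N a}" for a
  have "eventually (\<lambda>a. a \<in> S) sequentially"
    using small[OF B] by eventually_elim (simp add: S_def)
  then have infS: "infinite S" by (metis eventually_mono[of _ sequentially] finite_nat_set_iff_bounded eventually_sequentially less_irrefl le_less_trans nat_le_linear)
  have "cls ` S \<subseteq> northcott_set q (of_real \<sigma>) B"
  proof (rule image_subsetI)
    fix a assume "a \<in> S"
    then have "\<exists>F. global_function_field q F (N a) \<and> norm (zeta_special_value F (N a) (of_real \<sigma>)) \<le> B"
      using N[of a] by (intro exI[of _ "h a ` Fix 1"]) (simp add: S_def)
    then show "cls a \<in> northcott_set q (of_real \<sigma>) B"
      unfolding northcott_set_def cls_def by (auto intro!: quotientI)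
  qed
  then have "finite (cls ` S)" using north finite_subset by (auto simp: northcott_property_def)
  \<comment> \<open>With finitely many classes, some class occurs for infinitely many
    \<open>a\<close>, and \<open>val\<close> is constant along these.\<close>
  from pigeonhole_infinite[OF infS this] obtain a0 where a0: "a0 \<in> S" "infinite {a \<in> S. cls a = cls a0}" by blast
  have same: "val a = val a0" if "cls a = cls a0" for a
  proof -
    have "(N a0, N a0) \<in> function_field_iso_rel q"
      using N(1)[of a0] ring_iso_refl by (auto simp: function_field_iso_rel_def)
    then have "N a0 \<in> cls a" using that by (auto simp: cls_def)
    then have "N a \<simeq> N a0" by (auto simp: cls_def function_field_iso_rel_def)
    then show ?thesis by (rule inv)
  qed
  \<comment> \<open>As \<open>val a0\<close> is nonzero, its modulus is a legitimate threshold, and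
    beyond \<open>m\<close> the value \<open>val a0\<close> cannot recur.\<close>
  obtain m where m: "\<And>a. a \<ge> m \<Longrightarrow> norm (val a) < norm (val a0)"
    using small[of "norm (val a0)"] val(1)[of a0] by (auto simp: eventually_sequentially)
  obtain a where "a \<ge> m" "cls a = cls a0"
    using a0(2) by (metis (mono_tags, lifting) finite_nat_set_iff_bounded linorder_not_le mem_Collect_eq)
  with m[of a] same[of a] show False by simp
qed

section \<open>The field of the right characteristic\<close>

definition northcott_counterexample :: "nat \<Rightarrow> bool" where
  "northcott_counterexample q \<longleftrightarrow> primepow q \<and> q mod 4 = 1 \<and>
     (\<exists>\<sigma> B. B > 0 \<and> 1 / 2 < \<sigma> \<and> \<sigma> < 1 \<and> northcott_property q (complex_of_real \<sigma>) B)"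

text \<open>A type cannot depend on the number \<open>q\<close> of the theorem. To get the algebraically closed field of the
  right characteristic as a type, fix one global \<open>q\<close>, chosen to be a counterexample if there is any;
  refuting this one suffices.\<close>

definition critical_q :: nat where
  "critical_q = (if \<exists>q. northcott_counterexample q then SOME q. northcott_counterexample q else 5)"

lemma critical_q: "primepow critical_q" "critical_q mod 4 = 1"
    "northcott_counterexample q \<Longrightarrow> northcott_counterexample critical_q"
proof -
  have *: "northcott_counterexample critical_q" if "\<exists>q. northcott_counterexample q"
    unfolding critical_q_def using that by (simp add: someI_ex)
  then show "northcott_counterexample q \<Longrightarrow> northcott_counterexample critical_q" by blast
  \<comment> \<open>The default 5 is a prime congruent to 1 modulo 4, so the first two facts hold
    even if there is no counterexample.\<close>
  have "Factorial_Ring.prime (5::nat)" by (rule prime_nat_numeral_eq[THEN iffD2]) simp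
  then have "primepow (5::nat)" by (rule primepow_prime)
  then show "primepow critical_q" "critical_q mod 4 = 1"
    using * by (cases "\<exists>q. northcott_counterexample q"; auto simp: northcott_counterexample_def critical_q_def)+
qed

definition critical_p :: nat where
  "critical_p = (SOME p. Factorial_Ring.prime p \<and> (\<exists>k>0. critical_q = p ^ k))"

lemma critical_p: "Factorial_Ring.prime critical_p" "\<exists>k>0. critical_q = critical_p ^ k"
proof -
  have "\<exists>p. Factorial_Ring.prime p \<and> (\<exists>k>0. critical_q = p ^ k)"
    using critical_q(1) by (auto simp: primepow_def)
  from someI_ex[OF this] show "Factorial_Ring.prime critical_p" "\<exists>k>0. critical_q = critical_p ^ k"
    by (auto simp: critical_p_def)
qed

text \<open>An index type of prime cardinality \<open>critical_p\<close>, which makes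
  \<open>mod_ring\<close> over it the prime field of the required characteristic.\<close>

typedef critical_index = "{0..<critical_p}"
  using prime_gt_0_nat[OF critical_p(1)] by auto

lemma card_critical_index: "CARD(critical_index) = critical_p"
  using type_definition.card[OF type_definition_critical_index] by simp

instance critical_index :: prime_card
  by standard (simp add: card_critical_index critical_p)

lemma not_northcott_critical:
  assumes "B > 0" "1 / 2 < \<sigma>" "\<sigma> < 1"
  shows "\<not> northcott_property critical_q (complex_of_real \<sigma>) B"
proof -
  obtain k where k: "k > 0" "critical_q = critical_p ^ k" using critical_p(2) by blast
  \<comment> \<open>The algebraic closure of the Laurent series over the prime field contains the
    series variable, whose positive powers have nonzero subdegree and so differ from 1.\<close>
  define x :: "critical_index mod_ring fls alg_closure" where "x = to_ac fls_X"
  have char: "CHAR(critical_index mod_ring fls alg_closure) = critical_p"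
    by (simp add: card_critical_index)
  have "x ^ N \<noteq> 1" if "N > 0" for N
  proof
    assume "x ^ N = 1"
    then have "to_ac (fls_X ^ N :: critical_index mod_ring fls) = to_ac 1" by (simp add: x_def)
    then have "(fls_X ^ N :: critical_index mod_ring fls) = 1" by (simp only: to_ac_eq_iff)
    then have "fls_subdegree (fls_X ^ N :: critical_index mod_ring fls) = 0" by simp
    with that show False by simp
  qed
  moreover have "x \<noteq> 0" by (simp add: x_def)
  ultimately show ?thesis
    using not_northcott_of_transcendental[of critical_q k x B \<sigma>] char critical_p(1) k critical_q(2) assms by simp
qed

theorem theorem5p4:
  fixes q :: nat and \<sigma> B :: real
  assumes "primepow q" and "q mod 4 = 1"
    and "B > 0" and "1 / 2 < \<sigma>" and "\<sigma> < 1"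
  shows "\<not> northcott_property q (complex_of_real \<sigma>) B"
proof
  assume "northcott_property q (complex_of_real \<sigma>) B"
  then have "northcott_counterexample q" using assms by (auto simp: northcott_counterexample_def)
  then have "northcott_counterexample critical_q" by (rule critical_q(3))
  then show False using not_northcott_critical by (auto simp: northcott_counterexample_def)
qed

end
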